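(* Let $p\ge1$ and let $f(x)$, $x\in\mathbb{R}^m$, be an almost periodic function by Stepanoff (of order $p$) on $\mathbb{R}^m$ with Fourier series $\sum_{n=0}^\infty a_ne^{i\langle x,\lambda_n\rangle}$, and suppose there is $C<\infty$ with $\|\lambda_n\|\le C$ for all $n$. Then $f$ extends to $\mathbb{C}^m$ as an entire function $F(z)$ of exponential type (with $F(x)=f(x)$ on $\mathbb{R}^m$), which is almost periodic by Bohr on every tube domain in $\mathbb{C}^m$ with bounded base; $F$ has Dirichlet series $\sum_{n=0}^\infty a_ne^{i\langle z,\lambda_n\rangle}$; and the $P$-indicator of $F$ satisfies $h_F(y)=H_{\operatorname{sp} f}(-y)$ for all $y\in\mathbb{R}^m$, where $H_{\operatorname{sp} f}(\mu)=\sup_{x\in\operatorname{sp} f}\langle x,\mu\rangle$ is the support function of $\operatorname{sp} f$.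
   Context: For $K\subset\mathbb{R}^m$, $T_K=\{x+iy:x\in\mathbb{R}^m,y\in K\}$ (a tube domain with base $K$). A continuous $g$ on $T_K$ is almost periodic by Bohr if for every $\varepsilon>0$ there is $l>0$ such that every $m$-dimensional cube of side $l$ in $\mathbb{R}^m$ contains $\tau$ with $\sup_{z\in T_K}|g(z+\tau)-g(z)|<\varepsilon$. A locally integrable $f$ on $\mathbb{R}^m$ is almost periodic by Stepanoff of order $p$ if for every $\varepsilon>0$ there is $l$ such that every cube of side $l$ contains $\tau$ with $\sup_{x\in\mathbb{R}^m}\big(\int_{[0,1]^m}|f(x+u+\tau)-f(x+u)|^pdu\big)^{1/p}<\varepsilon$. Fourier coefficients: $a(\lambda)=\lim_{N\to\infty}(2N)^{-m}\int_{[-N,N]^m}f(x+x')e^{-i\langle x+x',\lambda\rangle}dx$ (uniform in and independent of $x'$); the spectrum $\operatorname{sp} f$ is the set of $\lambda$ with $a(\lambda)\ne0$, enumerated as $\lambda_n$, $a_n=a(\lambda_n)$. The $P$-indicator of an entire function $F$ on $\mathbb{C}^m$ is $h_F(y)=\sup_{x\in\mathbb{R}^m}\limsup_{r\to\infty}\frac1r\log|F(x+iry)|$. *)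

theory Defs
  imports "HOL-Analysis.Analysis"
begin

definition cvec :: "real^'m \<Rightarrow> complex^'m" where
  "cvec x = (\<chi> i. complex_of_real (x $ i))"

definition imvec :: "complex^'m \<Rightarrow> real^'m" where
  "imvec z = (\<chi> i. Im (z $ i))"

definition cinner :: "complex^'m \<Rightarrow> real^'m \<Rightarrow> complex" where
  "cinner z l = (\<Sum>i\<in>UNIV. z $ i * complex_of_real (l $ i))"

definition cube :: "real^'m \<Rightarrow> real \<Rightarrow> (real^'m) set" where
  "cube a l = cbox a (a + l *\<^sub>R One)"

definition tube :: "(real^'m) set \<Rightarrow> (complex^'m) set" where
  "tube K = {z. imvec z \<in> K}"

text \<open>entire function on C^m: complex (Frechet) differentiable at every point,
  i.e. real differentiable with complex-linear derivative\<close>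
definition entire_fn :: "(complex^'m \<Rightarrow> complex) \<Rightarrow> bool" where
  "entire_fn F \<longleftrightarrow> (\<forall>z. \<exists>D. (F has_derivative D) (at z) \<and>
      (\<forall>c v. D (c *s v) = c * D v))"

definition exponential_type :: "(complex^'m \<Rightarrow> complex) \<Rightarrow> bool" where
  "exponential_type F \<longleftrightarrow> (\<exists>A B. \<forall>z. norm (F z) \<le> A * exp (B * norm z))"

definition bohr_ap_tube :: "(real^'m) set \<Rightarrow> (complex^'m \<Rightarrow> complex) \<Rightarrow> bool" where
  "bohr_ap_tube K g \<longleftrightarrow> continuous_on (tube K) g \<and>
     (\<forall>\<epsilon>>0. \<exists>l>0. \<forall>a. \<exists>\<tau>\<in>cube a l.
        (SUP z\<in>tube K. ereal (norm (g (z + cvec \<tau>) - g z))) < ereal \<epsilon>)"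

definition locally_integrable :: "(real^'m \<Rightarrow> complex) \<Rightarrow> bool" where
  "locally_integrable f \<longleftrightarrow> (\<forall>a b. f absolutely_integrable_on cbox a b)"

text \<open>Stepanoff almost periodicity of order p. The condition
  sup_x (int |f(x+u+tau)-f(x+u)|^p du)^(1/p) < eps is written equivalently
  (by monotonicity of t -> t^(1/p)) as sup_x int ... < eps^p, in ennreal.\<close>
definition stepanoff_ap :: "real \<Rightarrow> (real^'m \<Rightarrow> complex) \<Rightarrow> bool" where
  "stepanoff_ap p f \<longleftrightarrow> locally_integrable f \<and>
     (\<forall>\<epsilon>>0. \<exists>l>0. \<forall>a. \<exists>\<tau>\<in>cube a l.
        (SUP x. (\<integral>\<^sup>+ u\<in>cbox 0 One. ennreal (norm (f (x + u + \<tau>) - f (x + u)) powr p) \<partial>lborel))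
          < ennreal (\<epsilon> powr p))"

definition fourier_avg :: "(real^'m \<Rightarrow> complex) \<Rightarrow> real^'m \<Rightarrow> real \<Rightarrow> complex" where
  "fourier_avg f l N = complex_of_real (1 / (2 * N) ^ CARD('m)) *
     integral (cbox (- (N *\<^sub>R One)) (N *\<^sub>R One)) (\<lambda>x. f x * exp (- \<i> * complex_of_real (x \<bullet> l)))"

definition fourier_coeff :: "(real^'m \<Rightarrow> complex) \<Rightarrow> real^'m \<Rightarrow> complex" where
  "fourier_coeff f l = Lim at_top (fourier_avg f l)"

definition spectrum_ap :: "(real^'m \<Rightarrow> complex) \<Rightarrow> (real^'m) set" where
  "spectrum_ap f = {l. fourier_coeff f l \<noteq> 0}"

definition dirichlet_avg :: "(complex^'m \<Rightarrow> complex) \<Rightarrow> real^'m \<Rightarrow> real^'m \<Rightarrow> real \<Rightarrow> complex" where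
  "dirichlet_avg F y l N = complex_of_real (1 / (2 * N) ^ CARD('m)) *
     integral (cbox (- (N *\<^sub>R One)) (N *\<^sub>R One))
       (\<lambda>x. F (cvec x + \<i> *s cvec y) * exp (- \<i> * cinner (cvec x + \<i> *s cvec y) l))"

definition P_indicator :: "(complex^'m \<Rightarrow> complex) \<Rightarrow> real^'m \<Rightarrow> ereal" where
  "P_indicator F y = (SUP x. Limsup at_top (\<lambda>r::real.
      let w = F (cvec x + \<i> *s cvec (r *\<^sub>R y)) in
      if w = 0 then -\<infinity> else ereal (ln (norm w) / r)))"

definition support_fn :: "(real^'m) set \<Rightarrow> real^'m \<Rightarrow> ereal" where
  "support_fn S \<mu> = (SUP l\<in>S. ereal (l \<bullet> \<mu>))"

end

theory Submission
  imports Defs "HOL-Complex_Analysis.Conformal_Mappings"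
begin

text \<open>Averaging \<open>f\<close> over small cubes gives a Bohr almost periodic function \<open>g\<close> whose Fourier coefficients
  are those of \<open>f\<close> times factors bounded away from \<open>0\<close> on the spectrum. Convolving \<open>g\<close> in the mean with an
  almost periodic kernel concentrated on the almost periods of \<open>g\<close> gives an absolutely summable Fourier
  series (Cauchy-Schwarz and Bessel), which by uniqueness sums to the convolution; so \<open>g\<close> is a uniform limit
  of trigonometric polynomials with frequencies in the spectrum of \<open>f\<close>. Since the spectrum is bounded,
  Bernstein's inequality allows the cube average to be undone: the corresponding polynomials for \<open>f\<close> are
  uniformly Cauchy on the real space, hence by the maximum principle in a half-plane on every tube with
  bounded base, and their limit is \<open>F\<close>. The same maximum principle bounds the indicator from above. From
  below, a Phragmen-Lindelof argument turns growth along the single rays \<open>x + i r y\<close> into a bound uniform in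
  \<open>x\<close>, and the Fourier coefficients of \<open>F\<close> on the horizontal planes then force the frequencies into the
  corresponding half-space.

  Uniqueness is proved by sampling on a fine grid: there the many almost periods make the autocorrelation
  large in \<open>l\<^sup>2\<close>, so by Plancherel on a finite group some frequency has a coefficient bounded below; a limit of
  such frequencies over growing cubes is a frequency with nonzero coefficient.\<close>

section \<open>Averages over cubes\<close>

text \<open>A function that is not identically zero has positive mean square, but Plancherel alone
  leaves open that this mass is spread thinly over the ever more numerous frequencies of a growing
  grid. The fourth moment excludes it: the almost periods on the grid are a fixed proportion of all
  grid points, which yields a coefficient bounded below independently of the grid. Undoing the cube
  average is a contraction argument. By Bernstein, a polynomial with frequencies of norm at most
  \<open>C\<close> varies by at most half its supremum on a cube whose side \<open>d\<close>
  satisfies \<open>d * CARD('m) * exp C \<le> 1 / 2\<close>; so averaging loses at most a factor 2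
  in the sup norm, whatever the number of frequencies. The factor \<open>exp C\<close> comes from
  Cauchy's estimate on a unit disc. In the indicator the limsup is taken separately for each
  \<open>x\<close>, with thresholds that need not be uniform. Phragmen-Lindelof removes them, since
  the constant it returns is the bound on the real space. The Stepanoff condition does not see null
  sets, so \<open>F\<close> agrees with \<open>f\<close> almost everywhere.\<close>

definition echar :: "real^'m \<Rightarrow> real^'m \<Rightarrow> complex" where
  "echar l x = cis (x \<bullet> l)"

lemma echar_add: "echar l (x + y) = echar l x * echar l y"
  by (simp add: echar_def inner_add_left cis_mult)

lemma norm_echar [simp]: "norm (echar l x) = 1"
  by (simp add: echar_def)

lemma echar_zero [simp]: "echar l 0 = 1" "echar 0 x = 1"
  by (simp_all add: echar_def)

lemma echar_minus: "echar (- l) x = cnj (echar l x)"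
  by (simp add: echar_def cis_cnj)

lemma echar_mult: "echar l x * echar l' x = echar (l + l') x"
  by (simp add: echar_def inner_add_right cis_mult)

lemma echar_cancel [simp]: "echar l x * echar (- l) x = 1" "echar (- l) x * echar l x = 1"
  by (simp_all add: echar_mult)

lemma continuous_on_echar [continuous_intros]:
  "continuous_on S g \<Longrightarrow> continuous_on S (\<lambda>x. echar l (g x))"
  unfolding echar_def cis_conv_exp by (intro continuous_intros)

lemma norm_cis_diff_le: "norm (cis a - cis b) \<le> \<bar>a - b\<bar>"
proof -
  have "norm (cis a - cis b) = norm (cis b * (cis (a - b) - 1))"
    by (simp add: algebra_simps cis_mult)
  also have "\<dots> = norm (exp (\<i> * complex_of_real (a - b)) - 1)"
    by (simp add: norm_mult cis_conv_exp)
  also have "\<dots> = 2 * \<bar>sin ((a - b) / 2)\<bar>"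
    by (metis norm_exp_i_times dist_exp_i_1 mult.commute dist_norm)
  also have "\<dots> \<le> \<bar>a - b\<bar>"
    using abs_sin_le_one abs_sin_x_le_abs_x[of "(a - b) / 2"] by simp
  finally show ?thesis .
qed

lemma norm_echar_diff_le: "norm (echar l x - echar l' y) \<le> \<bar>x \<bullet> l - y \<bullet> l'\<bar>"
  unfolding echar_def by (rule norm_cis_diff_le)

section \<open>Averages over centred cubes\<close>

definition cub :: "real \<Rightarrow> (real^'m) set" where
  "cub N = cbox (- (N *\<^sub>R One)) (N *\<^sub>R One)"

lemma sum_Basis_nth [simp]: "(\<Sum>b\<in>Basis. (b :: real^'m) $ i) = 1"
proof -
  have "(\<Sum>b\<in>Basis. (b :: real^'m) $ i) = (One :: real^'m) \<bullet> axis i 1"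
    by (simp add: cart_eq_inner_axis inner_sum_left)
  also have "\<dots> = 1"
  proof -
    have "One \<bullet> b = 1" if "b \<in> Basis" for b :: "real^'m"
      using that by (simp add: inner_sum_left inner_Basis)
    thus ?thesis by (auto simp: axis_in_Basis_iff)
  qed
  finally show ?thesis .
qed

lemma mem_cub: "x \<in> cub N \<longleftrightarrow> (\<forall>i. \<bar>x $ i\<bar> \<le> N)"
  by (auto simp: cub_def mem_box_cart abs_le_iff minus_le_iff)

lemma content_cub: "N \<ge> 0 \<Longrightarrow> measure lborel (cub N :: (real^'m) set) = (2 * N) ^ CARD('m)"
  unfolding cub_def by (subst content_cbox_cart) (auto simp: interval_ne_empty_cart)

definition boxavg :: "real \<Rightarrow> (real^'m \<Rightarrow> complex) \<Rightarrow> complex" where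
  "boxavg N g = complex_of_real (1 / (2 * N) ^ CARD('m)) * integral (cub N) g"

lemma integrable_cub: "continuous_on UNIV g \<Longrightarrow> g integrable_on (cub N)"
  for g :: "real^'m \<Rightarrow> 'b::banach"
  unfolding cub_def by (intro integrable_continuous) (auto intro: continuous_on_subset)

lemma boxavg_add:
  assumes "continuous_on UNIV f" "continuous_on UNIV g"
  shows "boxavg N (\<lambda>x. f x + g x) = boxavg N f + boxavg N g"
  unfolding boxavg_def using assms by (simp only: integral_add integrable_cub distrib_left)

lemma boxavg_cmult: "boxavg N (\<lambda>x. c * f x) = c * boxavg N f"
  unfolding boxavg_def by simp

lemma boxavg_diff:
  assumes "continuous_on UNIV f" "continuous_on UNIV g"
  shows "boxavg N (\<lambda>x. f x - g x) = boxavg N f - boxavg N g"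
  unfolding boxavg_def using assms by (simp only: integral_diff integrable_cub right_diff_distrib)

lemma norm_boxavg_le:
  assumes "continuous_on UNIV (f :: real^'m \<Rightarrow> complex)" "N > 0" "\<And>x. x \<in> cub N \<Longrightarrow> norm (f x) \<le> B"
  shows "norm (boxavg N f) \<le> B"
proof -
  have "norm (integral (cub N) f) \<le> integral (cub N :: (real^'m) set) (\<lambda>x. B)"
    using assms by (intro integral_norm_bound_integral integrable_cub) auto
  also have "\<dots> = B * (2 * N) ^ CARD('m)"
    using assms(2) content_cub[of N, where 'm='m] by (simp add: cub_def)
  finally show ?thesis
    using assms(2) by (simp add: boxavg_def norm_mult norm_power norm_divide) (simp add: field_simps)
qed

lemma boxavg_const: "N > 0 \<Longrightarrow> boxavg N (\<lambda>x :: real^'m. c) = c"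
  unfolding boxavg_def using content_cub[of N, where 'm='m] by (simp add: cub_def scaleR_conv_of_real)

lemma boxavg_swap:
  fixes \<Phi> :: "real^'m \<Rightarrow> real^'m \<Rightarrow> complex"
  assumes "continuous_on UNIV (\<lambda>(x, y). \<Phi> x y)"
  shows "boxavg N (\<lambda>x. boxavg L (\<Phi> x)) = boxavg L (\<lambda>y. boxavg N (\<lambda>x. \<Phi> x y))"
proof -
  have "integral (cub N) (\<lambda>x. integral (cub L) (\<Phi> x)) = integral (cub L) (\<lambda>y. integral (cub N) (\<lambda>x. \<Phi> x y))"
    unfolding cub_def using assms by (intro integral_swap_continuous) (rule continuous_on_subset, auto)
  thus ?thesis by (simp add: boxavg_def)
qed

text \<open>Each of the two integrals differs from the integral over the inner box by at most the L1
  mass between the inner and the outer box. In this form it serves bounded continuous functions as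
  well as Stepanoff functions, which may be unbounded.\<close>

lemma integral_sandwich:
  fixes f :: "'a::euclidean_space \<Rightarrow> complex"
  assumes f: "f absolutely_integrable_on cbox a b"
    and sub: "S \<in> {cbox a' b' |a' b'. True}" "T \<in> {cbox a' b' |a' b'. True}"
      "cbox c d \<subseteq> S" "S \<subseteq> cbox a b" "cbox c d \<subseteq> T" "T \<subseteq> cbox a b"
  shows "norm (integral S f - integral T f) \<le>
    2 * (integral (cbox a b) (\<lambda>x. norm (f x)) - integral (cbox c d) (\<lambda>x. norm (f x)))"
proof -
  have *: "norm (integral S f - integral (cbox c d) f) \<le>
    integral (cbox a b) (\<lambda>x. norm (f x)) - integral (cbox c d) (\<lambda>x. norm (f x))"
    if S: "S \<in> {cbox a' b' |a' b'. True}" "cbox c d \<subseteq> S" "S \<subseteq> cbox a b" for S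
  proof -
    obtain a' b' where Seq: "S = cbox a' b'" using S by auto
    have fS: "f absolutely_integrable_on S" and fc: "f absolutely_integrable_on cbox c d"
      using f S absolutely_integrable_on_subcbox unfolding Seq by (blast, blast)
    have i: "f integrable_on S" "f integrable_on cbox c d" "(\<lambda>x. norm (f x)) integrable_on S"
      "(\<lambda>x. norm (f x)) integrable_on cbox c d" "(\<lambda>x. norm (f x)) integrable_on cbox a b"
      using fS fc f by (auto simp: absolutely_integrable_on_def)
    have n: "negligible (cbox c d - S)" using S by simp
    have "norm (integral S f - integral (cbox c d) f) = norm (integral (S - cbox c d) f)"
      using i n by (simp add: integral_setdiff)
    also have "\<dots> \<le> integral (S - cbox c d) (\<lambda>x. norm (f x))"
      using i n by (intro integral_norm_bound_integral)
        (auto intro: integrable_setdiff integrable_integral)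
    also have "\<dots> = integral S (\<lambda>x. norm (f x)) - integral (cbox c d) (\<lambda>x. norm (f x))"
      using i n by (simp add: integral_setdiff)
    also have "integral S (\<lambda>x. norm (f x)) \<le> integral (cbox a b) (\<lambda>x. norm (f x))"
      using i S by (intro integral_subset_le) auto
    finally show ?thesis by simp
  qed
  have "norm (integral S f - integral T f) \<le> norm (integral S f - integral (cbox c d) f) + norm (integral T f - integral (cbox c d) f)"
    by norm
  also have "\<dots> \<le> 2 * (integral (cbox a b) (\<lambda>x. norm (f x)) - integral (cbox c d) (\<lambda>x. norm (f x)))"
    using *[of S] *[of T] sub by simp
  finally show ?thesis .
qed

lemma integral_cub_translate:
  "integral (cub N) (\<lambda>u. g (t + u)) = integral (cbox (t - N *\<^sub>R One) (t + N *\<^sub>R One)) g"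
  for g :: "real^'m \<Rightarrow> complex"
  using integral_shift_cbox_plus[of "- (N *\<^sub>R One)" "N *\<^sub>R One" g t]
  by (simp add: o_def cub_def add.commute)

text \<open>The cube and its translate both contain \<open>cub (N - r)\<close> and lie in
  \<open>cub (N + r)\<close>, so their integrals differ by at most twice the mass of that shell. The
  last factor is the volume of the shell relative to the cube of side \<open>2 * N\<close>.\<close>

lemma boxavg_translate:
  fixes g :: "real^'m \<Rightarrow> complex"
  assumes g: "continuous_on UNIV g" "\<And>x. norm (g x) \<le> B" and r: "norm t \<le> r" "r < N"
  shows "norm (boxavg N (\<lambda>u. g (t + u)) - boxavg N g) \<le>
     2 * B * ((1 + r / N) ^ CARD('m) - (1 - r / N) ^ CARD('m))"
proof -
  have r0: "r \<ge> 0" "N > 0" using r norm_ge_zero[of t] by linarith+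
  have ti: "\<bar>t $ i\<bar> \<le> r" for i using component_le_norm_cart[of t i] r by linarith
  have B0: "B \<ge> 0" using g(2)[of 0] norm_ge_zero order_trans by blast
  define G where "G = (\<lambda>x. norm (g x))"
  have G: "continuous_on UNIV G" unfolding G_def by (intro continuous_intros g)
  have sub1: "cub (N - r) \<subseteq> cbox (t - N *\<^sub>R One) (t + N *\<^sub>R One)"
    "cbox (t - N *\<^sub>R One) (t + N *\<^sub>R One) \<subseteq> cub (N + r)"
    "cub (N - r) \<subseteq> (cub N :: (real^'m) set)" "cub N \<subseteq> (cub (N + r) :: (real^'m) set)"
    using ti r0 unfolding cub_def
    by (auto simp: mem_box_cart abs_le_iff subset_iff) (smt (verit) ti)+
  have absint: "g absolutely_integrable_on cub (N + r)"
    unfolding cub_def by (intro absolutely_integrable_continuous continuous_on_subset[OF g(1)]) auto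
  have "norm (integral (cub N) (\<lambda>u. g (t + u)) - integral (cub N) g) \<le>
      2 * (integral (cub (N + r)) G - integral (cub (N - r)) G)"
    unfolding G_def integral_cub_translate
    using sub1 absint unfolding cub_def
    by (intro integral_sandwich) auto
  also have "integral (cub (N + r)) G - integral (cub (N - r)) G = integral (cub (N + r) - cub (N - r)) G"
    using sub1 by (intro integral_setdiff[symmetric] integrable_cub G) auto
  also have "\<dots> \<le> integral (cub (N + r) - cub (N - r) :: (real^'m) set) (\<lambda>x. B)"
  proof (rule integral_le)
    show "G integrable_on cub (N + r) - cub (N - r)"
      using sub1 by (intro integrable_setdiff[OF integrable_integral integrable_integral] integrable_cub G) auto
    show "(\<lambda>x. B) integrable_on cub (N + r) - (cub (N - r) :: (real^'m) set)"
      using sub1 by (intro integrable_setdiff[OF integrable_integral integrable_integral] integrable_cub) auto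
  qed (use g in \<open>auto simp: G_def\<close>)
  also have "\<dots> = integral (cub (N + r) :: (real^'m) set) (\<lambda>x. B) - integral (cub (N - r) :: (real^'m) set) (\<lambda>x. B)"
    using sub1 by (intro integral_setdiff integrable_cub) auto
  also have "\<dots> = B * ((2 * (N + r)) ^ CARD('m) - (2 * (N - r)) ^ CARD('m))"
    using r r0 content_cub[of "N + r", where 'm='m] content_cub[of "N - r", where 'm='m]
    by (simp add: cub_def algebra_simps)
  finally have *: "norm (integral (cub N) (\<lambda>u. g (t + u)) - integral (cub N) g) \<le>
     2 * (B * ((2 * (N + r)) ^ CARD('m) - (2 * (N - r)) ^ CARD('m)))" by simp
  have "norm (boxavg N (\<lambda>u. g (t + u)) - boxavg N g) =
     norm (integral (cub N) (\<lambda>u. g (t + u)) - integral (cub N) g) / (2 * N) ^ CARD('m)"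
    using r0 unfolding boxavg_def right_diff_distrib[symmetric]
    by (simp add: norm_mult norm_power norm_divide)
  also have "\<dots> \<le> 2 * (B * ((2 * (N + r)) ^ CARD('m) - (2 * (N - r)) ^ CARD('m))) / (2 * N) ^ CARD('m)"
    using * r0 by (intro divide_right_mono) auto
  also have "\<dots> = 2 * B * (((2 * (N + r)) / (2 * N)) ^ CARD('m) - ((2 * (N - r)) / (2 * N)) ^ CARD('m))"
    unfolding power_divide by (simp add: diff_divide_distrib right_diff_distrib)
  also have "(2 * (N + r)) / (2 * N) = 1 + r / N" using r0 by (simp add: field_simps)
  also have "(2 * (N - r)) / (2 * N) = 1 - r / N" using r0 by (simp add: field_simps)
  finally show ?thesis .
qed

text \<open>The shell becomes negligible against the cube as \<open>N\<close> grows, and the bound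
  depends on \<open>t\<close> only through \<open>r\<close>.\<close>

lemma boxavg_translate_tendsto:
  fixes g :: "real^'m \<Rightarrow> complex"
  assumes g: "continuous_on UNIV g" "\<And>x. norm (g x) \<le> B" and "e > 0"
  shows "\<exists>N0>r. \<forall>N\<ge>N0. \<forall>t. norm t \<le> r \<longrightarrow> norm (boxavg N (\<lambda>u. g (t + u)) - boxavg N g) \<le> e"
proof -
  have "((\<lambda>N. 2 * B * ((1 + r / N) ^ CARD('m) - (1 - r / N) ^ CARD('m))) \<longlongrightarrow>
      2 * B * ((1 + 0) ^ CARD('m) - (1 - 0) ^ CARD('m))) at_top"
    by (intro tendsto_intros tendsto_divide_0[OF tendsto_const] filterlim_at_top_imp_at_infinity filterlim_ident)
  hence "eventually (\<lambda>N. 2 * B * ((1 + r / N) ^ CARD('m) - (1 - r / N) ^ CARD('m)) < e) at_top"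
    using \<open>e > 0\<close> by (intro order_tendstoD) auto
  then obtain N1 where N1: "\<And>N. N \<ge> N1 \<Longrightarrow> 2 * B * ((1 + r / N) ^ CARD('m) - (1 - r / N) ^ CARD('m)) < e"
    unfolding eventually_at_top_linorder by blast
  show ?thesis
  proof (intro exI[of _ "max N1 (r + 1)"] conjI allI impI)
    fix N t assume N: "max N1 (r + 1) \<le> N" "norm (t::real^'m) \<le> r"
    have "norm (boxavg N (\<lambda>u. g (t + u)) - boxavg N g) \<le>
     2 * B * ((1 + r / N) ^ CARD('m) - (1 - r / N) ^ CARD('m))"
      using N by (intro boxavg_translate g) auto
    also have "\<dots> < e" using N by (intro N1) auto
    finally show "norm (boxavg N (\<lambda>u. g (t + u)) - boxavg N g) \<le> e" by simp
  qed auto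
qed

section \<open>Almost periodic functions and their means\<close>

text \<open>Bochner's form of almost periodicity: the translates of \<open>g\<close> are totally
  bounded in the sup norm. This is expressed by finitely many colours of the translation vectors,
  because colourings of two functions can simply be paired, whereas common almost periods of two
  functions would take an argument of their own.\<close>

definition ap :: "(real^'m \<Rightarrow> complex) \<Rightarrow> bool" where
  "ap g \<longleftrightarrow> continuous_on UNIV g \<and>
     (\<forall>e>0. \<exists>c :: real^'m \<Rightarrow> nat. finite (range c) \<and>
        (\<forall>s t. c s = c t \<longrightarrow> (\<forall>x. norm (g (x + s) - g (x + t)) \<le> e)))"

lemma ap_continuous: "ap g \<Longrightarrow> continuous_on UNIV g"
  by (simp add: ap_def)

lemma ap_continuous_on:
  "ap g \<Longrightarrow> continuous_on S h \<Longrightarrow> continuous_on S (\<lambda>x. g (h x))"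
  by (rule continuous_on_compose2[OF ap_continuous]) auto

lemma ap_colouring:
  assumes "ap g" "e > 0"
  obtains c :: "real^'m \<Rightarrow> nat" where "finite (range c)"
    "\<And>s t x. c s = c t \<Longrightarrow> norm (g (x + s) - g (x + t)) \<le> e"
  using assms unfolding ap_def by blast

text \<open>One representative per colour gives a finite net of translates.\<close>

lemma ap_net:
  fixes g :: "real^'m \<Rightarrow> complex"
  assumes "ap g" "e > 0"
  obtains T where "finite T" "\<And>t. \<exists>s\<in>T. \<forall>x. norm (g (x + t) - g (x + s)) \<le> e"
proof -
  obtain c :: "real^'m \<Rightarrow> nat" where c: "finite (range c)"
    "\<And>s t x. c s = c t \<Longrightarrow> norm (g (x + s) - g (x + t)) \<le> e"
    using ap_colouring[OF assms] by blast
  define r where "r = (\<lambda>j. SOME t. c t = j)"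
  have r: "c (r (c t)) = c t" for t unfolding r_def by (rule someI_ex) auto
  show ?thesis
  proof (rule that[of "r ` range c"])
    show "\<exists>s\<in>r ` range c. \<forall>x. norm (g (x + t) - g (x + s)) \<le> e" for t
      using c(2)[of t "r (c t)"] r[of t] by auto
  qed (use c in auto)
qed

lemma ap_bounded:
  assumes "ap (g :: real^'m \<Rightarrow> complex)"
  obtains B where "B > 0" "\<And>x. norm (g x) \<le> B"
proof -
  obtain T where T: "finite T" "\<And>t. \<exists>s\<in>T. \<forall>x. norm (g (x + t) - g (x + s)) \<le> 1"
    using ap_net[OF assms, of 1] by (metis zero_less_one)
  show ?thesis
  proof (rule that[of "(\<Sum>s\<in>T. norm (g s)) + 1"])
    show "(\<Sum>s\<in>T. norm (g s)) + 1 > 0" by (smt (verit) norm_ge_zero sum_nonneg)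
    fix x
    obtain s where s: "s \<in> T" "norm (g (0 + x) - g (0 + s)) \<le> 1" using T(2)[of x] by blast
    have "norm (g s) \<le> (\<Sum>s\<in>T. norm (g s))"
      using s T by (intro member_le_sum) auto
    thus "norm (g x) \<le> (\<Sum>s\<in>T. norm (g s)) + 1"
      using s(2) norm_triangle_sub[of "g x" "g s"] by simp
  qed
qed

text \<open>A net reduces continuity at an arbitrary point \<open>y\<close> to continuity at
  finitely many points \<open>s\<close>: \<open>g x\<close> and \<open>g y\<close> are close to
  \<open>g (x - y + s)\<close> and \<open>g s\<close>.\<close>

lemma ap_unif_cont:
  fixes g :: "real^'m \<Rightarrow> complex"
  assumes "ap g" "e > 0"
  obtains d where "d > 0" "\<And>x y. norm (x - y) < d \<Longrightarrow> norm (g x - g y) < e"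
proof -
  obtain T where T: "finite T" "\<And>t. \<exists>s\<in>T. \<forall>x. norm (g (x + t) - g (x + s)) \<le> e / 4"
    using ap_net[OF assms(1), of "e / 4"] assms(2) by (metis zero_less_divide_iff zero_less_numeral)
  have "\<exists>d>0. \<forall>y. norm (y - s) < d \<longrightarrow> norm (g y - g s) < e / 4" for s
    using ap_continuous[OF assms(1)] assms(2) unfolding continuous_on_iff dist_norm
    by (metis UNIV_I zero_less_divide_iff zero_less_numeral)
  then obtain D where D: "\<And>s. D s > 0" "\<And>s y. norm (y - s) < D s \<Longrightarrow> norm (g y - g s) < e / 4"
    by metis
  define d where "d = Min (insert 1 (D ` T))"
  have d: "d > 0" "\<And>s. s \<in> T \<Longrightarrow> d \<le> D s" using T D unfolding d_def by auto
  show ?thesis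
  proof (rule that[OF d(1)])
    fix x y :: "real^'m" assume xy: "norm (x - y) < d"
    obtain s where s: "s \<in> T" "\<And>x. norm (g (x + y) - g (x + s)) \<le> e / 4" using T(2)[of y] by blast
    have "norm (g x - g (x - y + s)) \<le> e / 4" using s(2)[of "x - y"] by simp
    moreover have "norm (g y - g s) \<le> e / 4" using s(2)[of 0] by simp
    moreover have "norm (g (x - y + s) - g s) < e / 4"
      using d(2)[OF s(1)] xy by (intro D) simp
    moreover have "norm (g x - g y) \<le> norm (g x - g (x - y + s)) + norm (g y - g s) + norm (g (x - y + s) - g s)"
      by norm
    ultimately show "norm (g x - g y) < e" using assms(2) by linarith
  qed
qed

text \<open>Common scheme for sums, products, conjugates and translates: differences of translates
  of \<open>h\<close> are controlled by those of \<open>f\<close> and \<open>g\<close>, so the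
  paired colouring works for \<open>h\<close>.\<close>

lemma ap_compose2:
  fixes f g h :: "real^'m \<Rightarrow> complex"
  assumes f: "ap f" and g: "ap g" and h: "continuous_on UNIV h" and A: "A > 0"
    and *: "\<And>s t e. e > 0 \<Longrightarrow> (\<And>x. norm (f (x + s) - f (x + t)) \<le> e) \<Longrightarrow> (\<And>x. norm (g (x + s) - g (x + t)) \<le> e)
       \<Longrightarrow> (\<And>x. norm (h (x + s) - h (x + t)) \<le> A * e)"
  shows "ap h"
  unfolding ap_def
proof (intro conjI allI impI h)
  fix e :: real assume e: "e > 0"
  obtain c where c: "finite (range c)" "\<And>s t x. c s = (c t :: nat) \<Longrightarrow> norm (f (x + s) - f (x + t)) \<le> e / A"
    using ap_colouring[OF f, of "e / A"] e A by (metis divide_pos_pos)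
  obtain d where d: "finite (range d)" "\<And>s t x. d s = (d t :: nat) \<Longrightarrow> norm (g (x + s) - g (x + t)) \<le> e / A"
    using ap_colouring[OF g, of "e / A"] e A by (metis divide_pos_pos)
  have "finite (range (\<lambda>s. prod_encode (c s, d s)))"
    by (rule finite_subset[of _ "prod_encode ` (range c \<times> range d)"]) (use c(1) d(1) in auto)
  moreover have "norm (h (x + s) - h (x + t)) \<le> e" if "prod_encode (c s, d s) = prod_encode (c t, d t)" for s t x
    using *[of "e / A" s t x] c(2)[of s t] d(2)[of s t] that e A by (simp add: prod_encode_eq)
  ultimately show "\<exists>c :: real^'m \<Rightarrow> nat. finite (range c) \<and>
        (\<forall>s t. c s = c t \<longrightarrow> (\<forall>x. norm (h (x + s) - h (x + t)) \<le> e))"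
    by blast
qed

lemma ap_const [simp, intro]: "ap (\<lambda>x. k)"
  unfolding ap_def by (auto intro!: exI[of _ "\<lambda>_. 0"])

lemma ap_add [intro]:
  assumes f: "ap f" and g: "ap g" shows "ap (\<lambda>x. f x + g x)"
proof (rule ap_compose2[OF f g, of _ 2])
  fix s t e x
  assume "\<And>x. norm (f (x + s) - f (x + t)) \<le> e" "\<And>x. norm (g (x + s) - g (x + t)) \<le> e"
  hence "norm (f (x + s) - f (x + t)) + norm (g (x + s) - g (x + t)) \<le> 2 * e"
    by (metis add_mono mult_2)
  thus "norm (f (x + s) + g (x + s) - (f (x + t) + g (x + t))) \<le> 2 * e"
    by (rule order_trans[OF norm_diff_triangle_ineq])
qed (use f g in \<open>auto intro!: continuous_intros simp: ap_continuous\<close>)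

lemma ap_mult [intro]:
  assumes f: "ap f" and g: "ap g" shows "ap (\<lambda>x. f x * g x)"
proof -
  obtain A where A: "A > 0" "\<And>x. norm (f x) \<le> A" using ap_bounded[OF f] by blast
  obtain B where B: "B > 0" "\<And>x. norm (g x) \<le> B" using ap_bounded[OF g] by blast
  show ?thesis
  proof (rule ap_compose2[OF f g, of _ "A + B"])
    fix s t e x
    assume e: "e > 0" and 1: "\<And>x. norm (f (x + s) - f (x + t)) \<le> e" and 2: "\<And>x. norm (g (x + s) - g (x + t)) \<le> e"
    have "norm (f (x + s) * g (x + s) - f (x + t) * g (x + t)) =
      norm (f (x + s) * (g (x + s) - g (x + t)) + (f (x + s) - f (x + t)) * g (x + t))"
      by (simp add: algebra_simps)
    also have "\<dots> \<le> A * e + e * B"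
      by (intro norm_triangle_mono order_trans[OF norm_mult_ineq] mult_mono A B 1 2) (use A e in auto)
    finally show "norm (f (x + s) * g (x + s) - f (x + t) * g (x + t)) \<le> (A + B) * e"
      by (simp add: algebra_simps)
  qed (use A B f g in \<open>auto intro!: continuous_intros simp: ap_continuous\<close>)
qed

lemma ap_cnj [intro]:
  assumes "ap f" shows "ap (\<lambda>x. cnj (f x))"
proof (rule ap_compose2[OF assms assms, of _ 1])
  fix s t e x assume "\<And>x. norm (f (x + s) - f (x + t)) \<le> e"
  thus "norm (cnj (f (x + s)) - cnj (f (x + t))) \<le> 1 * e"
    by (metis complex_cnj_diff complex_mod_cnj mult_1)
qed (use assms in \<open>auto intro!: continuous_intros simp: ap_continuous\<close>)

lemma ap_translate:
  assumes "ap f" shows "ap (\<lambda>x. f (x + a))"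
proof (rule ap_compose2[OF assms assms, of _ 1])
  fix s t e x assume "\<And>x. norm (f (x + s) - f (x + t)) \<le> e"
  from this[of "x + a"] show "norm (f (x + s + a) - f (x + t + a)) \<le> 1 * e"
    by (simp add: add.commute add.left_commute)
qed (use assms in \<open>auto intro!: continuous_intros ap_continuous_on[OF assms]\<close>)

lemma ap_cmult [intro]: "ap f \<Longrightarrow> ap (\<lambda>x. k * f x)"
  by (rule ap_mult) auto

lemma ap_diff [intro]: "ap f \<Longrightarrow> ap g \<Longrightarrow> ap (\<lambda>x. f x - g x)"
  using ap_add[of f "\<lambda>x. (-1) * g x"] ap_cmult[of g "-1"] by simp

lemma ap_sum [intro]: "(\<And>i. i \<in> I \<Longrightarrow> ap (f i)) \<Longrightarrow> ap (\<lambda>x. \<Sum>i\<in>I. f i x)"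
  by (induction I rule: infinite_finite_induct) auto

text \<open>A translate of a character is the character times a unimodular number, and the unit
  circle is covered by finitely many small discs.\<close>

lemma ap_echar [simp, intro]: "ap (echar l :: real^'m \<Rightarrow> complex)"
  unfolding ap_def
proof (intro conjI allI impI)
  show "continuous_on UNIV (echar l)" by (intro continuous_intros)
  fix e :: real assume e: "e > 0"
  have "compact (sphere (0::complex) 1)" by simp
  then obtain k where k: "finite k" "sphere (0::complex) 1 \<subseteq> (\<Union>x\<in>k. ball x (e / 2))"
    using e unfolding compact_eq_totally_bounded by (metis half_gt_zero)
  have "\<exists>y. y \<in> k \<and> dist y (echar l s) < e / 2" for s
    using k(2) by (force simp: subset_iff)
  then obtain y where y: "\<And>s. y s \<in> k" "\<And>s. dist (y s) (echar l s) < e / 2" by metis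
  define c where "c = (\<lambda>s. to_nat_on k (y s))"
  have "finite (range c)"
    by (rule finite_subset[of _ "to_nat_on k ` k"]) (use k y in \<open>auto simp: c_def\<close>)
  moreover have "norm (echar l (x + s) - echar l (x + t)) \<le> e" if "c s = c t" for s t x
  proof -
    have "y s = y t" using that y(1) k(1) unfolding c_def
      by (metis countable_finite inj_on_def inj_on_to_nat_on)
    have "norm (echar l (x + s) - echar l (x + t)) = norm (echar l s - echar l t)"
      by (simp add: echar_add right_diff_distrib[symmetric] norm_mult)
    also have "\<dots> \<le> e"
      using y(2)[of s] y(2)[of t] \<open>y s = y t\<close> dist_triangle_half_r[of "y s" "echar l s" e "echar l t"]
      by (simp add: dist_norm)
    finally show ?thesis .
  qed
  ultimately show "\<exists>c :: real^'m \<Rightarrow> nat. finite (range c) \<and>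
        (\<forall>s t. c s = c t \<longrightarrow> (\<forall>x. norm (echar l (x + s) - echar l (x + t)) \<le> e))"
    by blast
qed

lemma ap_uniform_limit:
  fixes g :: "real^'m \<Rightarrow> complex"
  assumes "\<And>e. e > 0 \<Longrightarrow> \<exists>h. ap h \<and> (\<forall>x. norm (g x - h x) \<le> e)"
  shows "ap g"
  unfolding ap_def
proof (intro conjI allI impI)
  have "\<exists>h. ap h \<and> (\<forall>x. norm (g x - h x) \<le> 1 / Suc n)" for n by (rule assms) simp
  then obtain h where h: "\<And>n. ap (h n)" "\<And>n x. norm (g x - h n x) \<le> 1 / Suc n" by metis
  have "uniform_limit UNIV h g sequentially"
  proof (rule uniform_limitI)
    fix e :: real assume "e > 0"
    then obtain n0 where "1 / Suc n0 < e" by (meson nat_approx_posE)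
    hence "\<forall>n\<ge>n0. \<forall>x\<in>UNIV. dist (h n x) (g x) < e"
    proof (intro allI ballI impI)
      fix n x assume "n \<ge> n0"
      hence "1 / real (Suc n) \<le> 1 / Suc n0" by (simp add: field_simps)
      thus "dist (h n x) (g x) < e" using h(2)[of x n] \<open>1 / Suc n0 < e\<close>
        by (simp add: dist_norm norm_minus_commute)
    qed
    thus "\<forall>\<^sub>F n in sequentially. \<forall>x\<in>UNIV. dist (h n x) (g x) < e"
      unfolding eventually_sequentially by blast
  qed
  thus "continuous_on UNIV g"
    by (rule uniform_limit_theorem[rotated]) (auto simp: ap_continuous h)
  fix e :: real assume e: "e > 0"
  then obtain k where k: "ap k" "\<And>x. norm (g x - k x) \<le> e / 3" using assms[of "e / 3"] by auto
  obtain c where c: "finite (range c)" "\<And>s t x. c s = (c t :: nat) \<Longrightarrow> norm (k (x + s) - k (x + t)) \<le> e / 3"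
    using ap_colouring[OF k(1), of "e / 3"] e by (metis divide_pos_pos zero_less_numeral)
  have "norm (g (x + s) - g (x + t)) \<le> e" if "c s = c t" for s t x
  proof -
    have "norm (g (x + s) - g (x + t)) = norm ((g (x + s) - k (x + s)) + (k (x + s) - k (x + t)) - (g (x + t) - k (x + t)))"
      by simp
    also have "\<dots> \<le> (e / 3 + e / 3) + e / 3"
      by (intro order_trans[OF norm_triangle_ineq4] order_trans[OF norm_triangle_ineq] add_mono k c that)
    finally show ?thesis by simp
  qed
  thus "\<exists>c :: real^'m \<Rightarrow> nat. finite (range c) \<and>
        (\<forall>s t. c s = c t \<longrightarrow> (\<forall>x. norm (g (x + s) - g (x + t)) \<le> e))"
    using c(1) by blast
qed

text \<open>Replacing \<open>t\<close> by a member of a finite net costs \<open>e / 2\<close>. The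
  net is bounded, so moving the cube by one of its members costs another \<open>e / 2\<close> once
  \<open>N\<close> is large; this makes the estimate uniform in all \<open>t\<close>.\<close>

lemma ap_boxavg_osc:
  fixes g :: "real^'m \<Rightarrow> complex"
  assumes "ap g" "e > 0"
  shows "\<exists>N0>0. \<forall>N\<ge>N0. \<forall>t. norm (boxavg N (\<lambda>u. g (t + u)) - boxavg N g) \<le> e"
proof -
  obtain T where T: "finite T" "\<And>t. \<exists>s\<in>T. \<forall>x. norm (g (x + t) - g (x + s)) \<le> e / 2"
    using ap_net[OF assms(1), of "e / 2"] assms(2) by (metis half_gt_zero)
  obtain B where B: "\<And>x. norm (g x) \<le> B" using ap_bounded[OF assms(1)] by blast
  obtain r where r: "\<And>s. s \<in> T \<Longrightarrow> norm s \<le> r"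
    using finite_imp_bounded[OF T(1)] unfolding bounded_iff by blast
  obtain N0 where N0: "N0 > max r 0" "\<And>N t. N \<ge> N0 \<Longrightarrow> norm t \<le> max r 0 \<Longrightarrow> norm (boxavg N (\<lambda>u. g (t + u)) - boxavg N g) \<le> e / 2"
    using boxavg_translate_tendsto[OF ap_continuous[OF assms(1)] B, of "e / 2" "max r 0"] assms(2) by auto
  have "norm (boxavg N (\<lambda>u. g (t + u)) - boxavg N g) \<le> e" if N: "N \<ge> N0" for N t
  proof -
    obtain s where s: "s \<in> T" "\<And>x. norm (g (x + t) - g (x + s)) \<le> e / 2" using T(2)[of t] by blast
    have "norm (boxavg N (\<lambda>u. g (t + u)) - boxavg N (\<lambda>u. g (s + u))) = norm (boxavg N (\<lambda>u. g (t + u) - g (s + u)))"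
      by (subst boxavg_diff) (auto intro!: continuous_intros ap_continuous_on[OF assms(1)])
    also have "\<dots> \<le> e / 2"
      using s(2) N N0(1) by (intro norm_boxavg_le continuous_intros ap_continuous_on[OF assms(1)]) (auto simp: add.commute)
    finally have "norm (boxavg N (\<lambda>u. g (t + u)) - boxavg N (\<lambda>u. g (s + u))) \<le> e / 2" .
    moreover have "norm (boxavg N (\<lambda>u. g (s + u)) - boxavg N g) \<le> e / 2"
      using N r[OF s(1)] by (intro N0) auto
    ultimately show ?thesis
      using norm_diff_triangle_le by (metis field_sum_of_halves)
  qed
  thus ?thesis using N0(1) by (metis less_max_iff_disj max.strict_boundedE)
qed

lemma ap_boxavg_iterate:
  fixes g :: "real^'m \<Rightarrow> complex"
  assumes "ap g" "N > 0" "L > 0" "\<And>t. norm (boxavg L (\<lambda>u. g (t + u)) - k) \<le> e"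
  shows "norm (boxavg N (\<lambda>t. boxavg L (\<lambda>u. g (t + u))) - k) \<le> e"
proof -
  have c: "continuous_on UNIV (\<lambda>t. boxavg L (\<lambda>u. g (t + u)))"
  proof -
    have "continuous_on UNIV (\<lambda>t. integral (cub L) (\<lambda>u. g (t + u)))"
      unfolding cub_def
      by (rule integral_continuous_on_param) (auto intro!: continuous_intros ap_continuous_on[OF assms(1)] simp: split_beta)
    thus ?thesis unfolding boxavg_def by (intro continuous_intros)
  qed
  have "norm (boxavg N (\<lambda>t. boxavg L (\<lambda>u. g (t + u))) - k) = norm (boxavg N (\<lambda>t. boxavg L (\<lambda>u. g (t + u)) - k))"
    by (subst boxavg_diff) (auto simp: boxavg_const assms c)
  also have "\<dots> \<le> e"
    using assms by (intro norm_boxavg_le continuous_intros c) auto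
  finally show ?thesis .
qed

section \<open>The mean value and its positivity\<close>

definition mean :: "(real^'m \<Rightarrow> complex) \<Rightarrow> complex" where
  "mean g = Lim at_top (\<lambda>N. boxavg N g)"

text \<open>The averages over \<open>cub N\<close> and \<open>cub L\<close> commute by Fubini, and
  the iterated average is close to either single one because averages over large cubes hardly depend
  on the position of the cube. Hence two large cubes give nearly equal averages.\<close>

lemma ap_boxavg_convergent:
  fixes g :: "real^'m \<Rightarrow> complex"
  assumes g: "ap g"
  shows "\<exists>M. ((\<lambda>N. boxavg N g) \<longlongrightarrow> M) at_top"
proof -
  have close: "norm (boxavg N g - boxavg L g) \<le> 2 * e"
    if NL: "N > 0" "L > 0" and N: "\<And>t. norm (boxavg N (\<lambda>u. g (t + u)) - boxavg N g) \<le> e"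
      and L: "\<And>t. norm (boxavg L (\<lambda>u. g (t + u)) - boxavg L g) \<le> e" for N L e
  proof -
    have "boxavg N (\<lambda>t. boxavg L (\<lambda>u. g (t + u))) = boxavg L (\<lambda>u. boxavg N (\<lambda>t. g (u + t)))"
      by (subst boxavg_swap) (auto intro!: continuous_intros ap_continuous_on[OF g] simp: split_beta add.commute)
    with ap_boxavg_iterate[OF g NL L] ap_boxavg_iterate[OF g NL(2,1) N]
    show ?thesis
      by (metis mult_2 norm_diff_triangle_le norm_minus_commute)
  qed
  have "Cauchy (\<lambda>n. boxavg (real n) g)"
  proof (rule metric_CauchyI)
    fix e :: real assume e: "e > 0"
    then obtain N0 where N0: "N0 > 0" "\<And>N t. N \<ge> N0 \<Longrightarrow> norm (boxavg N (\<lambda>u. g (t + u)) - boxavg N g) \<le> e / 3"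
      using ap_boxavg_osc[OF g, of "e / 3"] by auto
    have "dist (boxavg (real m) g) (boxavg (real n) g) < e" if "m \<ge> nat \<lceil>N0\<rceil>" "n \<ge> nat \<lceil>N0\<rceil>" for m n
    proof -
      have "real m \<ge> N0" "real n \<ge> N0" using that by linarith+
      hence "norm (boxavg (real m) g - boxavg (real n) g) \<le> 2 * (e / 3)"
        using N0 by (intro close N0) auto
      thus ?thesis using e by (simp add: dist_norm)
    qed
    thus "\<exists>M. \<forall>m\<ge>M. \<forall>n\<ge>M. dist (boxavg (real m) g) (boxavg (real n) g) < e" by blast
  qed
  then obtain M where M: "(\<lambda>n. boxavg (real n) g) \<longlonglongrightarrow> M"
    using Cauchy_convergent_iff convergent_def by blast
  have "((\<lambda>N. boxavg N g) \<longlongrightarrow> M) at_top"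
  proof (rule tendstoI)
    fix e :: real assume e: "e > 0"
    then obtain N0 where N0: "N0 > 0" "\<And>N t. N \<ge> N0 \<Longrightarrow> norm (boxavg N (\<lambda>u. g (t + u)) - boxavg N g) \<le> e / 4"
      using ap_boxavg_osc[OF g, of "e / 4"] by auto
    have "eventually (\<lambda>n. dist (boxavg (real n) g) M < e / 3) sequentially"
      using M e by (intro tendstoD) auto
    moreover have "eventually (\<lambda>n. real n \<ge> N0) sequentially"
      by (rule eventually_sequentiallyI[of "nat \<lceil>N0\<rceil>"]) linarith
    ultimately obtain n where n: "dist (boxavg (real n) g) M < e / 3" "real n \<ge> N0"
      using eventually_happens[OF eventually_conj] by (metis (mono_tags, lifting) sequentially_bot)
    have "dist (boxavg N g) M < e" if "N \<ge> N0" for N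
    proof -
      have "norm (boxavg N g - boxavg (real n) g) \<le> 2 * (e / 4)"
        using N0 that n by (intro close N0) auto
      thus ?thesis using n(1) e dist_triangle[of "boxavg N g" M "boxavg (real n) g"] by (simp add: dist_norm)
    qed
    thus "eventually (\<lambda>N. dist (boxavg N g) M < e) at_top"
      unfolding eventually_at_top_linorder by blast
  qed
  thus ?thesis by blast
qed

lemma mean_tendsto:
  assumes "ap g" shows "((\<lambda>N. boxavg N g) \<longlongrightarrow> mean g) at_top"
  using ap_boxavg_convergent[OF assms] unfolding mean_def
  by (metis tendsto_Lim trivial_limit_at_top_linorder)

lemma mean_unique: "((\<lambda>N. boxavg N g) \<longlongrightarrow> M) at_top \<Longrightarrow> mean g = M"
  unfolding mean_def by (rule tendsto_Lim) auto

text \<open>The form in which means are used later: one \<open>N0\<close> serves all positions of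
  the cube.\<close>

lemma mean_uniform:
  fixes g :: "real^'m \<Rightarrow> complex"
  assumes g: "ap g" and e: "e > 0"
  obtains N0 where "N0 > 0" "\<And>N t. N \<ge> N0 \<Longrightarrow> norm (boxavg N (\<lambda>u. g (t + u)) - mean g) \<le> e"
proof -
  obtain N0 where N0: "N0 > 0" "\<And>N t. N \<ge> N0 \<Longrightarrow> norm (boxavg N (\<lambda>u. g (t + u)) - boxavg N g) \<le> e / 2"
    using ap_boxavg_osc[OF g, of "e / 2"] e by auto
  have "eventually (\<lambda>N. dist (boxavg N g) (mean g) < e / 2) at_top"
    using mean_tendsto[OF g] e by (intro tendstoD) auto
  then obtain N1 where N1: "\<And>N. N \<ge> N1 \<Longrightarrow> dist (boxavg N g) (mean g) < e / 2"
    unfolding eventually_at_top_linorder by blast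
  show ?thesis
  proof (rule that[of "max N0 N1"])
    fix N t assume N: "N \<ge> max N0 N1"
    have "norm (boxavg N (\<lambda>u. g (t + u)) - mean g) \<le> norm (boxavg N (\<lambda>u. g (t + u)) - boxavg N g) + norm (boxavg N g - mean g)"
      by norm
    also have "\<dots> \<le> e" using N0(2)[of N t] N1[of N] N by (simp add: dist_norm)
    finally show "norm (boxavg N (\<lambda>u. g (t + u)) - mean g) \<le> e" .
  qed (use N0 in auto)
qed

lemma eventually_gt_0: "eventually (\<lambda>N. N > (0::real)) at_top"
  by (rule eventually_gt_at_top)

lemma mean_add: "ap f \<Longrightarrow> ap g \<Longrightarrow> mean (\<lambda>x. f x + g x) = mean f + mean g"
  by (rule mean_unique) (auto simp: boxavg_add ap_continuous intro!: tendsto_intros mean_tendsto)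

lemma mean_diff: "ap f \<Longrightarrow> ap g \<Longrightarrow> mean (\<lambda>x. f x - g x) = mean f - mean g"
  by (rule mean_unique) (auto simp: boxavg_diff ap_continuous intro!: tendsto_intros mean_tendsto)

lemma mean_cmult: "ap f \<Longrightarrow> mean (\<lambda>x. k * f x) = k * mean f"
  by (rule mean_unique) (auto simp: boxavg_cmult intro!: tendsto_intros mean_tendsto)

lemma mean_const [simp]: "mean (\<lambda>x :: real^'m. k) = k"
proof (rule mean_unique)
  show "((\<lambda>N. boxavg N (\<lambda>x :: real^'m. k)) \<longlongrightarrow> k) at_top"
    by (rule tendsto_eventually) (use eventually_gt_0 in eventually_elim, simp add: boxavg_const)
qed

lemma mean_sum: "(\<And>i. i \<in> I \<Longrightarrow> ap (f i)) \<Longrightarrow> mean (\<lambda>x. \<Sum>i\<in>I. f i x) = (\<Sum>i\<in>I. mean (f i))"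
  by (induction I rule: infinite_finite_induct) (auto simp: mean_add ap_sum)

lemma mean_translate:
  assumes "ap g" shows "mean (\<lambda>x. g (x + a)) = mean g"
proof (rule mean_unique, rule tendstoI)
  fix e :: real assume e: "e > 0"
  obtain N0 where N0: "N0 > 0" "\<And>N t. N \<ge> N0 \<Longrightarrow> norm (boxavg N (\<lambda>u. g (t + u)) - mean g) \<le> e / 2"
    using mean_uniform[OF assms, of "e / 2"] e by (metis half_gt_zero)
  hence "\<forall>N\<ge>N0. dist (boxavg N (\<lambda>u. g (u + a))) (mean g) < e"
    using e by (auto simp: dist_norm add.commute[of _ a] intro: le_less_trans[OF N0(2)])
  thus "eventually (\<lambda>N. dist (boxavg N (\<lambda>u. g (u + a))) (mean g) < e) at_top"
    unfolding eventually_at_top_linorder by blast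
qed

lemma norm_mean_le:
  assumes "ap g" "\<And>x. norm (g x) \<le> B" shows "norm (mean g) \<le> B"
proof (rule tendsto_upperbound[OF tendsto_norm[OF mean_tendsto[OF assms(1)]]])
  show "\<forall>\<^sub>F N in at_top. norm (boxavg N g) \<le> B"
    using eventually_gt_0 by eventually_elim (intro norm_boxavg_le ap_continuous assms, auto)
qed auto

lemma Re_boxavg:
  assumes "continuous_on UNIV (g :: real^'m \<Rightarrow> complex)" "N > 0" "\<And>x. Re (g x) \<ge> 0"
  shows "Re (boxavg N g) \<ge> 0"
proof -
  have "Re (integral (cub N) g) = integral (cub N) (\<lambda>x. Re (g x))"
    using integral_linear[OF integrable_cub[OF assms(1)] bounded_linear_Re] by (simp add: o_def)
  also have "\<dots> \<ge> 0" using assms by (intro integral_nonneg integrable_cub continuous_intros) auto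
  finally have "(1 / (2 * N) ^ CARD('m)) * Re (integral (cub N) g) \<ge> 0"
    using assms(2) by (intro mult_nonneg_nonneg) auto
  thus ?thesis unfolding boxavg_def by (metis Re_complex_of_real Im_complex_of_real diff_zero mult_zero_left times_complex.sel(1))
qed

lemma Re_mean_nonneg:
  assumes "ap g" "\<And>x. Re (g x) \<ge> 0" shows "Re (mean g) \<ge> 0"
proof (rule tendsto_lowerbound[OF tendsto_Re[OF mean_tendsto[OF assms(1)]]])
  show "\<forall>\<^sub>F N in at_top. Re (boxavg N g) \<ge> 0"
    using eventually_gt_0 by eventually_elim (intro Re_boxavg ap_continuous assms, auto)
qed auto

text \<open>By total boundedness finitely many translates of \<open>g\<close> have a sum whose real
  part is at least \<open>p\<close> everywhere. Each of them has the mean of \<open>g\<close>, so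
  \<open>p\<close> is at most a multiple of the real part of that mean.\<close>

lemma mean_pos:
  fixes g :: "real^'m \<Rightarrow> complex"
  assumes g: "ap g" and nn: "\<And>x. Re (g x) \<ge> 0" and pos: "Re (g a) > 0"
  shows "Re (mean g) > 0"
proof -
  define p where "p = Re (g a) / 2"
  have p: "p > 0" using pos by (simp add: p_def)
  obtain T where T: "finite T" "\<And>t. \<exists>s\<in>T. \<forall>x. norm (g (x + t) - g (x + s)) \<le> p"
    using ap_net[OF g p] by blast
  \<comment> \<open>When \<open>s\<close> represents \<open>x\<close> in the net,
    \<open>g (x + (a - s))\<close> is within \<open>p\<close> of \<open>g a\<close>, whose real part
    is \<open>2 * p\<close>.\<close>
  define h where "h = (\<lambda>x. (\<Sum>s\<in>T. g (x + (a - s))) - complex_of_real p)"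
  have "Re (h x) \<ge> 0" for x
  proof -
    obtain s where s: "s \<in> T" "\<And>y. norm (g (y + x) - g (y + s)) \<le> p" using T(2)[of x] by blast
    have "norm (g (x + (a - s)) - g a) \<le> p" using s(2)[of "a - s"] by (simp add: algebra_simps)
    hence "\<bar>Re (g (x + (a - s)) - g a)\<bar> \<le> p"
      using abs_Re_le_cmod order_trans by blast
    hence "Re (g (x + (a - s))) \<ge> p" unfolding p_def minus_complex.sel by linarith
    also have "Re (g (x + (a - s))) \<le> (\<Sum>s\<in>T. Re (g (x + (a - s))))"
      using s T nn by (intro member_le_sum) auto
    finally show ?thesis by (simp add: h_def)
  qed
  moreover have "ap h"
    unfolding h_def by (rule ap_diff[OF ap_sum[OF ap_translate[OF g]] ap_const])
  ultimately have "Re (mean h) \<ge> 0" by (metis Re_mean_nonneg)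
  also have "mean h = of_nat (card T) * mean g - complex_of_real p"
  proof -
    have t: "ap (\<lambda>x. g (x + b))" for b by (rule ap_translate[OF g])
    have "mean h = (\<Sum>s\<in>T. mean (\<lambda>x. g (x + (a - s)))) - complex_of_real p"
      unfolding h_def by (simp only: mean_diff[OF ap_sum[OF t] ap_const] mean_sum[OF t] mean_const)
    thus ?thesis by (simp only: mean_translate[OF g] sum_constant)
  qed
  finally have "0 \<le> Re (of_nat (card T) * mean g) - p" by simp
  moreover have "Re (of_nat (card T) * mean g) = of_nat (card T) * Re (mean g)" by simp
  ultimately have "of_nat (card T) * Re (mean g) \<ge> p" by linarith
  hence "0 < of_nat (card T) * Re (mean g)" using p by linarith
  thus ?thesis by (simp add: zero_less_mult_iff)
qed

section \<open>Fourier coefficients of almost periodic functions\<close>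

definition coef :: "(real^'m \<Rightarrow> complex) \<Rightarrow> real^'m \<Rightarrow> complex" where
  "coef g l = mean (\<lambda>x. g x * echar (- l) x)"

lemma mean_echar: "l \<noteq> 0 \<Longrightarrow> mean (echar l :: real^'m \<Rightarrow> complex) = 0"
proof -
  assume "l \<noteq> 0"
  \<comment> \<open>Half a period of the character: translation by \<open>a\<close> changes its
    sign, so its mean equals its own negative.\<close>
  define a where "a = (pi / (l \<bullet> l)) *\<^sub>R l"
  have a: "echar l a = -1" using \<open>l \<noteq> 0\<close> by (simp add: echar_def a_def)
  have "mean (echar l) = mean (\<lambda>x. echar l (x + a))" by (rule mean_translate[symmetric]) simp
  also have "\<dots> = - mean (echar l)" using mean_cmult[of "echar l" "-1"] by (simp add: echar_add a)
  finally show "mean (echar l :: real^'m \<Rightarrow> complex) = 0" by simp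
qed

lemma coef_echar: "coef (echar l) l' = (if l = l' then 1 else 0)"
  by (simp add: coef_def echar_mult mean_echar)

lemma coef_diff: "ap f \<Longrightarrow> ap g \<Longrightarrow> coef (\<lambda>x. f x - g x) l = coef f l - coef g l"
  unfolding coef_def by (simp add: left_diff_distrib mean_diff ap_mult)

lemma coef_cmult: "ap f \<Longrightarrow> coef (\<lambda>x. k * f x) l = k * coef f l"
  unfolding coef_def by (simp add: mult.assoc mean_cmult ap_mult)

lemma coef_sum: "(\<And>i. i \<in> I \<Longrightarrow> ap (f i)) \<Longrightarrow> coef (\<lambda>x. \<Sum>i\<in>I. f i x) l = (\<Sum>i\<in>I. coef (f i) l)"
  unfolding coef_def by (simp add: sum_distrib_right mean_sum ap_mult)

lemma norm_coef_le:
  assumes "ap g" "\<And>x. norm (g x) \<le> B" shows "norm (coef g l) \<le> B"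
  unfolding coef_def using assms by (intro norm_mean_le ap_mult) (auto simp: norm_mult)

lemma coef_tendsto:
  assumes "ap g" "\<And>n. ap (f n)" "uniform_limit UNIV f g sequentially"
  shows "(\<lambda>n. coef (f n) l) \<longlonglongrightarrow> coef g l"
proof (rule tendstoI)
  fix e :: real assume e: "e > 0"
  hence "\<forall>\<^sub>F n in sequentially. \<forall>x\<in>UNIV. dist (f n x) (g x) < e / 2"
    by (intro uniform_limitD[OF assms(3)]) auto
  thus "\<forall>\<^sub>F n in sequentially. dist (coef (f n) l) (coef g l) < e"
  proof eventually_elim
    case (elim n)
    have "norm (coef (\<lambda>x. f n x - g x) l) \<le> e / 2"
      using elim assms by (intro norm_coef_le ap_diff) (auto simp: dist_norm less_imp_le)
    thus ?case using e assms by (simp add: coef_diff dist_norm)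
  qed
qed

section \<open>Plancherel on a finite grid\<close>

definition ibox :: "int \<Rightarrow> int \<Rightarrow> (int^'m) set" where
  "ibox a b = {n. \<forall>i. a \<le> n $ i \<and> n $ i \<le> b}"

lemma ibox_altdef: "(ibox a b :: (int^'m) set) = vec_lambda ` (PiE UNIV (\<lambda>_. {a..b}))"
proof (intro equalityI subsetI)
  fix n :: "int^'m" assume "n \<in> ibox a b"
  hence "(\<lambda>i. n $ i) \<in> PiE UNIV (\<lambda>_. {a..b})" by (auto simp: ibox_def)
  moreover have "n = vec_lambda (\<lambda>i. n $ i)" by simp
  ultimately show "n \<in> vec_lambda ` (PiE UNIV (\<lambda>_. {a..b}))" by blast
qed (auto simp: ibox_def PiE_iff)

lemma inj_vec_lambda: "inj_on vec_lambda S"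
  by (metis inj_onI vec_lambda_inject UNIV_I)

lemma finite_ibox [simp, intro]: "finite (ibox a b)"
  unfolding ibox_altdef by (intro finite_imageI finite_PiE) auto

lemma card_ibox: "card (ibox a b :: (int^'m) set) = nat (b - a + 1) ^ CARD('m)"
  unfolding ibox_altdef by (subst card_image[OF inj_vec_lambda]) (simp add: card_PiE)

lemma sum_ibox_prod:
  fixes f :: "'m::finite \<Rightarrow> int \<Rightarrow> 'a::comm_semiring_1"
  shows "(\<Sum>n\<in>ibox a b. \<Prod>j\<in>UNIV. f j (n $ j)) = (\<Prod>j\<in>UNIV. \<Sum>k\<in>{a..b}. f j k)"
  unfolding ibox_altdef by (subst sum.reindex[OF inj_vec_lambda]) (simp add: prod_sum_PiE)

text \<open>The characters of the group of integer vectors modulo \<open>L\<close>, with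
  \<open>k\<close> as frequency; frequencies are represented by a centred box.\<close>

definition dchar :: "int \<Rightarrow> int^'m \<Rightarrow> int^'m \<Rightarrow> complex" where
  "dchar L k n = (\<Prod>j\<in>UNIV. cis (2 * pi * of_int (k $ j) * of_int (n $ j) / of_int L))"

lemma dchar_diff: "dchar L k (n - n') = dchar L k n * cnj (dchar L k n')"
  by (simp add: dchar_def prod.distrib[symmetric] cis_cnj cis_mult right_diff_distrib diff_divide_distrib)

text \<open>Multiplying the sum by the root of unity \<open>z\<close> shifts the index by one, and
  periodicity moves the term that leaves at one end to the other. So \<open>z\<close> fixes the sum,
  and \<open>z\<close> is not 1 since \<open>d\<close> is not divisible by
  \<open>2 * H + 1\<close>.\<close>

lemma sum_cis_zero:
  assumes "H \<ge> 0" "\<bar>d\<bar> \<le> 2 * H" "d \<noteq> 0"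
  shows "(\<Sum>k\<in>{-H..H}. cis (2 * pi * of_int k * of_int d / of_int (2 * H + 1))) = 0"
proof -
  define L :: int where "L = 2 * H + 1"
  have L: "L > 0" using assms by (simp add: L_def)
  define f where "f = (\<lambda>k::int. cis (2 * pi * of_int k * of_int d / of_int L))"
  define z where "z = f 1"
  have fz: "z * f k = f (k + 1)" for k
    by (simp add: f_def z_def cis_mult distrib_left distrib_right add_divide_distrib add.commute)
  have per: "f (k + L) = f k" for k
  proof -
    have "2 * pi * of_int (k + L) * of_int d / of_int L = 2 * pi * of_int k * of_int d / of_int L + 2 * pi * real_of_int d"
      using L by (simp add: field_simps)
    hence "f (k + L) = cis (2 * pi * of_int k * of_int d / of_int L) * cis (2 * pi * of_int d)"
      unfolding f_def by (simp only: cis_mult)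
    also have "cis (2 * pi * of_int d) = 1" by (rule cis_multiple_2pi) auto
    finally show ?thesis by (simp add: f_def)
  qed
  have "z \<noteq> 1"
  proof
    assume "z = 1"
    hence "cos (2 * pi * of_int d / of_int L) = 1"
      by (simp add: z_def f_def complex_eq_iff)
    then obtain n :: int where "2 * pi * of_int d / of_int L = of_int n * 2 * pi"
      using cos_one_2pi_int by auto
    hence "real_of_int d = of_int (n * L)" using L by (simp add: field_simps)
    hence "d = n * L" by linarith
    hence "L \<le> \<bar>d\<bar>" using assms(3) L by (simp add: abs_mult)
    thus False using assms(2) by (simp add: L_def)
  qed
  have "z * (\<Sum>k\<in>{-H..H}. f k) = (\<Sum>k\<in>{-H..H}. f (k + 1))"
    by (simp add: sum_distrib_left fz)
  also have "\<dots> = (\<Sum>k\<in>{-H+1..H+1}. f k)"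
    by (rule sum.reindex_bij_witness[of _ "\<lambda>k. k - 1" "\<lambda>k. k + 1"]) auto
  also have "{-H+1..H+1} = insert (H + 1) {-H+1..H}" using assms by auto
  also have "sum f \<dots> = f (- H + L) + sum f {-H+1..H}" by (simp add: L_def)
  also have "\<dots> = sum f (insert (-H) {-H+1..H})" by (subst per) simp
  also have "insert (-H) {-H+1..H} = {-H..H}" using assms by auto
  finally have "(z - 1) * (\<Sum>k\<in>{-H..H}. f k) = 0" by (simp add: algebra_simps)
  thus ?thesis using \<open>z \<noteq> 1\<close> by (simp add: f_def L_def)
qed

lemma dchar_orthogonal:
  fixes d :: "int^'m"
  assumes "H \<ge> 0" "d \<in> ibox (-2*H) (2*H)"
  shows "(\<Sum>k\<in>ibox (-H) H. dchar (2*H+1) k d) = (if d = 0 then of_int (2*H+1) ^ CARD('m) else 0)"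
proof -
  have "(\<Sum>k\<in>ibox (-H) H. dchar (2*H+1) k d) =
     (\<Prod>j\<in>UNIV. \<Sum>k\<in>{-H..H}. cis (2 * pi * of_int k * of_int (d $ j) / of_int (2*H+1)))"
    unfolding dchar_def by (rule sum_ibox_prod)
  also have "\<dots> = (if d = 0 then of_int (2*H+1) ^ CARD('m) else 0)"
  proof (cases "d = 0")
    case False
    then obtain j where j: "d $ j \<noteq> 0" by (metis vec_eq_iff zero_index)
    hence "(\<Sum>k\<in>{-H..H}. cis (2 * pi * of_int k * of_int (d $ j) / of_int (2*H+1))) = 0"
      using assms by (intro sum_cis_zero) (auto simp: ibox_def abs_le_iff minus_le_iff)
    with False show ?thesis by (auto simp only: finite prod_zero_iff UNIV_I if_False)
  next
    case True
    thus ?thesis using assms(1) by (simp add: of_nat_diff)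
  qed
  finally show ?thesis .
qed

text \<open>The condition on differences ensures that no two points of \<open>S\<close> are
  congruent modulo \<open>2 * H + 1\<close>, so that a function on \<open>S\<close> can be read as
  one on the finite group.\<close>

lemma discrete_plancherel:
  fixes u :: "int^'m \<Rightarrow> complex"
  assumes H: "H \<ge> 0" and S: "finite S" "\<And>n n'. n \<in> S \<Longrightarrow> n' \<in> S \<Longrightarrow> n - n' \<in> ibox (-2*H) (2*H)"
  shows "(\<Sum>k\<in>ibox (-H) H. (norm (\<Sum>n\<in>S. u n * cnj (dchar (2*H+1) k n)))\<^sup>2) =
     of_int (2*H+1) ^ CARD('m) * (\<Sum>n\<in>S. (norm (u n))\<^sup>2)"
proof -
  let ?I = "ibox (-H) H :: (int^'m) set" and ?L = "2*H+1"
  have "complex_of_real (\<Sum>k\<in>?I. (norm (\<Sum>n\<in>S. u n * cnj (dchar ?L k n)))\<^sup>2) =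
     (\<Sum>k\<in>?I. (\<Sum>n\<in>S. u n * cnj (dchar ?L k n)) * (\<Sum>n\<in>S. cnj (u n) * dchar ?L k n))"
    by (simp only: of_real_sum complex_norm_square cnj_sum complex_cnj_mult complex_cnj_cnj)
  also have "\<dots> = (\<Sum>k\<in>?I. \<Sum>n\<in>S. \<Sum>n'\<in>S. u n * cnj (u n') * dchar ?L k (n' - n))"
    by (simp add: sum_product dchar_diff mult_ac)
  also have "\<dots> = (\<Sum>n\<in>S. \<Sum>n'\<in>S. u n * cnj (u n') * (\<Sum>k\<in>?I. dchar ?L k (n' - n)))"
    by (subst sum.swap, rule sum.cong[OF refl], subst sum.swap) (simp add: sum_distrib_left)
  also have "\<dots> = (\<Sum>n\<in>S. \<Sum>n'\<in>S. if n' = n then u n * cnj (u n') * of_int ?L ^ CARD('m) else 0)"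
    using S H by (intro sum.cong refl) (auto simp: dchar_orthogonal)
  also have "\<dots> = complex_of_real (of_int ?L ^ CARD('m) * (\<Sum>n\<in>S. (norm (u n))\<^sup>2))"
    using S(1) by (simp add: complex_norm_square[symmetric] sum_distrib_right mult.commute del: of_int_add of_int_mult)
  finally show ?thesis by (simp only: of_real_eq_iff)
qed

text \<open>By Plancherel, the fourth moment of the transform is the \<open>l\<^sup>2\<close> norm of the autocorrelation, which is at
  least \<open>s\<close> at each almost period in \<open>E\<close>.\<close>

lemma discrete_inverse:
  fixes u :: "int^'m \<Rightarrow> complex" and K :: int
  assumes K: "K \<ge> 0" and B: "\<And>n. norm (u n) \<le> B" and e: "e \<ge> 0"
    and E: "E \<subseteq> ibox (-K) (2*K)" "\<And>b n. b \<in> E \<Longrightarrow> norm (u (n + b) - u n) \<le> e"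
    and M: "\<And>k. k \<in> ibox (-(3*K)) (3*K) \<Longrightarrow> norm (\<Sum>n\<in>ibox 0 K. u n * cnj (dchar (2*(3*K)+1) k n)) \<le> M"
    and S: "(\<Sum>n\<in>ibox 0 K. (norm (u n))\<^sup>2) \<ge> s + e * B * of_int (K + 1) ^ CARD('m)" "s \<ge> 0"
  shows "of_nat (card E) * s\<^sup>2 \<le> M\<^sup>2 * B\<^sup>2 * of_int (4 * K + 1) ^ CARD('m)"
proof -
  \<comment> \<open>\<open>U\<close> is large enough to contain \<open>n + b\<close> for
    \<open>n\<close> in \<open>W\<close> and \<open>b\<close> in \<open>E\<close>, whose coordinates
    run from \<open>0\<close> to \<open>K\<close> and from \<open>-K\<close> to
    \<open>2 * K\<close>.\<close>
  define W U I where "W = (ibox 0 K :: (int^'m) set)" and "U = (ibox (-K) (3*K) :: (int^'m) set)"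
    and "I = (ibox (-(3*K)) (3*K) :: (int^'m) set)"
  \<comment> \<open>Points of \<open>D\<close> have coordinates between \<open>-2 * K\<close> and
    \<open>3 * K\<close>, hence differences of at most \<open>5 * K\<close>; the modulus
    \<open>6 * K + 1\<close> keeps them apart, and likewise the points of \<open>U\<close>.\<close>
  define L where "L = 2*(3*K)+1"
  have L: "L > 0" using K by (simp add: L_def)
  \<comment> \<open>The correlation of \<open>u\<close> on \<open>U\<close> with \<open>u\<close> on
    the smaller window \<open>W\<close>. The larger window in one factor makes all products
    \<open>u (n + b) * cnj (u n)\<close> with \<open>n\<close> in \<open>W\<close> occur when
    \<open>b\<close> lies in \<open>E\<close>.\<close>
  define c where "c = (\<lambda>b. \<Sum>p\<in>{p\<in>U \<times> W. fst p - snd p = b}. u (fst p) * cnj (u (snd p)))"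
  define D where "D = (\<lambda>p. fst p - snd p) ` (U \<times> W)"
  define uh where "uh = (\<lambda>k. \<Sum>n\<in>U. u n * cnj (dchar L k n))"
  define vh where "vh = (\<lambda>k. \<Sum>n\<in>W. u n * cnj (dchar L k n))"
  have fin [simp]: "finite W" "finite U" "finite I" "finite D" by (simp_all add: W_def U_def I_def D_def)
  have B0: "B \<ge> 0" using B[of 0] norm_ge_zero order_trans by blast
  \<comment> \<open>The transform turns the correlation into a product of transforms.\<close>
  have prod: "uh k * cnj (vh k) = (\<Sum>b\<in>D. c b * cnj (dchar L k b))" for k
  proof -
    have "uh k * cnj (vh k) = (\<Sum>p\<in>U \<times> W. u (fst p) * cnj (u (snd p)) * cnj (dchar L k (fst p - snd p)))"
      unfolding uh_def vh_def by (simp add: sum_product sum.cartesian_product split_beta dchar_diff mult_ac)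
    also have "\<dots> = (\<Sum>b\<in>D. \<Sum>p\<in>{p\<in>U \<times> W. fst p - snd p = b}. u (fst p) * cnj (u (snd p)) * cnj (dchar L k (fst p - snd p)))"
      unfolding D_def by (rule sum.image_gen) simp
    also have "\<dots> = (\<Sum>b\<in>D. c b * cnj (dchar L k b))"
      unfolding c_def sum_distrib_right by (intro sum.cong) auto
    finally show ?thesis .
  qed
  have D2: "b - b' \<in> ibox (-2*(3*K)) (2*(3*K))" if bb: "b \<in> D" "b' \<in> D" for b b'
  proof -
    obtain p q where pq: "p \<in> U \<times> W" "b = fst p - snd p" "q \<in> U \<times> W" "b' = fst q - snd q"
      using bb unfolding D_def by blast
    define n1 n2 n3 n4 where "n1 = fst p" and "n2 = snd p" and "n3 = fst q" and "n4 = snd q"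
    have n: "b = n1 - n2" "b' = n3 - n4" "n1 \<in> U" "n2 \<in> W" "n3 \<in> U" "n4 \<in> W"
      using pq by (auto simp: n1_def n2_def n3_def n4_def)
    have "-2*(3*K) \<le> (b - b') $ i \<and> (b - b') $ i \<le> 2*(3*K)" for i
    proof -
      have "n1 $ i \<in> {-K..3*K}" "n3 $ i \<in> {-K..3*K}" "n2 $ i \<in> {0..K}" "n4 $ i \<in> {0..K}"
        using n(3-6) by (auto simp: U_def W_def ibox_def)
      thus ?thesis using n(1,2) K by auto
    qed
    thus ?thesis by (simp add: ibox_def)
  qed
  have U2: "n - n' \<in> ibox (-2*(3*K)) (2*(3*K))" if "n \<in> U" "n' \<in> U" for n n'
  proof -
    have "-2*(3*K) \<le> (n - n') $ i \<and> (n - n') $ i \<le> 2*(3*K)" for i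
    proof -
      have "n $ i \<in> {-K..3*K}" "n' $ i \<in> {-K..3*K}" using that by (auto simp: U_def ibox_def)
      thus ?thesis using K by auto
    qed
    thus ?thesis by (simp add: ibox_def)
  qed
  have low: "s \<le> norm (c b)" if b: "b \<in> E" for b
  proof -
    have bK: "-K \<le> b $ i" "b $ i \<le> 2 * K" for i using b E(1) by (auto simp: ibox_def)
    have mem: "n + b \<in> U" if "n \<in> W" for n
    proof -
      have "-K \<le> (n + b) $ i \<and> (n + b) $ i \<le> 3 * K" for i
      proof -
        have "n $ i \<in> {0..K}" using that by (auto simp: W_def ibox_def)
        thus ?thesis using bK[of i] by auto
      qed
      thus ?thesis by (simp add: U_def ibox_def)
    qed
    have cb: "c b = (\<Sum>n\<in>W. u (n + b) * cnj (u n))"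
      unfolding c_def
      by (rule sum.reindex_bij_witness[of _ "\<lambda>n. (n + b, n)" snd]) (auto simp: mem algebra_simps)
    \<comment> \<open>The energy on \<open>W\<close> is the correlation at shift 0; passing to an
      almost period changes it by at most \<open>e * B\<close> per point.\<close>
    have "(\<Sum>n\<in>W. complex_of_real ((norm (u n))\<^sup>2)) - c b = (\<Sum>n\<in>W. (u n - u (n + b)) * cnj (u n))"
      unfolding cb sum_subtractf[symmetric] by (simp only: complex_norm_square left_diff_distrib)
    also have "norm \<dots> \<le> of_nat (card W) * (e * B)"
    proof (rule sum_norm_bound)
      fix n
      have "norm (u n - u (n + b)) \<le> e"
        using E(2)[OF b, of n] by (metis norm_minus_commute)
      thus "norm ((u n - u (n + b)) * cnj (u n)) \<le> e * B"
        by (auto simp: norm_mult B0 e B intro!: mult_mono)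
    qed
    also have "real (card W) = of_int (K + 1) ^ CARD('m)"
      using K by (simp add: W_def card_ibox of_nat_power)
    finally have 1: "norm ((\<Sum>n\<in>W. complex_of_real ((norm (u n))\<^sup>2)) - c b) \<le> of_int (K + 1) ^ CARD('m) * (e * B)" .
    have "norm (\<Sum>n\<in>W. complex_of_real ((norm (u n))\<^sup>2)) = (\<Sum>n\<in>W. (norm (u n))\<^sup>2)"
      unfolding of_real_sum[symmetric] norm_of_real by (intro abs_of_nonneg sum_nonneg) auto
    moreover have "(\<Sum>n\<in>W. (norm (u n))\<^sup>2) \<ge> s + e * B * of_int (K + 1) ^ CARD('m)"
      using S unfolding W_def by simp
    ultimately show "s \<le> norm (c b)"
      using 1 norm_triangle_ineq2[of "\<Sum>n\<in>W. complex_of_real ((norm (u n))\<^sup>2)" "c b"]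
      by (simp add: mult_ac)
  qed
  have ED: "b \<in> D" if "b \<in> E" for b
  proof -
    have "b \<in> U" using E(1) that K by (auto simp: U_def ibox_def subset_iff) (smt (verit, best))
    moreover have "0 \<in> W" using K by (auto simp: W_def ibox_def)
    ultimately show ?thesis unfolding D_def by (force intro!: image_eqI[of _ _ "(b, 0)"])
  qed
  hence ED: "E \<subseteq> D" by blast
  have L0: "real_of_int L ^ CARD('m) > 0" using L by simp
  have "of_nat (card E) * s\<^sup>2 = (\<Sum>b\<in>E. s\<^sup>2)" by simp
  also have "\<dots> \<le> (\<Sum>b\<in>E. (norm (c b))\<^sup>2)"
    using low S(2) by (intro sum_mono power_mono) auto
  also have "\<dots> \<le> (\<Sum>b\<in>D. (norm (c b))\<^sup>2)" using ED by (intro sum_mono2) auto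
  finally have 1: "of_int L ^ CARD('m) * (of_nat (card E) * s\<^sup>2) \<le> of_int L ^ CARD('m) * (\<Sum>b\<in>D. (norm (c b))\<^sup>2)"
    using L0 by (simp add: mult_left_mono)
  \<comment> \<open>Plancherel is used twice: for \<open>c\<close>, and, after one factor has been
    bounded by \<open>M\<close>, for \<open>u\<close> on \<open>U\<close>. The powers of
    \<open>L\<close> cancel.\<close>
  also have "\<dots> = (\<Sum>k\<in>I. (norm (\<Sum>b\<in>D. c b * cnj (dchar L k b)))\<^sup>2)"
    unfolding I_def L_def using D2 K by (intro discrete_plancherel[symmetric]) auto
  also have "\<dots> = (\<Sum>k\<in>I. (norm (uh k))\<^sup>2 * (norm (vh k))\<^sup>2)"
    by (simp add: prod[symmetric] norm_mult power_mult_distrib)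
  also have "\<dots> \<le> (\<Sum>k\<in>I. (norm (uh k))\<^sup>2 * M\<^sup>2)"
    using M unfolding vh_def W_def I_def L_def
    by (intro sum_mono mult_left_mono power_mono) auto
  also have "\<dots> = (\<Sum>k\<in>I. (norm (uh k))\<^sup>2) * M\<^sup>2" by (simp add: sum_distrib_right)
  also have "(\<Sum>k\<in>I. (norm (uh k))\<^sup>2) = of_int L ^ CARD('m) * (\<Sum>n\<in>U. (norm (u n))\<^sup>2)"
    unfolding I_def uh_def L_def using U2 K by (intro discrete_plancherel) auto
  also have "of_int L ^ CARD('m) * (\<Sum>n\<in>U. (norm (u n))\<^sup>2) * M\<^sup>2 \<le> of_int L ^ CARD('m) * (of_nat (card U) * B\<^sup>2) * M\<^sup>2"
    using L0 by (intro mult_right_mono mult_left_mono sum_bounded_above power_mono B) auto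
  also have "\<dots> = of_int L ^ CARD('m) * (M\<^sup>2 * B\<^sup>2 * of_nat (card U))" by simp
  finally have "of_nat (card E) * s\<^sup>2 \<le> M\<^sup>2 * B\<^sup>2 * of_nat (card U)"
    using L0 by (simp add: mult_le_cancel_left_pos)
  also have "real (card U) = of_int (4 * K + 1) ^ CARD('m)"
    using K by (simp add: U_def card_ibox of_nat_power)
  finally show ?thesis .
qed

section \<open>Integrals over grid cells\<close>

lemma lborel_integral_prod:
  fixes f :: "'a::euclidean_space \<Rightarrow> real \<Rightarrow> complex"
  assumes f: "\<And>b. b \<in> Basis \<Longrightarrow> integrable lborel (f b)"
  shows "(\<integral>x. (\<Prod>b\<in>Basis. f b (x \<bullet> b)) \<partial>lborel) = (\<Prod>b\<in>Basis. \<integral>t. f b t \<partial>lborel)"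
proof -
  interpret product_sigma_finite "\<lambda>_::'a. interval_measure (\<lambda>x. x)"
    by (intro product_sigma_finite.intro) (metis lborel_eq_real sigma_finite_lborel)
  have f': "integrable (interval_measure (\<lambda>x. x)) (f b)" if "b \<in> Basis" for b
    using f[OF that] by (simp add: lborel_eq_real)
  have m: "f b \<in> borel_measurable borel" if "b \<in> Basis" for b
    using borel_measurable_integrable[OF f[OF that]] by simp
  have "(\<integral>x. (\<Prod>b\<in>Basis. f b (x \<bullet> b)) \<partial>lborel) =
     (\<integral>y. (\<Prod>b\<in>Basis. f b ((\<Sum>c\<in>Basis. y c *\<^sub>R c) \<bullet> b)) \<partial>(\<Pi>\<^sub>M b\<in>(Basis :: 'a set). interval_measure (\<lambda>x. x)))"
    unfolding lborel_def[where 'a='a]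
    by (rule integral_distr) (auto intro!: borel_measurable_prod measurable_compose[OF _ m])
  also have "\<dots> = (\<integral>y. (\<Prod>b\<in>Basis. f b (y b)) \<partial>(\<Pi>\<^sub>M b\<in>(Basis :: 'a set). interval_measure (\<lambda>x. x)))"
    by (intro Bochner_Integration.integral_cong prod.cong refl) simp
  also have "\<dots> = (\<Prod>b\<in>Basis. \<integral>t. f b t \<partial>lborel)"
    by (subst product_integral_prod) (auto simp: f' lborel_eq_real)
  finally show ?thesis .
qed

text \<open>The Taylor remainder \<open>x ^ 3 / 6\<close> is at most \<open>x / 2\<close>, because
  the square of \<open>x\<close> is at most 3 on this interval.\<close>

lemma sin_ge_half: "0 \<le> x \<Longrightarrow> x \<le> pi / 2 \<Longrightarrow> sin x \<ge> x / 2"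
proof -
  assume x: "0 \<le> x" "x \<le> pi / 2"
  have "\<bar>sin x - (\<Sum>m<3. sin_coeff m * x ^ m)\<bar> \<le> inverse (fact 3) * \<bar>x\<bar> ^ 3"
    by (rule Maclaurin_sin_bound)
  hence "\<bar>sin x - x\<bar> \<le> x ^ 3 / 6"
    using x by (simp add: sin_coeff_def eval_nat_numeral fact_numeral)
  moreover have "x ^ 3 / 6 \<le> x / 2"
  proof -
    have "x \<le> 1.7" using x pi_less_4 pi_approx by simp
    hence "x * x \<le> 1.7 * 1.7" using x by (intro mult_mono) auto
    hence "x * (x * x) \<le> x * 3" using x by (intro mult_left_mono) auto
    thus ?thesis by (simp add: power3_eq_cube)
  qed
  ultimately show ?thesis by linarith
qed

text \<open>The modulus of the integral is
  \<open>2 * sin (d * \<bar>l\<bar> / 2) / \<bar>l\<bar>\<close> for nonzero \<open>l\<close>, and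
  the argument of the sine is at most \<open>pi / 2\<close>, where the sine is at least half its
  argument.\<close>

lemma integral_cis_ge:
  assumes "d > 0" "\<bar>l\<bar> * d \<le> pi"
  shows "norm (integral {0..d} (\<lambda>t. cis (- (t * l)))) \<ge> d / 2"
proof (cases "l = 0")
  case True
  thus ?thesis using assms by simp
next
  case False
  define c where "c = complex_of_real l * \<i>"
  have c: "c \<noteq> 0" using False by (simp add: c_def)
  have "((\<lambda>t. cis (- (t * l))) has_integral (- cis (- (d * l)) / c - (- cis (- (0 * l)) / c))) {0..d}"
  proof (rule fundamental_theorem_of_calculus)
    fix x assume "x \<in> {0..d}"
    have "((\<lambda>t. - exp (- c * t) / c) has_field_derivative exp (- c * complex_of_real x)) (at (complex_of_real x))"
      using c by (auto intro!: derivative_eq_intros)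
    hence "((\<lambda>t. - exp (- c * complex_of_real t) / c) has_vector_derivative exp (- c * complex_of_real x)) (at x within {0..d})"
      by (rule has_vector_derivative_real_field)
    thus "((\<lambda>t. - cis (- (t * l)) / c) has_vector_derivative cis (- (x * l))) (at x within {0..d})"
      by (simp add: cis_conv_exp c_def mult_ac)
  qed (use assms in auto)
  hence "norm (integral {0..d} (\<lambda>t. cis (- (t * l)))) = norm ((1 - cis (- (d * l))) / c)"
    by (simp add: integral_unique diff_divide_distrib)
  also have "\<dots> = norm (exp (\<i> * complex_of_real (- (d * l))) - 1) / \<bar>l\<bar>"
    by (simp add: norm_divide c_def norm_mult cis_conv_exp norm_minus_commute)
  also have "norm (exp (\<i> * complex_of_real (- (d * l))) - 1) = 2 * \<bar>sin (d * l / 2)\<bar>"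
    using dist_exp_i_1[of "- (d * l)"] by simp
  also have "\<bar>sin (d * l / 2)\<bar> = sin (d * \<bar>l\<bar> / 2)"
  proof -
    have "d * \<bar>l\<bar> \<le> pi" using assms by (simp add: mult.commute)
    hence "d * \<bar>l\<bar> / 2 \<le> pi" using pi_gt_zero by linarith
    hence "sin (d * \<bar>l\<bar> / 2) \<ge> 0" using assms by (intro sin_ge_zero) auto
    thus ?thesis by (cases "l \<ge> 0") auto
  qed
  also have "2 * (d * \<bar>l\<bar> / 2 / 2) / \<bar>l\<bar> \<le> 2 * sin (d * \<bar>l\<bar> / 2) / \<bar>l\<bar>"
    using assms by (intro divide_right_mono mult_left_mono sin_ge_half) (auto simp: mult.commute)
  hence "d / 2 \<le> 2 * sin (d * \<bar>l\<bar> / 2) / \<bar>l\<bar>" using False by simp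
  finally show ?thesis .
qed

text \<open>The integral is a product over the coordinates. The condition on \<open>l\<close> says
  that the mesh \<open>d\<close> resolves the frequency, so that the character does not cancel out
  over one cell.\<close>

lemma integral_cell_echar:
  fixes l :: "real^'m"
  assumes "d > 0" "\<And>j. \<bar>l $ j\<bar> * d \<le> pi"
  shows "norm (integral (cbox 0 (d *\<^sub>R One)) (echar (- l))) \<ge> (d / 2) ^ CARD('m)"
proof -
  define f where "f = (\<lambda>b t. indicator {0..d} t *\<^sub>R cis (- (t * (l \<bullet> b))))"
  have int: "integrable lborel (f b)" for b
    unfolding f_def by (intro borel_integrable_compact continuous_intros) (auto simp: cis_conv_exp intro!: continuous_intros)
  have fb: "(\<integral>t. f b t \<partial>lborel) = integral {0..d} (\<lambda>t. cis (- (t * (l \<bullet> b))))" for b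
    using int[of b] set_borel_integral_eq_integral(2)[of "{0..d}" "\<lambda>t. cis (- (t * (l \<bullet> b)))"]
    unfolding f_def set_integrable_def set_lebesgue_integral_def by simp
  have eq: "indicator (cbox 0 (d *\<^sub>R One)) x *\<^sub>R echar (- l) x = (\<Prod>b\<in>Basis. f b (x \<bullet> b))" for x :: "real^'m"
  proof -
    have "echar (- l) x = cis (\<Sum>b\<in>Basis. - ((x \<bullet> b) * (l \<bullet> b)))"
      unfolding echar_def by (subst euclidean_inner) (simp add: sum_negf)
    also have "\<dots> = (\<Prod>b\<in>Basis. cis (- ((x \<bullet> b) * (l \<bullet> b))))"
      by (simp add: cis_conv_exp exp_sum sum_distrib_left)
    finally have "echar (- l) x = (\<Prod>b\<in>Basis. cis (- ((x \<bullet> b) * (l \<bullet> b))))" .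
    moreover have "complex_of_real (indicator (cbox 0 (d *\<^sub>R One)) x) = (\<Prod>b\<in>Basis. complex_of_real (indicator {0..d} (x \<bullet> b)))"
    proof (cases "x \<in> cbox 0 (d *\<^sub>R One)")
      case True
      thus ?thesis by (auto simp: mem_box inner_sum_left_Basis indicator_def)
    next
      case False
      then obtain b where "b \<in> Basis" "x \<bullet> b \<notin> {0..d}"
        by (auto simp: mem_box inner_sum_left_Basis)
      thus ?thesis using False by (auto intro!: bexI[of _ b])
    qed
    ultimately show ?thesis
      by (simp add: f_def scaleR_conv_of_real prod.distrib)
  qed
  have "integrable lborel (\<lambda>x. indicator (cbox 0 (d *\<^sub>R One)) x *\<^sub>R echar (- l) x)"
    by (intro borel_integrable_compact continuous_intros) auto
  hence "integral (cbox 0 (d *\<^sub>R One)) (echar (- l)) = (\<integral>x. indicator (cbox 0 (d *\<^sub>R One)) x *\<^sub>R echar (- l) x \<partial>lborel)"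
    using set_borel_integral_eq_integral(2)[of "cbox 0 (d *\<^sub>R One)" "echar (- l)"]
    unfolding set_integrable_def set_lebesgue_integral_def by simp
  also have "\<dots> = (\<Prod>b\<in>Basis. \<integral>t. f b t \<partial>lborel)"
    unfolding eq by (rule lborel_integral_prod[OF int])
  finally have "norm (integral (cbox 0 (d *\<^sub>R One)) (echar (- l))) = (\<Prod>b\<in>Basis. norm (integral {0..d} (\<lambda>t. cis (- (t * (l \<bullet> b))))))"
    by (simp add: prod_norm fb)
  also have "\<dots> \<ge> (\<Prod>b\<in>(Basis :: (real^'m) set). d / 2)"
  proof (rule prod_mono)
    fix b :: "real^'m" assume "b \<in> Basis"
    then obtain j where "b = axis j 1" by (auto simp: Basis_vec_def)
    hence "l \<bullet> b = l $ j" by (simp add: inner_axis)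
    thus "0 \<le> d / 2 \<and> d / 2 \<le> norm (integral {0..d} (\<lambda>t. cis (- (t * (l \<bullet> b)))))"
      using assms integral_cis_ge[of d "l $ j"] by simp
  qed
  finally show ?thesis by simp
qed

definition gp :: "real \<Rightarrow> int^'m \<Rightarrow> real^'m" where
  "gp d n = (\<chi> i. d * of_int (n $ i))"

lemma gp_nth [simp]: "gp d n $ i = d * of_int (n $ i)"
  by (simp add: gp_def)

lemma gp_add: "gp d (n + k) = gp d n + gp d k" and gp_diff: "gp d (n - k) = gp d n - gp d k"
  by (simp_all add: vec_eq_iff algebra_simps)

lemma integral_tiling:
  fixes g :: "real^'m \<Rightarrow> 'b::banach"
  assumes g: "continuous_on UNIV g" and d: "d > 0" and K: "K \<ge> 0"
  shows "integral (cbox 0 ((d * of_int (K + 1)) *\<^sub>R One)) g =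
     (\<Sum>n\<in>ibox 0 K. integral (cbox 0 (d *\<^sub>R One)) (\<lambda>s. g (gp d n + s)))"
proof -
  define Q where "Q = (\<lambda>n :: int^'m. cbox (gp d n) (gp d n + d *\<^sub>R One))"
  have mem: "x \<in> Q n \<longleftrightarrow> (\<forall>i. d * of_int (n $ i) \<le> x $ i \<and> x $ i \<le> d * of_int (n $ i) + d)" for x n
    by (auto simp: Q_def mem_box_cart)
  have disj: "interior (Q n) \<inter> interior (Q n') = {}" if "n \<noteq> n'" for n n'
  proof (rule ccontr)
    assume "interior (Q n) \<inter> interior (Q n') \<noteq> {}"
    then obtain x where x: "x \<in> interior (Q n)" "x \<in> interior (Q n')" by auto
    have i: "d * of_int (n $ i) < x $ i \<and> x $ i < d * of_int (n $ i) + d"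
      "d * of_int (n' $ i) < x $ i \<and> x $ i < d * of_int (n' $ i) + d" for i
      using x unfolding Q_def interior_cbox by (auto simp: mem_box_cart)
    have "n $ i = n' $ i" for i
    proof -
      have "d * of_int (n $ i) < d * (of_int (n' $ i) + 1)" "d * of_int (n' $ i) < d * (of_int (n $ i) + 1)"
        using i[of i] by (auto simp: distrib_left)
      hence "of_int (n $ i) < real_of_int (n' $ i + 1)" "of_int (n' $ i) < real_of_int (n $ i + 1)"
        using d by (auto simp: mult_less_cancel_left_pos)
      thus ?thesis unfolding of_int_less_iff by linarith
    qed
    thus False using that by (simp add: vec_eq_iff)
  qed
  have ne: "interior (Q n) \<noteq> {}" for n
    unfolding Q_def interior_cbox using d by (simp add: interval_ne_empty_cart)
  have inj: "inj_on Q (ibox 0 K)"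
    using disj ne by (metis inf.idem inj_onI)
  have cover: "\<Union>(Q ` ibox 0 K) = cbox 0 ((d * of_int (K + 1)) *\<^sub>R One)"
  proof (intro equalityI subsetI)
    fix x assume "x \<in> \<Union>(Q ` ibox 0 K)"
    then obtain n where n: "n \<in> ibox 0 K" "x \<in> Q n" by auto
    have "0 \<le> x $ i \<and> x $ i \<le> d * of_int (K + 1)" for i
    proof -
      have "0 \<le> real_of_int (n $ i)" "real_of_int (n $ i) + 1 \<le> of_int (K + 1)" using n(1) by (auto simp: ibox_def)
      hence "0 \<le> d * real_of_int (n $ i)" "d * (real_of_int (n $ i) + 1) \<le> d * of_int (K + 1)"
        using d by (auto intro: mult_left_mono simp del: of_int_add)
      moreover have "d * of_int (n $ i) \<le> x $ i" "x $ i \<le> d * of_int (n $ i) + d" using n(2) mem by auto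
      ultimately show ?thesis unfolding distrib_left by linarith
    qed
    thus "x \<in> cbox 0 ((d * of_int (K + 1)) *\<^sub>R One)"
      by (auto simp: mem_box_cart simp del: of_int_add)
  next
    fix x :: "real^'m" assume "x \<in> cbox 0 ((d * of_int (K + 1)) *\<^sub>R One)"
    hence x: "0 \<le> x $ i" "x $ i \<le> d * of_int (K + 1)" for i by (auto simp: mem_box_cart simp del: of_int_add)
    \<comment> \<open>The minimum assigns points of the outer faces, where the floor would be
      \<open>K + 1\<close>, to the last cell.\<close>
    define n :: "int^'m" where "n = (\<chi> i. min K \<lfloor>x $ i / d\<rfloor>)"
    have "0 \<le> n $ i \<and> n $ i \<le> K" for i using K x(1)[of i] d by (simp add: n_def)
    moreover have "d * of_int (n $ i) \<le> x $ i \<and> x $ i \<le> d * of_int (n $ i) + d" for i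
    proof -
      have "of_int (n $ i) \<le> x $ i / d" unfolding n_def by simp linarith
      moreover have "x $ i / d \<le> of_int (n $ i) + 1"
      proof (cases "K \<le> \<lfloor>x $ i / d\<rfloor>")
        case True
        hence "n $ i = K" by (simp add: n_def)
        thus ?thesis using x(2)[of i] d by (simp add: field_simps)
      next
        case False
        hence "n $ i = \<lfloor>x $ i / d\<rfloor>" by (simp add: n_def)
        thus ?thesis by linarith
      qed
      ultimately show ?thesis using d by (simp add: field_simps)
    qed
    ultimately show "x \<in> \<Union>(Q ` ibox 0 K)" using mem by (force simp: ibox_def)
  qed
  have div: "Q ` ibox 0 K division_of cbox 0 ((d * of_int (K + 1)) *\<^sub>R One)"
  proof (rule division_ofI)
    fix A B assume A: "A \<in> Q ` ibox 0 K" and B: "B \<in> Q ` ibox 0 K" and "A \<noteq> B"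
    obtain n where n: "A = Q n" using A by (rule imageE)
    obtain n' where n': "B = Q n'" using B by (rule imageE)
    have "n \<noteq> n'" using n n' \<open>A \<noteq> B\<close> by metis
    thus "interior A \<inter> interior B = {}" unfolding n n' by (rule disj)
  next
    fix A assume A: "A \<in> Q ` ibox 0 K"
    then obtain n where "A = Q n" by (rule imageE)
    with ne[of n] show "A \<noteq> {}" by (intro notI) simp
    show "A \<subseteq> cbox 0 ((d * of_int (K + 1)) *\<^sub>R One)"
      unfolding cover[symmetric] using A by (rule Union_upper)
    show "\<exists>a b. A = cbox a b" using \<open>A = Q n\<close> unfolding Q_def by metis
  qed (simp_all only: cover finite_imageI finite_ibox)
  have "integral (cbox 0 ((d * of_int (K + 1)) *\<^sub>R One)) g = (\<Sum>k\<in>Q ` ibox 0 K. integral k g)"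
    by (rule integral_combine_division_topdown[OF _ div])
       (intro integrable_continuous continuous_on_subset[OF g], auto)
  also have "\<dots> = (\<Sum>n\<in>ibox 0 K. integral (Q n) g)"
    by (simp add: sum.reindex[OF inj])
  also have "\<dots> = (\<Sum>n\<in>ibox 0 K. integral (cbox 0 (d *\<^sub>R One)) (\<lambda>s. g (gp d n + s)))"
  proof (rule sum.cong[OF refl])
    fix n :: "int^'m"
    show "integral (Q n) g = integral (cbox 0 (d *\<^sub>R One)) (\<lambda>s. g (gp d n + s))"
      using integral_shift_cbox_plus[of 0 "d *\<^sub>R One" g "gp d n"]
      by (simp add: Q_def o_def add.commute)
  qed
  finally show ?thesis .
qed

section \<open>Uniqueness of Fourier coefficients\<close>

text \<open>Every grid point differs from the representative of its colour by an almost period, and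
  it is recovered from that difference and the representative. So the grid points of the box inject
  into pairs, whose second entries are at most as many as the colours.\<close>

lemma card_almost_periods:
  fixes c :: "real^'m \<Rightarrow> nat"
  assumes c: "finite (range c)"
  shows "\<exists>R. \<forall>K\<ge>R. real_of_int (K + 1) ^ CARD('m) \<le>
    real (card {b \<in> ibox (-K) (2*K). \<exists>n n'. b = n - n' \<and> c (gp d n) = c (gp d n')}) * card (range c)"
proof -
  define r :: "nat \<Rightarrow> int^'m" where "r = (\<lambda>j. SOME n. c (gp d n) = j)"
  define s where "s = (\<lambda>n. r (c (gp d n)))"
  have s: "c (gp d (s n)) = c (gp d n)" for n unfolding s_def r_def by (rule someI_ex) auto
  have fs: "finite (range s)" unfolding s_def
    by (rule finite_subset[of _ "r ` range c"]) (use c in auto)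
  have cs: "card (range s) \<le> card (range c)"
    using surj_card_le[OF c, of "range s" r] by (auto simp: s_def)
  \<comment> \<open>Once \<open>K\<close> reaches all coordinates of the finitely many
    representatives in absolute value, the differences stay in the box from \<open>-K\<close> to
    \<open>2 * K\<close>.\<close>
  define R where "R = Max ((\<lambda>(m, i). \<bar>m $ i\<bar>) ` (range s \<times> UNIV))"
  have R: "\<bar>s n $ i\<bar> \<le> R" for n i
    unfolding R_def using fs by (intro Max_ge) (auto intro!: image_eqI[of _ _ "(s n, i)"])
  show ?thesis
  proof (intro exI allI impI)
    fix K assume K: "R \<le> K"
    have K0: "K \<ge> 0" using R[of 0 undefined] K by linarith
    let ?E = "{b \<in> ibox (-K) (2*K). \<exists>n n'. b = n - n' \<and> c (gp d n) = c (gp d n')} :: (int^'m) set"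
    have "card (ibox 0 K :: (int^'m) set) \<le> card (?E \<times> range s)"
    proof (rule card_inj_on_le)
      show "inj_on (\<lambda>n. (n - s n, s n)) (ibox 0 K)" by (auto simp: inj_on_def)
      show "finite (?E \<times> range s)" using fs by auto
      show "(\<lambda>n. (n - s n, s n)) ` ibox 0 K \<subseteq> ?E \<times> range s"
      proof (clarsimp, intro conjI)
        fix n :: "int^'m" assume n: "n \<in> ibox 0 K"
        have "-K \<le> (n - s n) $ i \<and> (n - s n) $ i \<le> 2 * K" for i
        proof -
          have "0 \<le> n $ i" "n $ i \<le> K" using n by (auto simp: ibox_def)
          thus ?thesis using R[of n i] K by auto
        qed
        thus "n - s n \<in> ibox (- K) (2 * K)" by (simp add: ibox_def)
        show "\<exists>na n'. n - s n = na - n' \<and> c (gp d na) = c (gp d n')" using s by metis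
      qed
    qed
    also have "\<dots> = card ?E * card (range s)" by (rule card_cartesian_product)
    also have "\<dots> \<le> card ?E * card (range c)" using cs by simp
    finally have "real (card (ibox 0 K :: (int^'m) set)) \<le> real (card ?E) * real (card (range c))"
      unfolding of_nat_mult[symmetric] of_nat_le_iff .
    thus "real_of_int (K + 1) ^ CARD('m) \<le> real (card ?E) * card (range c)"
      using K0 by (simp add: card_ibox of_nat_power)
  qed
qed

lemma boxavg_corner:
  fixes g :: "real^'m \<Rightarrow> complex"
  shows "integral (cbox 0 ((2 * N) *\<^sub>R One)) g = integral (cub N) (\<lambda>u. g (N *\<^sub>R One + u))"
proof -
  have "N *\<^sub>R One + N *\<^sub>R One = (2 * N) *\<^sub>R (One :: real^'m)"
    by (simp only: scaleR_left_distrib[symmetric] mult_2)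
  thus ?thesis unfolding integral_cub_translate by simp
qed

lemma cbox_corner_norm:
  fixes s :: "real^'m"
  assumes "s \<in> cbox 0 (d *\<^sub>R One)" "d \<ge> 0"
  shows "norm s \<le> d * CARD('m)"
proof -
  have "norm s \<le> (\<Sum>i\<in>UNIV. \<bar>s $ i\<bar>)" by (rule norm_le_l1_cart)
  also have "\<dots> \<le> (\<Sum>i\<in>(UNIV :: 'm set). d)"
    using assms by (intro sum_mono) (auto simp: mem_box_cart)
  finally show ?thesis by (simp add: mult.commute)
qed

lemma integral_cell_bound:
  fixes h :: "real^'m \<Rightarrow> complex"
  assumes "continuous_on UNIV h" "d > 0" "\<And>s. s \<in> cbox 0 (d *\<^sub>R One) \<Longrightarrow> norm (h s) \<le> e"
  shows "norm (integral (cbox 0 (d *\<^sub>R One)) h) \<le> e * d ^ CARD('m)"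
proof -
  have "norm (integral (cbox 0 (d *\<^sub>R One)) h) \<le> integral (cbox 0 (d *\<^sub>R One) :: (real^'m) set) (\<lambda>_. e)"
    using assms by (intro integral_norm_bound_integral integrable_continuous continuous_on_subset[OF assms(1)]) auto
  also have "\<dots> = e * measure lborel (cbox 0 (d *\<^sub>R One) :: (real^'m) set)" by simp
  also have "measure lborel (cbox 0 (d *\<^sub>R One) :: (real^'m) set) = d ^ CARD('m)"
    using assms(2) by (subst content_cbox_cart) (auto simp: interval_ne_empty_cart)
  finally show ?thesis .
qed

text \<open>The point is that \<open>\<gamma>\<close> does not depend on \<open>K\<close>. Samples
  on a grid of mesh \<open>d\<close> have energy proportional to the number of points, and a fixed
  proportion of the shifts are almost periods, so \<open>discrete_inverse\<close> forbids that all
  discrete coefficients be small. Uniform continuity passes from the sample sum to the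
  integral.\<close>

lemma large_frequency:
  fixes g :: "real^'m \<Rightarrow> complex"
  assumes g: "ap g" and nz: "g a \<noteq> 0"
  shows "\<exists>\<gamma>>0. \<exists>d>0. \<exists>K0. \<forall>K\<ge>K0. \<exists>l. (\<forall>j. \<bar>l $ j\<bar> \<le> pi / d) \<and>
     norm (boxavg (d * of_int (K + 1) / 2) (\<lambda>u. g ((d * of_int (K + 1) / 2) *\<^sub>R One + u) *
        echar (- l) ((d * of_int (K + 1) / 2) *\<^sub>R One + u))) \<ge> \<gamma>"
proof -
  let ?m = "CARD('m)"
  define G where "G = (\<lambda>x. g x * cnj (g x))"
  have apG: "ap G" unfolding G_def by (intro ap_mult ap_cnj g)
  have Gn: "G x = complex_of_real ((norm (g x))\<^sup>2)" for x by (simp only: G_def complex_norm_square)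
  define A where "A = Re (mean G)"
  have A: "A > 0" unfolding A_def
    using nz by (intro mean_pos[OF apG, of a]) (auto simp: Gn)
  obtain B where B: "B > 0" "\<And>x. norm (g x) \<le> B" using ap_bounded[OF g] by blast
  \<comment> \<open>With this \<open>e\<close> the loss \<open>e * B\<close> per point in the
    correlation equals \<open>A / 4\<close>.\<close>
  define e where "e = A / (4 * B)"
  have e: "e > 0" using A B by (simp add: e_def)
  obtain c :: "real^'m \<Rightarrow> nat" where c: "finite (range c)"
    "\<And>s t x. c s = c t \<Longrightarrow> norm (g (x + s) - g (x + t)) \<le> e"
    using ap_colouring[OF g e] by blast
  define J where "J = real (card (range c))"
  have "card (range c) \<noteq> 0" using c(1) by (simp add: card_eq_0_iff)
  hence J: "J \<ge> 1" by (simp add: J_def)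
  define k where "k = A / 4"
  have k: "k > 0" using A by (simp add: k_def)
  \<comment> \<open>Chosen so that the inequality of \<open>discrete_inverse\<close> with
    \<open>M = \<eta> * v\<close> fails by a factor 4.\<close>
  define \<eta> where "\<eta> = k / (2 * B * sqrt (J * 4 ^ ?m))"
  have \<eta>: "\<eta> > 0" using k B J by (simp add: \<eta>_def)
  have \<eta>2: "\<eta>\<^sup>2 * B\<^sup>2 * 4 ^ ?m * J * 4 = k\<^sup>2"
    using B J by (simp add: \<eta>_def power_divide power_mult_distrib) 
  \<comment> \<open>Relative to the volume, the large discrete coefficient contributes
    \<open>2 * \<theta>\<close> and the oscillation of \<open>g\<close> within cells takes away
    \<open>\<theta>\<close>.\<close>
  define \<theta> where "\<theta> = \<eta> / 2 ^ (?m + 1)"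
  have \<theta>: "\<theta> > 0" using \<eta> by (simp add: \<theta>_def)
  obtain d1 where d1: "d1 > 0" "\<And>x y. norm (x - y) < d1 \<Longrightarrow> norm (g x - g y) < \<theta>"
    using ap_unif_cont[OF g \<theta>] by blast
  have A4: "A / 4 > 0" using A by simp
  obtain d2 where d2: "d2 > 0" "\<And>x y. norm (x - y) < d2 \<Longrightarrow> norm (G x - G y) < A / 4"
    using ap_unif_cont[OF apG A4] by blast
  \<comment> \<open>Points of a cell are within \<open>d * CARD('m)\<close> of its corner, which is
    half the smaller of the two continuity radii.\<close>
  define d where "d = min d1 d2 / (2 * ?m)"
  have d: "d > 0" using d1 d2 by (simp add: d_def)
  have cell: "norm s < d1" "norm s < d2" if "s \<in> cbox 0 (d *\<^sub>R One)" for s :: "real^'m"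
  proof -
    have "norm s \<le> d * ?m" using that d by (intro cbox_corner_norm) auto
    also have "\<dots> = min d1 d2 / 2" by (simp add: d_def)
    also have "\<dots> < min d1 d2" using d1(1) d2(1) by (simp add: min_def)
    finally show "norm s < d1" "norm s < d2" by auto
  qed
  obtain R where R: "\<And>K. K \<ge> R \<Longrightarrow> real_of_int (K + 1) ^ ?m \<le>
    real (card {b \<in> ibox (-K) (2*K). \<exists>n n' :: int^'m. b = n - n' \<and> c (gp d n) = c (gp d n')}) * J"
    using card_almost_periods[OF c(1), of d] unfolding J_def by blast
  obtain N0 where N0: "N0 > 0" "\<And>N t. N \<ge> N0 \<Longrightarrow> norm (boxavg N (\<lambda>u. G (t + u)) - mean G) \<le> A / 4"
    using mean_uniform[OF apG A4] by blast
  define K0 where "K0 = max (max R 0) \<lceil>2 * N0 / d\<rceil>"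
  have "\<exists>l. (\<forall>j. \<bar>l $ j\<bar> \<le> pi / d) \<and>
     norm (boxavg (d * of_int (K + 1) / 2) (\<lambda>u. g ((d * of_int (K + 1) / 2) *\<^sub>R One + u) *
        echar (- l) ((d * of_int (K + 1) / 2) *\<^sub>R One + u))) \<ge> \<eta> / 2 ^ (?m + 1)" if K: "K \<ge> K0" for K
  proof -
    have K0: "K \<ge> 0" "K \<ge> R" and KN: "of_int K \<ge> 2 * N0 / d" using K by (auto simp: K0_def ceiling_le_iff)
    define v where "v = real_of_int (K + 1) ^ ?m"
    have v: "v > 0" using K0 by (simp add: v_def)
    define N where "N = d * of_int (K + 1) / 2"
    have N: "N > 0" using d K0 by (simp add: N_def)
    have NN0: "N \<ge> N0" using KN d by (simp add: N_def field_simps)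
    have vol: "(2 * N) ^ ?m = d ^ ?m * v" by (simp add: N_def v_def power_mult_distrib)
    define u where "u = (\<lambda>n. g (gp d n))"
    define W where "W = (ibox 0 K :: (int^'m) set)"
    have cardW: "real (card W) = v" using K0 by (simp add: W_def card_ibox v_def of_nat_power)
    have tile: "boxavg N (\<lambda>u. h (N *\<^sub>R One + u)) =
        complex_of_real (1 / (d ^ ?m * v)) * (\<Sum>n\<in>W. integral (cbox 0 (d *\<^sub>R One)) (\<lambda>s. h (gp d n + s)))"
      if "continuous_on UNIV h" for h
    proof -
      have "integral (cub N) (\<lambda>u. h (N *\<^sub>R One + u)) = integral (cbox 0 ((d * of_int (K + 1)) *\<^sub>R One)) h"
        unfolding boxavg_corner[symmetric] by (simp add: N_def)
      also have "\<dots> = (\<Sum>n\<in>W. integral (cbox 0 (d *\<^sub>R One)) (\<lambda>s. h (gp d n + s)))"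
        unfolding W_def by (rule integral_tiling[OF that d K0(1)])
      finally show ?thesis unfolding boxavg_def vol by simp
    qed
    \<comment> \<open>Of the mean square \<open>A\<close>, a quarter is given up for the finite cube
      and a quarter for sampling; the remaining half is split into \<open>k\<close> and
      \<open>e * B\<close>.\<close>
    have S: "(\<Sum>n\<in>W. (norm (u n))\<^sup>2) \<ge> k * v + e * B * v"
    proof -
      have "norm ((\<Sum>n\<in>W. integral (cbox 0 (d *\<^sub>R One)) (\<lambda>s. G (gp d n + s))) - complex_of_real (d ^ ?m) * (\<Sum>n\<in>W. G (gp d n)))
        = norm (\<Sum>n\<in>W. integral (cbox 0 (d *\<^sub>R One)) (\<lambda>s. G (gp d n + s) - G (gp d n)))"
      proof -
        have "integral (cbox 0 (d *\<^sub>R One)) (\<lambda>s. G (gp d n + s) - G (gp d n)) = integral (cbox 0 (d *\<^sub>R One)) (\<lambda>s. G (gp d n + s)) - complex_of_real (d ^ ?m) * G (gp d n)" for n :: "int^'m"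
        proof -
          have "measure lborel (cbox 0 (d *\<^sub>R One) :: (real^'m) set) = d ^ ?m"
            using d by (subst content_cbox_cart) (auto simp: interval_ne_empty_cart)
          thus ?thesis
            by (subst Henstock_Kurzweil_Integration.integral_diff)
               (auto intro!: integrable_continuous continuous_intros ap_continuous_on[OF apG] simp: scaleR_conv_of_real)
        qed
        thus ?thesis by (simp add: sum_subtractf sum_distrib_left)
      qed
      also have "\<dots> \<le> of_nat (card W) * (A / 4 * d ^ ?m)"
      proof (rule sum_norm_bound)
        fix n show "norm (integral (cbox 0 (d *\<^sub>R One)) (\<lambda>s. G (gp d n + s) - G (gp d n))) \<le> A / 4 * d ^ ?m"
        proof (rule integral_cell_bound[OF _ d])
          fix s :: "real^'m" assume "s \<in> cbox 0 (d *\<^sub>R One)"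
          thus "norm (G (gp d n + s) - G (gp d n)) \<le> A / 4"
            using cell d2(2)[of "gp d n + s" "gp d n"] by simp
        qed (auto intro!: continuous_intros ap_continuous_on[OF apG])
      qed
      finally have 1: "norm ((\<Sum>n\<in>W. integral (cbox 0 (d *\<^sub>R One)) (\<lambda>s. G (gp d n + s))) - complex_of_real (d ^ ?m) * (\<Sum>n\<in>W. G (gp d n))) \<le> v * (A / 4 * d ^ ?m)"
        unfolding cardW .
      define X where "X = (\<Sum>n\<in>W. integral (cbox 0 (d *\<^sub>R One)) (\<lambda>s. G (gp d n + s)))"
      have dv: "d ^ ?m * v > 0" using d v by simp
      have "norm (boxavg N (\<lambda>u. G (N *\<^sub>R One + u)) - mean G) \<le> A / 4" by (rule N0(2)[OF NN0])
      hence "\<bar>Re (boxavg N (\<lambda>u. G (N *\<^sub>R One + u)) - mean G)\<bar> \<le> A / 4"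
        by (rule order_trans[OF abs_Re_le_cmod])
      moreover have "boxavg N (\<lambda>u. G (N *\<^sub>R One + u)) = complex_of_real (1 / (d ^ ?m * v)) * X"
        unfolding X_def by (rule tile[OF ap_continuous[OF apG]])
      hence "Re (boxavg N (\<lambda>u. G (N *\<^sub>R One + u))) = Re X / (d ^ ?m * v)" by simp
      ultimately have "Re X / (d ^ ?m * v) \<ge> 3 * A / 4" unfolding minus_complex.sel A_def by linarith
      hence 2: "Re X \<ge> 3 * A / 4 * (d ^ ?m * v)" using dv by (simp only: pos_le_divide_eq)
      have "\<bar>Re (X - complex_of_real (d ^ ?m) * (\<Sum>n\<in>W. G (gp d n)))\<bar> \<le> v * (A / 4 * d ^ ?m)"
        using 1 unfolding X_def[symmetric] by (rule order_trans[OF abs_Re_le_cmod])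
      moreover have "complex_of_real (d ^ ?m) * (\<Sum>n\<in>W. G (gp d n)) = complex_of_real (d ^ ?m * (\<Sum>n\<in>W. (norm (u n))\<^sup>2))"
        by (simp add: Gn u_def)
      ultimately have "Re X - d ^ ?m * (\<Sum>n\<in>W. (norm (u n))\<^sup>2) \<le> v * (A / 4 * d ^ ?m)"
        by (simp only: minus_complex.sel Re_complex_of_real abs_le_iff)
      with 2 have "d ^ ?m * (\<Sum>n\<in>W. (norm (u n))\<^sup>2) \<ge> d ^ ?m * (A / 2 * v)"
        by (simp add: algebra_simps) 
      hence "(\<Sum>n\<in>W. (norm (u n))\<^sup>2) \<ge> A / 2 * v"
        using d by (subst (asm) mult_le_cancel_left_pos) auto
      also have "A / 2 * v = k * v + e * B * v" using B by (simp add: k_def e_def)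
      finally show ?thesis .
    qed
    define E :: "(int^'m) set" where "E = {b \<in> ibox (-K) (2*K). \<exists>n n'. b = n - n' \<and> c (gp d n) = c (gp d n')}"
    have cardE: "v \<le> real (card E) * J" unfolding v_def E_def by (rule R[OF K0(2)])
    have per: "norm (u (n + b) - u n) \<le> e" if b: "b \<in> E" for b n
    proof -
      obtain n1 n2 where n: "b = n1 - n2" "c (gp d n1) = c (gp d n2)" using b by (auto simp: E_def)
      have "norm (g (gp d (n - n2) + gp d n1) - g (gp d (n - n2) + gp d n2)) \<le> e"
        by (rule c(2)[OF n(2)])
      thus ?thesis by (simp add: u_def n(1) gp_add[symmetric] algebra_simps)
    qed
    have "\<exists>q\<in>ibox (-(3*K)) (3*K). norm (\<Sum>n\<in>W. u n * cnj (dchar (2*(3*K)+1) q n)) > \<eta> * v"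
    proof (rule ccontr)
      assume "\<not> ?thesis"
      hence M: "norm (\<Sum>n\<in>ibox 0 K. u n * cnj (dchar (2*(3*K)+1) q n)) \<le> \<eta> * v" if "q \<in> ibox (-(3*K)) (3*K)" for q :: "int^'m"
        using that unfolding W_def by force
      have "of_nat (card E) * (k * v)\<^sup>2 \<le> (\<eta> * v)\<^sup>2 * B\<^sup>2 * of_int (4 * K + 1) ^ ?m"
        by (rule discrete_inverse[OF K0(1) _ _ _ per M])
           (use S k v e B in \<open>auto simp: u_def E_def W_def v_def\<close>)
      also have "real_of_int (4 * K + 1) ^ ?m \<le> (4 * of_int (K + 1)) ^ ?m"
        using K0 by (intro power_mono) auto
      also have "\<dots> = 4 ^ ?m * v" by (simp only: power_mult_distrib v_def)
      finally have "of_nat (card E) * (k * v)\<^sup>2 \<le> (\<eta> * v)\<^sup>2 * B\<^sup>2 * (4 ^ ?m * v)"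
        using B by (simp add: mult_left_mono)
      hence "J * (of_nat (card E) * (k * v)\<^sup>2) \<le> J * ((\<eta> * v)\<^sup>2 * B\<^sup>2 * (4 ^ ?m * v))"
        using J by (intro mult_left_mono) auto
      moreover have "v * (k * v)\<^sup>2 \<le> (real (card E) * J) * (k * v)\<^sup>2"
        by (intro mult_right_mono cardE) auto
      ultimately have "4 * (v * (k * v)\<^sup>2) \<le> (\<eta>\<^sup>2 * B\<^sup>2 * 4 ^ ?m * J * 4) * (v * v\<^sup>2)"
        by (simp add: power_mult_distrib algebra_simps)
      hence "4 * (v * (k * v)\<^sup>2) \<le> v * (k * v)\<^sup>2"
        unfolding \<eta>2 by (simp add: power_mult_distrib algebra_simps)
      moreover have "v * (k * v)\<^sup>2 > 0" using v k by simp
      ultimately show False by linarith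
    qed
    then obtain q where q: "q \<in> ibox (-(3*K)) (3*K)" "norm (\<Sum>n\<in>W. u n * cnj (dchar (2*(3*K)+1) q n)) > \<eta> * v" by blast
    define L where "L = real_of_int (2*(3*K)+1)"
    have L: "L > 0" using K0 by (simp add: L_def)
    \<comment> \<open>On grid points \<open>echar l\<close> is the discrete character of
      \<open>q\<close>. Since \<open>3 * K / (6 * K + 1)\<close> is below one half, the frequency is
      resolved by the mesh.\<close>
    define l :: "real^'m" where "l = (\<chi> j. 2 * pi * of_int (q $ j) / (L * d))"
    have lj: "\<bar>l $ j\<bar> * d \<le> pi" for j
    proof -
      have "\<bar>l $ j\<bar> * d = 2 * pi * \<bar>of_int (q $ j)\<bar> / L" using d L by (simp add: l_def abs_mult)
      also have "\<dots> \<le> 2 * pi * of_int (3 * K) / L"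
        using q(1) L by (intro divide_right_mono mult_left_mono) (auto simp: ibox_def abs_le_iff minus_le_iff simp flip: of_int_abs of_int_mult)
      also have "\<dots> \<le> pi" using L by (simp add: L_def field_simps)
      finally show ?thesis .
    qed
    have ech: "echar (- l) (gp d n) = cnj (dchar (2*(3*K)+1) q n)" for n
    proof -
      have "echar l (gp d n) = cis (\<Sum>j\<in>UNIV. 2 * pi * of_int (q $ j) * of_int (n $ j) / L)"
        unfolding echar_def inner_vec_def using d L by (intro arg_cong[of _ _ cis] sum.cong) (auto simp: l_def)
      also have "\<dots> = dchar (2*(3*K)+1) q n"
        unfolding dchar_def L_def by (simp add: cis_conv_exp exp_sum sum_distrib_left del: of_int_add of_int_mult)
      finally show ?thesis by (simp add: echar_minus)
    qed
    define Z where "Z = integral (cbox 0 (d *\<^sub>R One)) (echar (- l))"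
    have Z: "norm Z \<ge> (d / 2) ^ ?m" unfolding Z_def by (rule integral_cell_echar[OF d lj])
    define Y where "Y = (\<Sum>n\<in>W. integral (cbox 0 (d *\<^sub>R One)) (\<lambda>s. g (gp d n + s) * echar (- l) (gp d n + s)))"
    \<comment> \<open>Within a cell \<open>g\<close> is frozen at the grid point, so that the
      integral of the character over one cell splits off as the common factor
      \<open>Z\<close>.\<close>
    have "Y - (\<Sum>n\<in>W. u n * echar (- l) (gp d n)) * Z = 
       (\<Sum>n\<in>W. integral (cbox 0 (d *\<^sub>R One)) (\<lambda>s. (g (gp d n + s) - g (gp d n)) * echar (- l) (gp d n + s)))"
    proof -
      have "integral (cbox 0 (d *\<^sub>R One)) (\<lambda>s. (g (gp d n + s) - g (gp d n)) * echar (- l) (gp d n + s))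
        = integral (cbox 0 (d *\<^sub>R One)) (\<lambda>s. g (gp d n + s) * echar (- l) (gp d n + s)) - u n * echar (- l) (gp d n) * Z" for n
      proof -
        have "integral (cbox 0 (d *\<^sub>R One)) (\<lambda>s. (g (gp d n + s) - g (gp d n)) * echar (- l) (gp d n + s)) =
          integral (cbox 0 (d *\<^sub>R One)) (\<lambda>s. g (gp d n + s) * echar (- l) (gp d n + s) - (u n * echar (- l) (gp d n)) * echar (- l) s)"
          by (simp add: echar_add u_def algebra_simps)
        also have "\<dots> = integral (cbox 0 (d *\<^sub>R One)) (\<lambda>s. g (gp d n + s) * echar (- l) (gp d n + s)) - integral (cbox 0 (d *\<^sub>R One)) (\<lambda>s. (u n * echar (- l) (gp d n)) * echar (- l) s)"
          by (rule Henstock_Kurzweil_Integration.integral_diff; intro integrable_continuous continuous_intros ap_continuous_on[OF g])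
        finally show ?thesis by (simp add: Z_def)
      qed
      thus ?thesis by (simp add: Y_def sum_subtractf sum_distrib_right)
    qed
    also have "norm \<dots> \<le> of_nat (card W) * (\<theta> * d ^ ?m)"
    proof (rule sum_norm_bound)
      fix n show "norm (integral (cbox 0 (d *\<^sub>R One)) (\<lambda>s. (g (gp d n + s) - g (gp d n)) * echar (- l) (gp d n + s))) \<le> \<theta> * d ^ ?m"
      proof (rule integral_cell_bound[OF _ d])
        fix s :: "real^'m" assume "s \<in> cbox 0 (d *\<^sub>R One)"
        thus "norm ((g (gp d n + s) - g (gp d n)) * echar (- l) (gp d n + s)) \<le> \<theta>"
          using cell d1(2)[of "gp d n + s" "gp d n"] by (simp add: norm_mult)
      qed (auto intro!: continuous_intros ap_continuous_on[OF g])
    qed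
    finally have Y1: "norm (Y - (\<Sum>n\<in>W. u n * echar (- l) (gp d n)) * Z) \<le> v * (\<theta> * d ^ ?m)"
      unfolding cardW .
    have "\<eta> * v * (d / 2) ^ ?m \<le> norm (\<Sum>n\<in>W. u n * echar (- l) (gp d n)) * norm Z"
      using q(2) \<eta> v d by (intro mult_mono Z) (auto simp: ech)
    also have "\<dots> \<le> norm Y + v * (\<theta> * d ^ ?m)"
      using Y1 norm_triangle_ineq2[of "(\<Sum>n\<in>W. u n * echar (- l) (gp d n)) * Z" Y]
      by (simp add: norm_mult norm_minus_commute)
    finally have "norm Y \<ge> \<theta> * (d ^ ?m * v)"
      by (simp add: \<theta>_def power_divide field_simps)
    moreover have "boxavg N (\<lambda>u. g (N *\<^sub>R One + u) * echar (- l) (N *\<^sub>R One + u)) = complex_of_real (1 / (d ^ ?m * v)) * Y"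
      unfolding Y_def by (rule tile) (intro continuous_intros ap_continuous[OF g])
    ultimately have "norm (boxavg N (\<lambda>u. g (N *\<^sub>R One + u) * echar (- l) (N *\<^sub>R One + u))) \<ge> \<theta>"
      using d v by (simp add: norm_mult norm_divide norm_power pos_le_divide_eq)
    moreover have "\<bar>l $ j\<bar> \<le> pi / d" for j using lj[of j] d by (simp add: pos_le_divide_eq)
    ultimately show ?thesis unfolding N_def \<theta>_def by blast
  qed
  moreover have "\<eta> / 2 ^ (?m + 1) > 0" using \<eta> by simp
  ultimately show ?thesis using d by blast
qed

text \<open>The large cubes grow while the frequencies merely converge, so over a whole cube the
  phases of \<open>l1\<close> and \<open>l0\<close> may drift apart. They stay together over cubes
  of fixed size; the averages over all such small cubes are small, and averaging them again gives a
  small average over the large one.\<close>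

lemma ap_uniqueness:
  fixes g :: "real^'m \<Rightarrow> complex"
  assumes g: "ap g" and zero: "\<And>l. coef g l = 0"
  shows "g x = 0"
proof (rule ccontr)
  assume "g x \<noteq> 0"
  then obtain \<gamma> d K0 where \<gamma>: "\<gamma> > 0" and d: "d > 0" and ex: "\<And>K. K \<ge> K0 \<Longrightarrow> \<exists>l. (\<forall>j. \<bar>l $ j\<bar> \<le> pi / d) \<and>
     norm (boxavg (d * of_int (K + 1) / 2) (\<lambda>u. g ((d * of_int (K + 1) / 2) *\<^sub>R One + u) *
        echar (- l) ((d * of_int (K + 1) / 2) *\<^sub>R One + u))) \<ge> \<gamma>"
    using large_frequency[OF g] by blast
  define N where "N = (\<lambda>n::nat. d * of_int (max K0 (int n) + 1) / 2)"
  have "\<exists>l. \<forall>n. (\<forall>j. \<bar>l n $ j\<bar> \<le> pi / d) \<and> norm (boxavg (N n) (\<lambda>u. g (N n *\<^sub>R One + u) * echar (- l n) (N n *\<^sub>R One + u))) \<ge> \<gamma>"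
    unfolding N_def by (intro choice allI ex) auto
  then obtain l where l: "\<And>n j. \<bar>l n $ j\<bar> \<le> pi / d"
    "\<And>n. norm (boxavg (N n) (\<lambda>u. g (N n *\<^sub>R One + u) * echar (- l n) (N n *\<^sub>R One + u))) \<ge> \<gamma>" by blast
  have "compact (cub (pi / d) :: (real^'m) set)" by (simp add: cub_def)
  moreover have "l n \<in> cub (pi / d)" for n using l(1) by (simp add: mem_cub)
  ultimately obtain r l0 where r: "strict_mono (r :: nat \<Rightarrow> nat)" "(l \<circ> r) \<longlonglongrightarrow> l0"
    unfolding compact_def by blast
  obtain B where B: "B > 0" "\<And>x. norm (g x) \<le> B" using ap_bounded[OF g] by blast
  define \<psi> where "\<psi> = (\<lambda>x. g x * echar (- l0) x)"
  have ap\<psi>: "ap \<psi>" unfolding \<psi>_def by (intro ap_mult g ap_echar)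
  have "mean \<psi> = 0" using zero[of l0] by (simp add: coef_def \<psi>_def)
  \<comment> \<open>\<open>L\<close> is fixed before the index \<open>n\<close>, which has to make
    the frequency error small on \<open>cub L\<close> and the large cube long compared with
    \<open>L\<close>.\<close>
  obtain L where L: "L > 0" "\<And>t. norm (boxavg L (\<lambda>u. \<psi> (t + u))) \<le> \<gamma> / 4"
    using mean_uniform[OF ap\<psi>, of "\<gamma> / 4"] \<gamma> \<open>mean \<psi> = 0\<close> by (metis diff_zero divide_pos_pos order_refl zero_less_numeral)
  define \<rho> where "\<rho> = L * CARD('m)"
  have norm_cub: "norm u \<le> \<rho>" if "u \<in> cub L" for u :: "real^'m"
  proof -
    have "norm u \<le> (\<Sum>i\<in>UNIV. \<bar>u $ i\<bar>)" by (rule norm_le_l1_cart)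
    also have "\<dots> \<le> (\<Sum>i\<in>(UNIV :: 'm set). L)" using that by (intro sum_mono) (auto simp: mem_cub)
    finally show ?thesis by (simp add: \<rho>_def mult.commute)
  qed
  have "((\<lambda>N. 2 * B * ((1 + \<rho> / N) ^ CARD('m) - (1 - \<rho> / N) ^ CARD('m))) \<longlongrightarrow>
      2 * B * ((1 + 0) ^ CARD('m) - (1 - 0) ^ CARD('m))) at_top"
    by (intro tendsto_intros tendsto_divide_0[OF tendsto_const] filterlim_at_top_imp_at_infinity filterlim_ident)
  hence "eventually (\<lambda>N. 2 * B * ((1 + \<rho> / N) ^ CARD('m) - (1 - \<rho> / N) ^ CARD('m)) < \<gamma> / 4) at_top"
    using \<gamma> by (intro order_tendstoD) auto
  moreover have Ntop: "filterlim (\<lambda>n. N (r n)) at_top sequentially"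
  proof (rule filterlim_at_top_mono[of "\<lambda>n. d / 2 * real n"])
    show "filterlim (\<lambda>n. d / 2 * real n) at_top sequentially" using d by real_asymp
    show "\<forall>\<^sub>F n in sequentially. d / 2 * real n \<le> N (r n)"
    proof (intro always_eventually allI)
      fix n
      have "int n \<le> max K0 (int (r n)) + 1" using seq_suble[OF r(1), of n] by linarith
      hence "real n \<le> of_int (max K0 (int (r n)) + 1)" by linarith
      thus "d / 2 * real n \<le> N (r n)" using d unfolding N_def by (simp add: mult_left_mono)
    qed
  qed
  ultimately have ev1: "\<forall>\<^sub>F n in sequentially. 2 * B * ((1 + \<rho> / N (r n)) ^ CARD('m) - (1 - \<rho> / N (r n)) ^ CARD('m)) < \<gamma> / 4"
    by (rule eventually_compose_filterlim)
  have ev2: "\<forall>\<^sub>F n in sequentially. N (r n) > \<rho>"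
    using Ntop unfolding filterlim_at_top_dense by blast
  have "(\<lambda>n. B * (\<rho> * norm (l (r n) - l0))) \<longlonglongrightarrow> B * (\<rho> * norm (l0 - l0))"
    using r(2) by (intro tendsto_intros) (simp add: o_def)
  hence ev3: "\<forall>\<^sub>F n in sequentially. B * (\<rho> * norm (l (r n) - l0)) < \<gamma> / 4"
    using \<gamma> by (intro order_tendstoD) auto
  obtain n where n: "2 * B * ((1 + \<rho> / N (r n)) ^ CARD('m) - (1 - \<rho> / N (r n)) ^ CARD('m)) < \<gamma> / 4"
    "N (r n) > \<rho>" "B * (\<rho> * norm (l (r n) - l0)) < \<gamma> / 4"
    using eventually_happens[OF eventually_conj[OF ev1 eventually_conj[OF ev2 ev3]]] by auto
  define M where "M = N (r n)"
  define l1 where "l1 = l (r n)"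
  define \<phi> where "\<phi> = (\<lambda>x. g x * echar (- l1) x)"
  have ap\<phi>: "ap \<phi>" unfolding \<phi>_def by (intro ap_mult g ap_echar)
  have \<phi>B: "norm (\<phi> x) \<le> B" for x using B by (simp add: \<phi>_def norm_mult)
  have "\<rho> > 0" using L by (simp add: \<rho>_def)
  hence M: "M > \<rho>" "M > 0" using n(2) by (auto simp: M_def)
  have small: "norm (boxavg L (\<lambda>u. \<phi> (t + u))) \<le> \<gamma> / 2" for t
  proof -
    \<comment> \<open>Taking out the phase at \<open>t\<close> leaves a frequency error in the
      single variable \<open>u\<close>, which ranges over the small cube.\<close>
    have split: "\<phi> (t + u) = echar (l0 - l1) t * (\<psi> (t + u) + g (t + u) * echar (- l0) t * (echar (- l1) u - echar (- l0) u))" for u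
    proof -
      have e: "echar (- l1) t = echar (l0 - l1) t * echar (- l0) t" by (simp add: echar_mult)
      show ?thesis unfolding \<phi>_def \<psi>_def echar_add e by (simp only: algebra_simps)
    qed
    have "norm (boxavg L (\<lambda>u. \<phi> (t + u))) = norm (boxavg L (\<lambda>u. \<psi> (t + u)) + boxavg L (\<lambda>u. g (t + u) * echar (- l0) t * (echar (- l1) u - echar (- l0) u)))"
      unfolding split boxavg_cmult norm_mult
      by (subst boxavg_add) (auto intro!: continuous_intros ap_continuous_on[OF g] ap_continuous_on[OF ap\<psi>])
    also have "\<dots> \<le> \<gamma> / 4 + \<gamma> / 4"
    proof (intro norm_triangle_mono L(2) norm_boxavg_le)
      fix u :: "real^'m" assume u: "u \<in> cub L"
      have "norm (echar (- l1) u - echar (- l0) u) \<le> \<bar>u \<bullet> (- l1) - u \<bullet> (- l0)\<bar>" by (rule norm_echar_diff_le)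
      also have "\<dots> = \<bar>u \<bullet> (l1 - l0)\<bar>" by (simp add: inner_diff_right abs_minus_commute)
      also have "\<dots> \<le> \<rho> * norm (l1 - l0)"
        using norm_cub[OF u] by (intro order_trans[OF Cauchy_Schwarz_ineq2] mult_right_mono) auto
      finally have "norm (g (t + u) * echar (- l0) t * (echar (- l1) u - echar (- l0) u)) \<le> B * (\<rho> * norm (l1 - l0))"
        unfolding norm_mult using B by (simp, intro mult_mono) auto
      also have "\<dots> \<le> \<gamma> / 4" using n(3) by (simp add: l1_def)
      finally show "norm (g (t + u) * echar (- l0) t * (echar (- l1) u - echar (- l0) u)) \<le> \<gamma> / 4" .
    qed (auto intro!: continuous_intros ap_continuous_on[OF g] L)
    finally show ?thesis by simp
  qed
  define t0 where "t0 = M *\<^sub>R (One :: real^'m)"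
  define \<xi> where "\<xi> = (\<lambda>x. \<phi> (t0 + x))"
  have ap\<xi>: "ap \<xi>" unfolding \<xi>_def using ap_translate[OF ap\<phi>, of t0] by (simp add: add.commute)
  have "norm (boxavg M (\<lambda>t. boxavg L (\<lambda>u. \<xi> (t + u))) - 0) \<le> \<gamma> / 2"
    using small by (intro ap_boxavg_iterate[OF ap\<xi> M(2) L(1)]) (simp add: \<xi>_def add.assoc[symmetric])
  also have "boxavg M (\<lambda>t. boxavg L (\<lambda>u. \<xi> (t + u))) = boxavg L (\<lambda>u. boxavg M (\<lambda>t. \<xi> (u + t)))"
    by (subst boxavg_swap) (auto intro!: continuous_intros ap_continuous_on[OF ap\<xi>] simp: split_beta add.commute)
  finally have 1: "norm (boxavg L (\<lambda>u. boxavg M (\<lambda>t. \<xi> (u + t)))) \<le> \<gamma> / 2" by simp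
  have contM: "continuous_on UNIV (\<lambda>u. boxavg M (\<lambda>t. \<xi> (u + t)))"
    unfolding boxavg_def cub_def
    by (intro continuous_intros integral_continuous_on_param) (auto intro!: continuous_intros ap_continuous_on[OF ap\<xi>] simp: split_beta)
  have "norm (boxavg L (\<lambda>u. boxavg M (\<lambda>t. \<xi> (u + t)) - boxavg M \<xi>)) \<le> \<gamma> / 4"
  proof (rule norm_boxavg_le)
    fix u :: "real^'m" assume u: "u \<in> cub L"
    have "norm (boxavg M (\<lambda>t. \<xi> (u + t)) - boxavg M \<xi>) \<le> 2 * B * ((1 + \<rho> / M) ^ CARD('m) - (1 - \<rho> / M) ^ CARD('m))"
      using \<phi>B norm_cub[OF u] M by (intro boxavg_translate ap_continuous[OF ap\<xi>]) (auto simp: \<xi>_def)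
    also have "\<dots> \<le> \<gamma> / 4" using n(1) by (simp add: M_def)
    finally show "norm (boxavg M (\<lambda>t. \<xi> (u + t)) - boxavg M \<xi>) \<le> \<gamma> / 4" .
  qed (auto intro!: continuous_intros contM L)
  hence 2: "norm (boxavg L (\<lambda>u. boxavg M (\<lambda>t. \<xi> (u + t))) - boxavg M \<xi>) \<le> \<gamma> / 4"
    using L(1) by (subst (asm) boxavg_diff) (auto simp: contM boxavg_const)
  have "\<gamma> \<le> norm (boxavg M \<xi>)"
    using l(2)[of "r n"] by (simp add: M_def \<xi>_def \<phi>_def t0_def l1_def)
  thus False using 1 2 \<gamma> norm_triangle_ineq3[of "boxavg L (\<lambda>u. boxavg M (\<lambda>t. \<xi> (u + t)))" "boxavg M \<xi>"] by linarith
qed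

section \<open>Approximation by trigonometric polynomials\<close>

lemma mean_cnj:
  assumes "ap g" shows "mean (\<lambda>x. cnj (g x)) = cnj (mean g)"
proof (rule mean_unique)
  have "boxavg N (\<lambda>x. cnj (g x)) = cnj (boxavg N g)" for N
    using integral_linear[OF integrable_cub[OF ap_continuous[OF assms]] bounded_linear_cnj, of N]
    by (simp add: boxavg_def o_def)
  thus "((\<lambda>N. boxavg N (\<lambda>x. cnj (g x))) \<longlongrightarrow> cnj (mean g)) at_top"
    using tendsto_cnj[OF mean_tendsto[OF assms]] by simp
qed

lemma norm_mean_le_Re_mean:
  assumes h: "ap h" and k: "ap k" and le: "\<And>x. norm (h x) \<le> Re (k x)"
  shows "norm (mean h) \<le> Re (mean (k :: real^'m \<Rightarrow> complex))"
proof (rule tendsto_le[OF _ tendsto_Re[OF mean_tendsto[OF k]] tendsto_norm[OF mean_tendsto[OF h]]])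
  show "\<forall>\<^sub>F N in at_top. norm (boxavg N h) \<le> Re (boxavg N k)"
    using eventually_gt_0
  proof eventually_elim
    case (elim N)
    have "norm (integral (cub N) h) \<le> integral (cub N) (\<lambda>x. Re (k x))"
      by (intro integral_norm_bound_integral integrable_cub le continuous_intros ap_continuous h k)
    also have "\<dots> = Re (integral (cub N) k)"
      using integral_linear[OF integrable_cub[OF ap_continuous[OF k]] bounded_linear_Re, of N] by (simp add: o_def)
    finally have *: "(1 / (2 * N) ^ CARD('m)) * norm (integral (cub N) h) \<le> (1 / (2 * N) ^ CARD('m)) * Re (integral (cub N) k)"
      using elim by (intro mult_left_mono) auto
    have "norm (boxavg N h) = (1 / (2 * N) ^ CARD('m)) * norm (integral (cub N) h)"
      unfolding boxavg_def norm_mult norm_of_real using elim by simp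
    moreover have "Re (boxavg N k) = (1 / (2 * N) ^ CARD('m)) * Re (integral (cub N) k)"
      unfolding boxavg_def times_complex.sel by simp
    ultimately show ?case using * by linarith
  qed
qed auto

text \<open>The remainder \<open>h\<close> after subtracting the Fourier sum over
  \<open>\<Lambda>\<close> has zero coefficients on \<open>\<Lambda>\<close>, so its nonnegative
  mean square is that of \<open>g\<close> minus the sum of squares.\<close>

lemma bessel:
  fixes g :: "real^'m \<Rightarrow> complex"
  assumes g: "ap g" and fin: "finite \<Lambda>"
  shows "(\<Sum>l\<in>\<Lambda>. (norm (coef g l))\<^sup>2) \<le> Re (mean (\<lambda>x. g x * cnj (g x)))"
proof -
  define P where "P = (\<lambda>x. \<Sum>l\<in>\<Lambda>. coef g l * echar l x)"
  have P: "ap P" unfolding P_def by (intro ap_sum ap_cmult ap_echar)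
  define h where "h = (\<lambda>x. g x - P x)"
  have h: "ap h" unfolding h_def by (intro ap_diff g P)
  have cP: "coef P l = coef g l" if "l \<in> \<Lambda>" for l
  proof -
    have "coef P l = (\<Sum>l'\<in>\<Lambda>. coef g l' * (if l' = l then 1 else 0))"
      unfolding P_def by (subst coef_sum) (auto simp: coef_cmult coef_echar ap_cmult)
    also have "\<dots> = coef g l" using that fin by (simp add: sum.delta if_distrib cong: if_cong)
    finally show ?thesis .
  qed
  have ch: "coef h l = 0" if "l \<in> \<Lambda>" for l
    unfolding h_def using cP[OF that] by (simp add: coef_diff g P)
  have cn: "cnj (h x) = cnj (g x) - (\<Sum>l\<in>\<Lambda>. cnj (coef g l) * echar (- l) x)" for x
    by (simp add: h_def P_def echar_minus)
  have "mean (\<lambda>x. h x * cnj (h x)) = mean (\<lambda>x. h x * cnj (g x) - (\<Sum>l\<in>\<Lambda>. cnj (coef g l) * (h x * echar (- l) x)))"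
    unfolding cn right_diff_distrib by (simp add: sum_distrib_left mult_ac)
  also have "\<dots> = mean (\<lambda>x. h x * cnj (g x)) - (\<Sum>l\<in>\<Lambda>. cnj (coef g l) * coef h l)"
  proof -
    have a: "ap (\<lambda>x. h x * echar (- l) x)" for l by (intro ap_mult h ap_echar)
    have b: "ap (\<lambda>x. k * (h x * echar (- l) x))" for k l by (intro ap_cmult a)
    have c: "ap (\<lambda>x. h x * cnj (g x))" by (intro ap_mult h ap_cnj g)
    show ?thesis
      by (subst mean_diff[OF c ap_sum[OF b]], subst mean_sum[OF b]) (simp add: mean_cmult[OF a] coef_def)
  qed
  also have "(\<Sum>l\<in>\<Lambda>. cnj (coef g l) * coef h l) = 0" by (simp add: ch)
  also have "mean (\<lambda>x. h x * cnj (g x)) = mean (\<lambda>x. g x * cnj (g x) - (\<Sum>l\<in>\<Lambda>. coef g l * cnj (g x * echar (- l) x)))"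
    by (simp only: h_def P_def left_diff_distrib sum_distrib_right) (simp add: echar_minus mult_ac)
  also have "\<dots> = mean (\<lambda>x. g x * cnj (g x)) - (\<Sum>l\<in>\<Lambda>. coef g l * cnj (coef g l))"
  proof -
    have a: "ap (\<lambda>x. cnj (g x * echar (- l) x))" for l by (intro ap_cnj ap_mult g ap_echar)
    have b: "ap (\<lambda>x. k * cnj (g x * echar (- l) x))" for k l by (intro ap_cmult a)
    have c: "ap (\<lambda>x. g x * cnj (g x))" by (intro ap_mult ap_cnj g)
    have m: "mean (\<lambda>x. cnj (g x * echar (- l) x)) = cnj (coef g l)" for l
      unfolding coef_def by (rule mean_cnj) (intro ap_mult g ap_echar)
    show ?thesis
      by (subst mean_diff[OF c ap_sum[OF b]], subst mean_sum[OF b]) (simp only: mean_cmult[OF a] m)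
  qed
  finally have "mean (\<lambda>x. h x * cnj (h x)) = mean (\<lambda>x. g x * cnj (g x)) - (\<Sum>l\<in>\<Lambda>. coef g l * cnj (coef g l))"
    by simp
  moreover have "Re (mean (\<lambda>x. h x * cnj (h x))) \<ge> 0"
    by (intro Re_mean_nonneg ap_mult ap_cnj h) (simp flip: complex_norm_square of_real_power)
  moreover have "Re (\<Sum>l\<in>\<Lambda>. coef g l * cnj (coef g l)) = (\<Sum>l\<in>\<Lambda>. (norm (coef g l))\<^sup>2)"
    by (simp only: Re_sum complex_norm_square[symmetric] Re_complex_of_real flip: of_real_power)
  ultimately show ?thesis by simp
qed

text \<open>For functions that depend in a Lipschitz way on the translate of \<open>g\<close>:
  uniform continuity of \<open>g\<close> gives continuity, and the colouring of \<open>g\<close> is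
  reused.\<close>

lemma conv_ap:
  fixes g k :: "real^'m \<Rightarrow> complex"
  assumes g: "ap g" and k: "ap k" and kB: "Bk > 0"
    and \<Phi>: "\<And>y z e. (\<And>t. norm (g (y + t) - g (z + t)) \<le> e) \<Longrightarrow> norm (\<Phi> y - \<Phi> z) \<le> Bk * e"
  shows "ap (\<Phi> :: real^'m \<Rightarrow> complex)"
proof (rule ap_compose2[OF g g _ kB])
  show "continuous_on UNIV \<Phi>"
    unfolding continuous_on_iff
  proof (intro ballI allI impI)
    fix x and e :: real assume e: "e > 0"
    hence "e / (2 * Bk) > 0" using kB by simp
    from ap_unif_cont[OF g this] obtain d where d: "d > 0"
      "\<And>x y. norm (x - y) < d \<Longrightarrow> norm (g x - g y) < e / (2 * Bk)" by blast
    have "dist (\<Phi> y) (\<Phi> x) < e" if "dist y x < d" for y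
    proof -
      have "norm (\<Phi> y - \<Phi> x) \<le> Bk * (e / (2 * Bk))"
        using that by (intro \<Phi> less_imp_le d) (simp add: dist_norm)
      thus ?thesis using e kB by (simp add: dist_norm)
    qed
    thus "\<exists>d>0. \<forall>x'\<in>UNIV. dist x' x < d \<longrightarrow> dist (\<Phi> x') (\<Phi> x) < e" using d(1) by blast
  qed
  fix s t e x assume *: "\<And>x. norm (g (x + s) - g (x + t)) \<le> e"
  show "norm (\<Phi> (x + s) - \<Phi> (x + t)) \<le> Bk * e"
  proof (rule \<Phi>)
    fix u show "norm (g (x + s + u) - g (x + t + u)) \<le> e"
      using *[of "x + u"] by (simp add: add_ac)
  qed
qed

lemma ap_shift: "ap g \<Longrightarrow> ap (\<lambda>t. g (x + t))"
  using ap_translate[of g x] by (simp add: add.commute)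

text \<open>The kernel enters as \<open>g (x + t) * k t\<close>, a correlation rather than a
  convolution, which is why \<open>coef k\<close> is taken at \<open>- l\<close>. Fubini is applied
  to averages of finite length \<open>L\<close>, which converge to \<open>\<Phi>\<close>
  uniformly.\<close>

lemma coef_convolution:
  fixes g k :: "real^'m \<Rightarrow> complex"
  assumes g: "ap g" and k: "ap k"
  defines "\<Phi> \<equiv> (\<lambda>x. mean (\<lambda>t. g (x + t) * k t))"
  shows "ap \<Phi>" "coef \<Phi> l = coef g l * coef k (- l)"
proof -
  obtain Bk where Bk: "Bk > 0" "\<And>x. norm (k x) \<le> Bk" using ap_bounded[OF k] by blast
  define F where "F = (\<lambda>L x. boxavg L (\<lambda>t. g (x + t) * k t))"
  have apgk: "ap (\<lambda>t. g (x + t) * k t)" for x by (rule ap_mult[OF ap_shift[OF g] k])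
  have bound: "norm (g (y + t) * k t - g (z + t) * k t) \<le> Bk * e"
    if "norm (g (y + t) - g (z + t)) \<le> e" for y z t e
  proof -
    have "norm (g (y + t) * k t - g (z + t) * k t) = norm (g (y + t) - g (z + t)) * norm (k t)"
      by (simp only: left_diff_distrib[symmetric] norm_mult)
    also have "\<dots> \<le> e * Bk" using that Bk order_trans[OF norm_ge_zero that] by (intro mult_mono) auto
    also have "\<dots> = Bk * e" by simp
    finally show ?thesis .
  qed
  have \<Phi>L: "norm (\<Phi> y - \<Phi> z) \<le> Bk * e" if "\<And>t. norm (g (y + t) - g (z + t)) \<le> e" for y z e
    unfolding \<Phi>_def mean_diff[OF apgk apgk, symmetric]
    by (intro norm_mean_le ap_diff apgk bound that)
  have FL: "norm (F L y - F L z) \<le> Bk * e" if "\<And>t. norm (g (y + t) - g (z + t)) \<le> e" "L > 0" for L y z e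
    unfolding F_def boxavg_diff[OF ap_continuous[OF apgk] ap_continuous[OF apgk], symmetric]
    using that by (intro norm_boxavg_le ap_continuous ap_diff apgk bound)
  show ap\<Phi>: "ap \<Phi>" by (rule conv_ap[OF g k Bk(1) \<Phi>L])
  have apF: "ap (F L)" if "L > 0" for L
    by (rule conv_ap[OF g k Bk(1) FL]) (use that in auto)
  \<comment> \<open>At the finitely many points of a net, convergence is that of the mean; the
    Lipschitz bounds transfer it to all \<open>x\<close>.\<close>
  have unif: "\<forall>\<^sub>F L in at_top. \<forall>x. norm (F L x - \<Phi> x) \<le> e" if e: "e > 0" for e
  proof -
    define e' where "e' = e / (4 * Bk)"
    have e': "e' > 0" using e Bk by (simp add: e'_def)
    obtain T where T: "finite T" "\<And>t. \<exists>s\<in>T. \<forall>x. norm (g (x + t) - g (x + s)) \<le> e'"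
      using ap_net[OF g e'] by blast
    have "\<forall>\<^sub>F L in at_top. \<forall>s\<in>T. dist (F L s) (\<Phi> s) < e / 2"
      unfolding F_def \<Phi>_def using e
      by (intro eventually_ball_finite T ballI tendstoD[OF mean_tendsto] apgk) auto
    thus ?thesis using eventually_gt_0
    proof eventually_elim
      case (elim L)
      show ?case
      proof
        fix x
        obtain s where s: "s \<in> T" "\<And>y. norm (g (y + x) - g (y + s)) \<le> e'" using T(2)[of x] by blast
        have *: "norm (g (x + t) - g (s + t)) \<le> e'" for t using s(2)[of t] by (simp add: add.commute)
        have "norm (F L x - F L s) \<le> Bk * e'" "norm (\<Phi> x - \<Phi> s) \<le> Bk * e'"
          using FL[OF *] \<Phi>L[OF *] elim by auto
        hence "norm (F L x - F L s) \<le> e / 4" "norm (\<Phi> x - \<Phi> s) \<le> e / 4" using Bk by (auto simp: e'_def)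
        moreover have "norm (F L s - \<Phi> s) < e / 2" using elim s(1) by (auto simp: dist_norm)
        moreover have "norm (F L x - \<Phi> x) \<le> norm (F L x - F L s) + norm (F L s - \<Phi> s) + norm (\<Phi> x - \<Phi> s)"
          by norm
        ultimately show "norm (F L x - \<Phi> x) \<le> e" by linarith
      qed
    qed
  qed
  \<comment> \<open>For fixed \<open>L\<close> the mean in \<open>x\<close> moves inside the average
    over \<open>t\<close>; the shift by \<open>t\<close> does no harm since the averages of
    \<open>\<psi>\<close> converge uniformly in the position.\<close>
  have coefF: "coef (F L) l = boxavg L (\<lambda>t. k t * echar l t) * coef g l" if L: "L > 0" for L
    unfolding coef_def[of "F L"]
  proof (rule mean_unique, rule tendstoI)
    fix e :: real assume e: "e > 0"
    define \<psi> where "\<psi> = (\<lambda>x. g x * echar (- l) x)"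
    have ap\<psi>: "ap \<psi>" unfolding \<psi>_def by (intro ap_mult g ap_echar)
    have "e / (2 * Bk) > 0" using e Bk by simp
    from mean_uniform[OF ap\<psi> this] obtain N0 where N0: "N0 > 0"
      "\<And>N t. N \<ge> N0 \<Longrightarrow> norm (boxavg N (\<lambda>u. \<psi> (t + u)) - mean \<psi>) \<le> e / (2 * Bk)" by blast
    have "dist (boxavg N (\<lambda>x. F L x * echar (- l) x)) (boxavg L (\<lambda>t. k t * echar l t) * coef g l) < e" if N: "N \<ge> N0" for N
    proof -
      have "boxavg N (\<lambda>x. F L x * echar (- l) x) = boxavg N (\<lambda>x. boxavg L (\<lambda>t. k t * echar l t * \<psi> (t + x)))"
      proof -
        have "F L x * echar (- l) x = boxavg L (\<lambda>t. k t * echar l t * \<psi> (t + x))" for x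
        proof -
          have "echar (- l) x * (g (x + t) * k t) = k t * echar l t * \<psi> (t + x)" for t
          proof -
            have "k t * echar l t * \<psi> (t + x) = (echar l t * echar (- l) t) * (k t * g (t + x) * echar (- l) x)"
              by (simp only: \<psi>_def echar_add mult_ac)
            thus ?thesis unfolding echar_cancel mult_1 by (simp only: add.commute mult_ac)
          qed
          thus ?thesis unfolding F_def by (subst mult.commute) (simp only: boxavg_cmult[symmetric])
        qed
        thus ?thesis by simp
      qed
      also have "\<dots> = boxavg L (\<lambda>t. boxavg N (\<lambda>x. k t * echar l t * \<psi> (t + x)))"
        by (rule boxavg_swap) (auto intro!: continuous_intros ap_continuous_on[OF k] ap_continuous_on[OF ap\<psi>] simp: split_beta)
      also have "\<dots> = boxavg L (\<lambda>t. k t * echar l t * boxavg N (\<lambda>x. \<psi> (t + x)))"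
        by (simp only: boxavg_cmult)
      finally have eq: "boxavg N (\<lambda>x. F L x * echar (- l) x) = boxavg L (\<lambda>t. k t * echar l t * boxavg N (\<lambda>x. \<psi> (t + x)))" .
      have cont: "continuous_on UNIV (\<lambda>t. boxavg N (\<lambda>x. \<psi> (t + x)))"
        unfolding boxavg_def cub_def
        by (intro continuous_intros integral_continuous_on_param) (auto intro!: continuous_intros ap_continuous_on[OF ap\<psi>] simp: split_beta)
      have "boxavg L (\<lambda>t. k t * echar l t) * coef g l = boxavg L (\<lambda>t. k t * echar l t * mean \<psi>)"
        unfolding mult.commute[of _ "mean \<psi>"] boxavg_cmult by (simp add: coef_def \<psi>_def)
      hence "norm (boxavg N (\<lambda>x. F L x * echar (- l) x) - boxavg L (\<lambda>t. k t * echar l t) * coef g l) =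
         norm (boxavg L (\<lambda>t. k t * echar l t * (boxavg N (\<lambda>x. \<psi> (t + x)) - mean \<psi>)))"
        unfolding eq right_diff_distrib
        by (subst boxavg_diff) (auto intro!: continuous_intros cont ap_continuous[OF k])
      also have "\<dots> \<le> Bk * (e / (2 * Bk))"
      proof (rule norm_boxavg_le)
        fix t show "norm (k t * echar l t * (boxavg N (\<lambda>x. \<psi> (t + x)) - mean \<psi>)) \<le> Bk * (e / (2 * Bk))"
          unfolding norm_mult norm_echar mult_1_right using Bk N0 N by (intro mult_mono) auto
      qed (use L in \<open>auto intro!: continuous_intros cont ap_continuous[OF k]\<close>)
      also have "\<dots> < e" using Bk e by simp
      finally show ?thesis by (simp add: dist_norm)
    qed
    thus "\<forall>\<^sub>F N in at_top. dist (boxavg N (\<lambda>x. F L x * echar (- l) x)) (boxavg L (\<lambda>t. k t * echar l t) * coef g l) < e"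
      unfolding eventually_at_top_linorder by blast
  qed
  have lim1: "((\<lambda>L. coef (F L) l) \<longlongrightarrow> coef \<Phi> l) at_top"
  proof (rule tendstoI)
    fix e :: real assume e: "e > 0"
    hence "e / 2 > 0" by simp
    from unif[OF this] eventually_gt_0 show "\<forall>\<^sub>F L in at_top. dist (coef (F L) l) (coef \<Phi> l) < e"
    proof eventually_elim
      case (elim L)
      have "norm (coef (\<lambda>x. F L x - \<Phi> x) l) \<le> e / 2"
        using elim by (intro norm_coef_le ap_diff apF ap\<Phi>) auto
      thus ?case using e elim by (simp add: coef_diff apF ap\<Phi> dist_norm)
    qed
  qed
  have "((\<lambda>L. boxavg L (\<lambda>t. k t * echar l t) * coef g l) \<longlongrightarrow> coef k (- l) * coef g l) at_top"
    unfolding coef_def[of k] minus_minus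
    by (intro tendsto_mult tendsto_const mean_tendsto ap_mult k ap_echar)
  hence lim2: "((\<lambda>L. coef (F L) l) \<longlongrightarrow> coef k (- l) * coef g l) at_top"
    by (rule Lim_transform_eventually) (use eventually_gt_0 in eventually_elim, simp add: coefF)
  show "coef \<Phi> l = coef g l * coef k (- l)"
    using tendsto_unique[OF _ lim1 lim2] by (simp add: mult.commute)
qed

text \<open>The tail of the series is dominated, uniformly in \<open>x\<close>, by the tail of the
  norms of the coefficients, so almost periodicity and coefficients pass to the limit.\<close>

lemma abs_summable_trig:
  fixes c :: "real^'m \<Rightarrow> complex"
  assumes bd: "\<And>\<Lambda>. finite \<Lambda> \<Longrightarrow> (\<Sum>l\<in>\<Lambda>. norm (c l)) \<le> D"
  obtains S where "ap S" "\<And>l. coef S l = c l"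
    "\<And>e. e > 0 \<Longrightarrow> \<exists>\<Lambda>. finite \<Lambda> \<and> (\<forall>x. norm (S x - (\<Sum>l\<in>\<Lambda>. c l * echar l x)) \<le> e)"
proof -
  have sm: "(\<lambda>l. norm (c l)) summable_on UNIV"
    by (rule nonneg_bounded_partial_sums_imp_summable_on[of _ _ D]) (auto simp: eventually_finite_subsets_at_top bd)
  define S where "S = (\<lambda>x. infsum (\<lambda>l. c l * echar l x) UNIV)"
  have asm: "(\<lambda>l. norm (c l * echar l x)) summable_on A" for x A
    by (simp add: norm_mult) (rule summable_on_subset_banach[OF sm], auto)
  have tail: "\<exists>\<Lambda>0. finite \<Lambda>0 \<and> (\<forall>\<Lambda>. finite \<Lambda> \<and> \<Lambda>0 \<subseteq> \<Lambda> \<longrightarrow> (\<forall>x. norm (S x - (\<Sum>l\<in>\<Lambda>. c l * echar l x)) \<le> e))" if e: "e > 0" for e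
  proof -
    have "((\<lambda>l. norm (c l)) has_sum infsum (\<lambda>l. norm (c l)) UNIV) UNIV" using sm by simp
    hence "\<forall>\<^sub>F \<Lambda> in finite_subsets_at_top UNIV. dist (\<Sum>l\<in>\<Lambda>. norm (c l)) (infsum (\<lambda>l. norm (c l)) UNIV) < e"
      unfolding has_sum_def using e by (rule tendstoD)
    then obtain \<Lambda>0 where L0: "finite \<Lambda>0" "\<And>\<Lambda>. finite \<Lambda> \<Longrightarrow> \<Lambda>0 \<subseteq> \<Lambda> \<Longrightarrow> dist (\<Sum>l\<in>\<Lambda>. norm (c l)) (infsum (\<lambda>l. norm (c l)) UNIV) < e"
      unfolding eventually_finite_subsets_at_top by auto
    have "norm (S x - (\<Sum>l\<in>\<Lambda>. c l * echar l x)) \<le> e" if L: "finite \<Lambda>" "\<Lambda>0 \<subseteq> \<Lambda>" for \<Lambda> x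
    proof -
      have "S x - (\<Sum>l\<in>\<Lambda>. c l * echar l x) = infsum (\<lambda>l. c l * echar l x) (UNIV - \<Lambda>)"
        unfolding S_def using L
        by (subst infsum_Diff) (auto intro: abs_summable_summable asm)
      also have "norm \<dots> \<le> infsum (\<lambda>l. norm (c l * echar l x)) (UNIV - \<Lambda>)"
        by (rule norm_infsum_bound) (rule asm)
      also have "\<dots> = infsum (\<lambda>l. norm (c l)) (UNIV - \<Lambda>)" by (simp add: norm_mult)
      also have "\<dots> = infsum (\<lambda>l. norm (c l)) UNIV - (\<Sum>l\<in>\<Lambda>. norm (c l))"
        using L by (subst infsum_Diff) (auto intro: sm)
      also have "\<dots> \<le> e" using L0(2)[OF L] by (simp add: dist_real_def abs_le_iff)
      finally show ?thesis .
    qed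
    thus ?thesis using L0(1) by blast
  qed
  have apP: "ap (\<lambda>x. \<Sum>l\<in>\<Lambda>. c l * echar l x)" for \<Lambda> by (intro ap_sum ap_cmult ap_echar)
  have apS: "ap S"
  proof (rule ap_uniform_limit)
    fix e :: real assume "e > 0"
    from tail[OF this] obtain \<Lambda> where "\<forall>x. norm (S x - (\<Sum>l\<in>\<Lambda>. c l * echar l x)) \<le> e" by blast
    with apP[of \<Lambda>] show "\<exists>h. ap h \<and> (\<forall>x. norm (S x - h x) \<le> e)" by (intro exI conjI)
  qed
  have "coef S l = c l" for l
  proof -
    have "norm (coef S l - c l) \<le> e" if e: "e > 0" for e
    proof -
      obtain \<Lambda>0 where L0: "finite \<Lambda>0 \<and> (\<forall>\<Lambda>. finite \<Lambda> \<and> \<Lambda>0 \<subseteq> \<Lambda> \<longrightarrow> (\<forall>x. norm (S x - (\<Sum>l\<in>\<Lambda>. c l * echar l x)) \<le> e))"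
        using tail[OF e] by (rule exE)
      \<comment> \<open>Adding \<open>l\<close> makes its coefficient show up in the partial
        sum.\<close>
      define \<Lambda> where "\<Lambda> = insert l \<Lambda>0"
      have fin: "finite \<Lambda>" using L0 by (simp add: \<Lambda>_def)
      have "coef (\<lambda>x. \<Sum>l\<in>\<Lambda>. c l * echar l x) l = (\<Sum>l'\<in>\<Lambda>. c l' * (if l' = l then 1 else 0))"
        by (subst coef_sum) (auto simp: coef_cmult coef_echar ap_cmult)
      also have "\<dots> = c l" using fin by (simp add: \<Lambda>_def sum.delta if_distrib cong: if_cong)
      finally have "coef S l - c l = coef (\<lambda>x. S x - (\<Sum>l\<in>\<Lambda>. c l * echar l x)) l"
        by (simp add: coef_diff apS apP)
      also have "norm \<dots> \<le> e"
      proof (rule norm_coef_le[OF ap_diff[OF apS apP]])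
        have "\<Lambda>0 \<subseteq> \<Lambda>" by (auto simp: \<Lambda>_def)
        thus "norm (S x - (\<Sum>l\<in>\<Lambda>. c l * echar l x)) \<le> e" for x using L0 fin by simp
      qed
      finally show ?thesis .
    qed
    hence "norm (coef S l - c l) \<le> 0 + e" if "e > 0" for e using that by simp
    hence "norm (coef S l - c l) \<le> 0" by (rule field_le_epsilon)
    thus ?thesis by simp
  qed
  moreover have "\<exists>\<Lambda>. finite \<Lambda> \<and> (\<forall>x. norm (S x - (\<Sum>l\<in>\<Lambda>. c l * echar l x)) \<le> e)" if e: "e > 0" for e
  proof -
    obtain \<Lambda>0 where "finite \<Lambda>0 \<and> (\<forall>\<Lambda>. finite \<Lambda> \<and> \<Lambda>0 \<subseteq> \<Lambda> \<longrightarrow> (\<forall>x. norm (S x - (\<Sum>l\<in>\<Lambda>. c l * echar l x)) \<le> e))"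
      using tail[OF e] by (rule exE)
    thus ?thesis by (intro exI[of _ \<Lambda>0]) simp
  qed
  ultimately show ?thesis by (intro that[OF apS])
qed

text \<open>\<open>\<rho> t\<close> is the sup distance between \<open>g\<close> and its translate
  by \<open>t\<close>, and the kernel vanishes where it is at least \<open>e\<close>. Almost
  periodicity is inherited because \<open>\<rho>\<close> changes by no more than the distance of two
  translates of \<open>g\<close>; the mean is positive since the kernel equals \<open>e\<close> at
  0.\<close>

lemma ap_kernel:
  fixes g :: "real^'m \<Rightarrow> complex"
  assumes g: "ap g" and e: "e > 0"
  obtains k where "ap k" "\<And>t. Re (k t) \<ge> 0" "Re (mean k) > 0"
    "\<And>x t. norm ((g (x + t) - g x) * k t) \<le> e * Re (k t)"
proof -
  obtain B where B: "B > 0" "\<And>x. norm (g x) \<le> B" using ap_bounded[OF g] by blast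
  define \<rho> where "\<rho> = (\<lambda>t. SUP x. norm (g (x + t) - g x))"
  have bdd: "bdd_above (range (\<lambda>x. norm (g (x + t) - g x)))" for t
  proof (rule bdd_aboveI[where M = "2 * B"])
    fix y assume "y \<in> range (\<lambda>x. norm (g (x + t) - g x))"
    then obtain x where "y = norm (g (x + t) - g x)" by blast
    also have "\<dots> \<le> norm (g (x + t)) + norm (g x)" by (rule norm_triangle_ineq4)
    also have "\<dots> \<le> 2 * B" using B(2)[of x] B(2)[of "x + t"] by linarith
    finally show "y \<le> 2 * B" .
  qed
  have up: "norm (g (x + t) - g x) \<le> \<rho> t" for x t
    unfolding \<rho>_def by (rule cSUP_upper[OF _ bdd]) auto
  have lip1: "\<rho> s \<le> \<rho> t + d" if d: "\<And>x. norm (g (x + s) - g (x + t)) \<le> d" for s t d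
  proof -
    have "(SUP x. norm (g (x + s) - g x)) \<le> \<rho> t + d"
    proof (rule cSUP_least)
      fix x
      have "norm (g (x + s) - g x) \<le> norm (g (x + s) - g (x + t)) + norm (g (x + t) - g x)" by norm
      thus "norm (g (x + s) - g x) \<le> \<rho> t + d" using d[of x] up[of x t] by linarith
    qed auto
    thus ?thesis by (simp add: \<rho>_def)
  qed
  have lip: "\<bar>\<rho> s - \<rho> t\<bar> \<le> d" if d: "\<And>x. norm (g (x + s) - g (x + t)) \<le> d" for s t d
    using lip1[of s t d, OF d] lip1[of t s d] d by (simp add: norm_minus_commute abs_le_iff)
  define k where "k = (\<lambda>t. complex_of_real (max 0 (e - \<rho> t)))"
  have kL: "norm (k s - k t) \<le> d" if d: "\<And>x. norm (g (x + s) - g (x + t)) \<le> d" for s t d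
  proof -
    have "norm (k s - k t) = \<bar>max 0 (e - \<rho> s) - max 0 (e - \<rho> t)\<bar>"
      unfolding k_def of_real_diff[symmetric] norm_of_real ..
    also have "\<dots> \<le> \<bar>\<rho> s - \<rho> t\<bar>" by linarith
    finally show ?thesis using lip[of s t d, OF d] by linarith
  qed
  have apk: "ap k"
  proof (rule conv_ap[OF g g zero_less_one])
    fix y z d assume *: "\<And>t. norm (g (y + t) - g (z + t)) \<le> d"
    show "norm (k y - k z) \<le> 1 * d"
      unfolding mult_1 by (rule kL) (use * in \<open>simp add: add.commute\<close>)
  qed
  show ?thesis
  proof (rule that[OF apk])
    show nn: "Re (k t) \<ge> 0" for t by (simp add: k_def)
    have "\<rho> 0 = 0" unfolding \<rho>_def by simp
    hence "Re (k 0) > 0" using e by (simp add: k_def)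
    thus "Re (mean k) > 0" by (intro mean_pos[OF apk nn])
    fix x t
    show "norm ((g (x + t) - g x) * k t) \<le> e * Re (k t)"
    proof (cases "\<rho> t \<le> e")
      case True
      hence "norm (g (x + t) - g x) \<le> e" using up[of x t] by linarith
      moreover have "k t = complex_of_real (e - \<rho> t)" using True by (simp add: k_def)
      moreover have "norm (complex_of_real (e - \<rho> t)) = e - \<rho> t" using True unfolding norm_of_real by simp
      ultimately show ?thesis using True by (simp only: norm_mult Re_complex_of_real) (rule mult_right_mono, simp_all)
    next
      case False
      thus ?thesis by (simp add: k_def)
    qed
  qed
qed

theorem ap_approximation:
  fixes g :: "real^'m \<Rightarrow> complex"
  assumes g: "ap g" and e: "e > 0"
  obtains \<Lambda> q where "finite \<Lambda>" "\<And>l. l \<in> \<Lambda> \<Longrightarrow> coef g l \<noteq> 0"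
    "\<And>x. norm (g x - (\<Sum>l\<in>\<Lambda>. q l * echar l x)) \<le> e"
proof -
  have e2: "e / 2 > 0" using e by simp
  obtain k where k: "ap k" "\<And>t. Re (k t) \<ge> 0" "Re (mean k) > 0"
    "\<And>x t. norm ((g (x + t) - g x) * k t) \<le> e / 2 * Re (k t)"
    using ap_kernel[OF g e2] by blast
  define \<mu> where "\<mu> = mean k"
  have \<mu>: "\<mu> \<noteq> 0" using k(3) by (auto simp: \<mu>_def)
  \<comment> \<open>Normalised to mean 1, so that \<open>\<Phi> x - g x\<close> is a weighted mean
    of the differences \<open>g (x + t) - g x\<close>.\<close>
  define k' where "k' = (\<lambda>t. inverse \<mu> * k t)"
  have k': "ap k'" unfolding k'_def by (intro ap_cmult k)
  define \<Phi> where "\<Phi> = (\<lambda>x. mean (\<lambda>t. g (x + t) * k' t))"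
  have ap\<Phi>: "ap \<Phi>" and coef\<Phi>: "coef \<Phi> l = coef g l * coef k' (- l)" for l
    unfolding \<Phi>_def by (rule coef_convolution[OF g k'])+
  have close: "norm (\<Phi> x - g x) \<le> e / 2" for x
  proof -
    have a: "ap (\<lambda>t. g (x + t) * k' t)" by (rule ap_mult[OF ap_shift[OF g] k'])
    have b: "ap (\<lambda>t. (g (x + t) - g x) * k t)" 
      by (rule ap_mult[OF ap_diff[OF ap_shift[OF g] ap_const] k(1)])
    have "mean k' = 1" using \<mu> k by (simp add: k'_def mean_cmult \<mu>_def)
    hence "\<Phi> x - g x = mean (\<lambda>t. g (x + t) * k' t) - mean (\<lambda>t. g x * k' t)"
      by (simp add: \<Phi>_def mean_cmult k')
    also have "\<dots> = mean (\<lambda>t. g (x + t) * k' t - g x * k' t)"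
      by (rule mean_diff[symmetric]) (intro a ap_cmult k')+
    also have "\<dots> = mean (\<lambda>t. inverse \<mu> * ((g (x + t) - g x) * k t))"
      by (intro arg_cong[of _ _ mean] ext) (simp add: k'_def left_diff_distrib right_diff_distrib mult.left_commute)
    also have "\<dots> = inverse \<mu> * mean (\<lambda>t. (g (x + t) - g x) * k t)" by (rule mean_cmult[OF b])
    finally have "norm (\<Phi> x - g x) = norm (mean (\<lambda>t. (g (x + t) - g x) * k t)) / norm \<mu>"
      by (simp only: norm_mult norm_inverse divide_inverse mult.commute)
    also have "norm (mean (\<lambda>t. (g (x + t) - g x) * k t)) \<le> Re (mean (\<lambda>t. complex_of_real (e / 2) * k t))"
      by (rule norm_mean_le_Re_mean[OF b ap_cmult[OF k(1)]]) (use k(4) in simp)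
    hence "norm (mean (\<lambda>t. (g (x + t) - g x) * k t)) / norm \<mu> \<le> (e / 2 * Re \<mu>) / norm \<mu>"
      unfolding mean_cmult[OF k(1)] \<mu>_def[symmetric] by (intro divide_right_mono) simp_all
    also have "\<dots> \<le> e / 2" using \<mu> e complex_Re_le_cmod[of \<mu>] by (simp add: pos_divide_le_eq)
    finally show ?thesis .
  qed
  define Mg Mk where "Mg = Re (mean (\<lambda>x. g x * cnj (g x)))" and "Mk = Re (mean (\<lambda>x. k' x * cnj (k' x)))"
  have bd: "(\<Sum>l\<in>\<Lambda>. norm (coef \<Phi> l)) \<le> Mg + Mk" if fin: "finite \<Lambda>" for \<Lambda>
  proof -
    have "(\<Sum>l\<in>\<Lambda>. norm (coef \<Phi> l)) \<le> (\<Sum>l\<in>\<Lambda>. (norm (coef g l))\<^sup>2 + (norm (coef k' (- l)))\<^sup>2)"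
    proof (rule sum_mono)
      fix l
      define x y where "x = norm (coef g l)" and "y = norm (coef k' (- l))"
      have "x \<ge> 0" "y \<ge> 0" by (auto simp: x_def y_def)
      hence "x * y \<ge> 0" by simp
      moreover have "2 * x * y \<le> x\<^sup>2 + y\<^sup>2" by (rule sum_squares_bound)
      ultimately have "x * y \<le> x\<^sup>2 + y\<^sup>2" by linarith
      thus "norm (coef \<Phi> l) \<le> (norm (coef g l))\<^sup>2 + (norm (coef k' (- l)))\<^sup>2"
        by (simp add: coef\<Phi> norm_mult x_def y_def)
    qed
    \<comment> \<open>Negation is injective, so the frequencies of \<open>k'\<close> remain distinct
      and Bessel's inequality applies to them.\<close>
    also have "\<dots> = (\<Sum>l\<in>\<Lambda>. (norm (coef g l))\<^sup>2) + (\<Sum>l\<in>uminus ` \<Lambda>. (norm (coef k' l))\<^sup>2)"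
      by (simp add: sum.distrib sum.reindex)
    also have "\<dots> \<le> Mg + Mk"
      unfolding Mg_def Mk_def using fin by (intro add_mono bessel g k') auto
    finally show ?thesis .
  qed
  obtain S where S: "ap S" "\<And>l. coef S l = coef \<Phi> l"
    "\<And>e. e > 0 \<Longrightarrow> \<exists>\<Lambda>. finite \<Lambda> \<and> (\<forall>x. norm (S x - (\<Sum>l\<in>\<Lambda>. coef \<Phi> l * echar l x)) \<le> e)"
    using abs_summable_trig[OF bd] by blast
  have "\<Phi> x - S x = 0" for x
    by (rule ap_uniqueness[of "\<lambda>x. \<Phi> x - S x"]) (auto simp: coef_diff ap\<Phi> S)
  hence S\<Phi>: "S x = \<Phi> x" for x by simp
  obtain \<Lambda> where L: "finite \<Lambda>" "\<And>x. norm (\<Phi> x - (\<Sum>l\<in>\<Lambda>. coef \<Phi> l * echar l x)) \<le> e / 2"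
    using S(3)[OF e2] unfolding S\<Phi> by blast
  show ?thesis
  \<comment> \<open>Where \<open>coef g\<close> vanishes so does \<open>coef \<Phi>\<close>;
    dropping these frequencies leaves the sum unchanged and confines it to the spectrum of
    \<open>g\<close>.\<close>
  proof (rule that[of "{l\<in>\<Lambda>. coef g l \<noteq> 0}" "coef \<Phi>"])
    fix x
    have "(\<Sum>l\<in>{l\<in>\<Lambda>. coef g l \<noteq> 0}. coef \<Phi> l * echar l x) = (\<Sum>l\<in>\<Lambda>. coef \<Phi> l * echar l x)"
      using L(1) by (intro sum.mono_neutral_left) (auto simp: coef\<Phi>)
    moreover have "norm (g x - (\<Sum>l\<in>\<Lambda>. coef \<Phi> l * echar l x)) \<le> norm (\<Phi> x - g x) + norm (\<Phi> x - (\<Sum>l\<in>\<Lambda>. coef \<Phi> l * echar l x))"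
      by norm
    ultimately show "norm (g x - (\<Sum>l\<in>{l\<in>\<Lambda>. coef g l \<noteq> 0}. coef \<Phi> l * echar l x)) \<le> e"
      using close[of x] L(2)[of x] by simp
  qed (use L in auto)
qed

section \<open>Maximum principles in the half-plane\<close>

lemma rectangle_max_modulus:
  assumes f: "f holomorphic_on cbox a b" and w: "w \<in> cbox a b"
    and bd: "\<And>z. z \<in> cbox a b \<Longrightarrow> Re z = Re a \<or> Re z = Re b \<or> Im z = Im a \<or> Im z = Im b \<Longrightarrow> norm (f z) \<le> B"
  shows "norm (f w) \<le> B"
proof (rule maximum_modulus_frontier[OF _ _ _ _ w])
  show "f holomorphic_on interior (cbox a b)"
    by (rule holomorphic_on_subset[OF f interior_subset])
  show "continuous_on (closure (cbox a b)) f"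
    using holomorphic_on_imp_continuous_on[OF f] by simp
  fix z assume "z \<in> frontier (cbox a b)"
  hence "z \<in> cbox a b" "z \<notin> box a b" by (auto simp: frontier_def interior_cbox)
  thus "norm (f z) \<le> B" by (intro bd) (auto simp: in_cbox_complex_iff in_box_complex_iff)
qed simp

text \<open>Removes an auxiliary damping factor by letting \<open>e\<close> tend to 0 from the
  right.\<close>

lemma le_of_exp_damping:
  assumes "\<And>e. e > 0 \<Longrightarrow> a * exp (- (e * k)) \<le> (D::real)"
  shows "a \<le> D"
proof (rule tendsto_upperbound)
  show "((\<lambda>e. a * exp (- (e * k))) \<longlongrightarrow> a) (at_right 0)"
  proof -
    have "((\<lambda>e. a * exp (- (e * k))) \<longlongrightarrow> a * exp (- (0 * k))) (at_right 0)"
      by (intro tendsto_intros)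
    thus ?thesis by simp
  qed
  show "\<forall>\<^sub>F e in at_right 0. a * exp (- (e * k)) \<le> D"
    using assms by (auto simp: eventually_at_right_less eventually_at_filter)
qed auto

text \<open>The divisor \<open>1 - \<i> * complex_of_real e * w\<close> has modulus at least 1 and
  grows linearly in the closed upper half-plane. It makes the quotient small on the far sides of a
  large rectangle; afterwards \<open>e\<close> tends to 0.\<close>

lemma halfplane_bounded:
  assumes f: "f holomorphic_on UNIV" and A: "\<And>w. Im w \<ge> 0 \<Longrightarrow> norm (f w) \<le> A"
    and M: "\<And>u. norm (f (complex_of_real u)) \<le> M" and w: "Im w \<ge> 0"
  shows "norm (f w) \<le> M"
proof -
  have M0: "M \<ge> 0" by (rule order_trans[OF norm_ge_zero M[of 0]])
  have A0: "A \<ge> 0" using order_trans[OF norm_ge_zero A[of 0]] by simp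
  have key: "norm (f w) \<le> (M + e) * norm (1 - \<i> * complex_of_real e * w)" if e: "e > 0" for e
  proof -
    \<comment> \<open>From \<open>A / e\<^sup>2\<close> on, the quotient is at most
      \<open>A / (e * R)\<close>, hence at most \<open>e\<close>, on the far sides.\<close>
    define R where "R = Max {\<bar>Re w\<bar>, Im w, A / e\<^sup>2, 1}"
    have R: "\<bar>Re w\<bar> \<le> R" "Im w \<le> R" "A / e\<^sup>2 \<le> R" "1 \<le> R" by (auto simp: R_def)
    have den: "norm (1 - \<i> * complex_of_real e * z) \<ge> max 1 (e * max \<bar>Re z\<bar> (Im z))" if z: "Im z \<ge> 0" for z
    proof -
      have re: "Re (1 - \<i> * complex_of_real e * z) = 1 + e * Im z" and im: "Im (1 - \<i> * complex_of_real e * z) = - (e * Re z)"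
        by simp_all
      have "\<bar>1 + e * Im z\<bar> \<le> norm (1 - \<i> * complex_of_real e * z)" "\<bar>- (e * Re z)\<bar> \<le> norm (1 - \<i> * complex_of_real e * z)"
        unfolding re[symmetric] im[symmetric] by (rule abs_Re_le_cmod abs_Im_le_cmod)+
      moreover have "e * Im z \<ge> 0" using z e by simp
      moreover have "\<bar>- (e * Re z)\<bar> = e * \<bar>Re z\<bar>" using e by (simp add: abs_mult)
      ultimately show ?thesis using e by (auto simp: max_def)
    qed
    have nz: "1 - \<i> * complex_of_real e * z \<noteq> 0" if "Im z \<ge> 0" for z
      using den[OF that] by (metis max.bounded_iff norm_zero not_one_le_zero)
    have "norm (f w / (1 - \<i> * complex_of_real e * w)) \<le> M + e"
    proof (rule rectangle_max_modulus[of "\<lambda>w. f w / (1 - \<i> * complex_of_real e * w)" "Complex (-R) 0" "Complex R R"])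
      show "(\<lambda>w. f w / (1 - \<i> * complex_of_real e * w)) holomorphic_on cbox (Complex (- R) 0) (Complex R R)"
        using nz by (intro holomorphic_intros holomorphic_on_subset[OF f]) (auto simp: in_cbox_complex_iff)
      show "w \<in> cbox (Complex (- R) 0) (Complex R R)" using R w by (auto simp: in_cbox_complex_iff)
      fix z assume z: "z \<in> cbox (Complex (- R) 0) (Complex R R)"
        and "Re z = Re (Complex (- R) 0) \<or> Re z = Re (Complex R R) \<or> Im z = Im (Complex (- R) 0) \<or> Im z = Im (Complex R R)"
      then consider "Im z = 0" | "\<bar>Re z\<bar> = R \<or> Im z = R" using R by auto
      thus "norm (f z / (1 - \<i> * complex_of_real e * z)) \<le> M + e"
      proof cases
        case 1
        hence "z = complex_of_real (Re z)" by (simp add: complex_eq_iff)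
        hence "norm (f z) \<le> M" using M by metis
        moreover have "1 \<le> norm (1 - \<i> * complex_of_real e * z)" using den[of z] 1 by simp
        ultimately have "norm (f z) / norm (1 - \<i> * complex_of_real e * z) \<le> M / 1"
          using M0 by (intro frac_le) auto
        thus ?thesis using e by (simp add: norm_divide)
      next
        case 2
        have z0: "Im z \<ge> 0" using z by (auto simp: in_cbox_complex_iff)
        have "R \<le> max \<bar>Re z\<bar> (Im z)" using 2 by auto
        hence "e * R \<le> e * max \<bar>Re z\<bar> (Im z)" using e by (intro mult_left_mono) auto
        hence "e * R \<le> norm (1 - \<i> * complex_of_real e * z)" using den[OF z0] by simp
        hence "norm (f z) / norm (1 - \<i> * complex_of_real e * z) \<le> A / (e * R)"
          using A[OF z0] A0 e R by (intro frac_le) auto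
        also have "A / (e * R) \<le> e" using R e by (simp add: field_simps power2_eq_square)
        finally show ?thesis using M0 by (simp add: norm_divide)
      qed
    qed
    moreover have "norm (1 - \<i> * complex_of_real e * w) > 0" using nz[OF w] by simp
    ultimately show ?thesis by (simp only: norm_divide pos_divide_le_eq)
  qed
  show ?thesis
  proof (rule tendsto_lowerbound)
    have "((\<lambda>e. (M + e) * norm (1 - \<i> * complex_of_real e * w)) \<longlongrightarrow> (M + 0) * norm (1 - \<i> * complex_of_real 0 * w)) (at_right 0)"
      by (intro tendsto_intros)
    thus "((\<lambda>e. (M + e) * norm (1 - \<i> * complex_of_real e * w)) \<longlongrightarrow> M) (at_right 0)" by simp
    show "\<forall>\<^sub>F e in at_right 0. norm (f w) \<le> (M + e) * norm (1 - \<i> * complex_of_real e * w)"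
      using key by (auto simp: eventually_at_right_less eventually_at_filter)
  qed auto
qed

text \<open>Two damping factors are used. \<open>exp (\<i> * e * z\<^sup>2)\<close> has modulus
  \<open>exp (- (2 * e * Re z * Im z))\<close> and beats \<open>exp (c * Im z)\<close> to the right
  of \<open>U\<close>; in the remaining vertical strip
  \<open>exp (d * (z\<^sup>2 - U\<^sup>2))\<close> decays like a Gaussian in \<open>Im z\<close>.
  Both have modulus at most 1 there and disappear as \<open>d\<close> and \<open>e\<close> tend to
  0.\<close>

lemma quadrant_bounded:
  assumes f: "f holomorphic_on UNIV" and c: "c > 0" and MD: "M \<le> D"
    and M: "\<And>w. Re w \<ge> 0 \<Longrightarrow> Im w \<ge> 0 \<Longrightarrow> norm (f w) \<le> M * exp (c * Im w)"
    and D: "\<And>v. v \<ge> 0 \<Longrightarrow> norm (f (\<i> * complex_of_real v)) \<le> D"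
    and w: "Re w \<ge> 0" "Im w \<ge> 0"
  shows "norm (f w) \<le> D"
proof (rule le_of_exp_damping[of _ "2 * Re w * Im w"])
  fix e :: real assume e: "e > 0"
  have M0: "M \<ge> 0" using order_trans[OF norm_ge_zero M[of 0]] by simp
  define g where "g = (\<lambda>z. f z * exp (\<i> * complex_of_real e * z\<^sup>2))"
  have ng: "norm (g z) = norm (f z) * exp (- (2 * e * Re z * Im z))" for z
    by (simp add: g_def norm_mult power2_eq_square)
  have g: "g holomorphic_on S" for S
    unfolding g_def by (intro holomorphic_intros holomorphic_on_subset[OF f]) auto
  \<comment> \<open>The abscissa at which \<open>2 * e * Re z\<close> reaches
    \<open>c\<close>.\<close>
  define U where "U = c / (2 * e)"
  have U: "U > 0" using c e by (simp add: U_def)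
  have far: "norm (g z) \<le> M" if z: "Re z \<ge> U" "Im z \<ge> 0" for z
  proof -
    have "norm (g z) \<le> M * exp (c * Im z) * exp (- (2 * e * Re z * Im z))"
      unfolding ng using z U by (intro mult_right_mono M) auto
    also have "\<dots> = M * exp ((c - 2 * e * Re z) * Im z)"
      by (simp add: mult.assoc exp_add[symmetric] algebra_simps)
    also have "(c - 2 * e * Re z) * Im z \<le> 0"
      using z e by (intro mult_nonpos_nonneg) (auto simp: U_def field_simps)
    hence "M * exp ((c - 2 * e * Re z) * Im z) \<le> M * 1" using M0 by (intro mult_left_mono) auto
    finally show ?thesis by simp
  qed
  have le: "norm (g z) \<le> norm (f z)" if "Re z \<ge> 0" "Im z \<ge> 0" for z
    unfolding ng using that e by (intro mult_right_le_one_le) auto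
  have "norm (g w) \<le> D"
  proof (cases "Re w \<ge> U")
    case True
    thus ?thesis using far[of w] w MD by linarith
  next
    case False
    show ?thesis
    proof (rule le_of_exp_damping[of _ "U\<^sup>2 - (Re w)\<^sup>2 + (Im w)\<^sup>2"])
      fix d :: real assume d: "d > 0"
      define h where "h = (\<lambda>z. g z * exp (complex_of_real d * (z\<^sup>2 - complex_of_real (U\<^sup>2))))"
      have nh: "norm (h z) = norm (g z) * exp (- (d * (U\<^sup>2 - (Re z)\<^sup>2 + (Im z)\<^sup>2)))" for z
        by (simp add: h_def norm_mult power2_eq_square algebra_simps)
      \<comment> \<open>From height \<open>c / d\<close> on the Gaussian wins over
        \<open>exp (c * Im z)\<close>.\<close>
      define R where "R = max (Im w) (c / d)"
      have R: "Im w \<le> R" "c / d \<le> R" by (auto simp: R_def)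
      have "norm (h w) \<le> D"
      proof (rule rectangle_max_modulus[of h "Complex 0 0" "Complex U R"])
        show "h holomorphic_on cbox (Complex 0 0) (Complex U R)"
          unfolding h_def by (intro holomorphic_intros g)
        show "w \<in> cbox (Complex 0 0) (Complex U R)" using w False R by (auto simp: in_cbox_complex_iff)
        fix z assume z: "z \<in> cbox (Complex 0 0) (Complex U R)"
          and bd: "Re z = Re (Complex 0 0) \<or> Re z = Re (Complex U R) \<or> Im z = Im (Complex 0 0) \<or> Im z = Im (Complex U R)"
        have zr: "0 \<le> Re z" "Re z \<le> U" "0 \<le> Im z" "Im z \<le> R" using z by (auto simp: in_cbox_complex_iff)
        have "(Re z)\<^sup>2 \<le> U\<^sup>2" using zr by (intro power_mono) auto
        hence ex: "exp (- (d * (U\<^sup>2 - (Re z)\<^sup>2 + (Im z)\<^sup>2))) \<le> exp (- (d * (Im z)\<^sup>2))"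
          using d by simp
        have "exp (- (d * (Im z)\<^sup>2)) \<le> 1" using d by simp
        hence hg: "norm (h z) \<le> norm (g z)"
          unfolding nh using ex by (intro mult_right_le_one_le) auto
        from bd consider "Re z = 0" | "Re z = U" | "Im z = 0" | "Im z = R" by auto
        thus "norm (h z) \<le> D"
        proof cases
          case 1
          hence "z = \<i> * complex_of_real (Im z)" by (simp add: complex_eq_iff)
          hence "norm (f z) \<le> D" using D zr(3) by metis
          thus ?thesis using hg le zr by force
        next
          case 2
          thus ?thesis using hg far[of z] zr MD by auto
        next
          case 3
          hence "norm (f z) \<le> M" using M[of z] zr by simp
          thus ?thesis using hg le[of z] zr MD by linarith
        next
          case 4
          have "norm (h z) \<le> norm (f z) * exp (- (d * (Im z)\<^sup>2))"
            unfolding nh using le zr ex by (intro mult_mono) auto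
          also have "\<dots> \<le> M * exp (c * Im z) * exp (- (d * (Im z)\<^sup>2))"
            using zr by (intro mult_right_mono M) auto
          also have "\<dots> = M * exp ((c - d * Im z) * Im z)"
            by (simp add: mult.assoc exp_add[symmetric] algebra_simps power2_eq_square)
          also have "(c - d * Im z) * Im z \<le> 0"
            using zr d R 4 by (intro mult_nonpos_nonneg) (auto simp: field_simps)
          hence "M * exp ((c - d * Im z) * Im z) \<le> M * 1" using M0 by (intro mult_left_mono) auto
          finally show ?thesis using MD by simp
        qed
      qed
      thus "norm (g w) * exp (- (d * (U\<^sup>2 - (Re w)\<^sup>2 + (Im w)\<^sup>2))) \<le> D" unfolding nh .
    qed
  qed
  thus "norm (f w) * exp (- (e * (2 * Re w * Im w))) \<le> D"
    unfolding ng by (simp add: mult_ac)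
qed

text \<open>Multiplication by \<open>exp (\<i> * h * w)\<close> makes the function bounded on the
  imaginary ray, so it is at most \<open>max M A\<close> in each quadrant, and the half-plane
  principle improves this to \<open>M\<close>. That \<open>A\<close> disappears is essential: in the
  application it depends on the base point of the ray.\<close>

lemma phragmen_lindelof_halfplane:
  assumes f: "f holomorphic_on UNIV" and c: "c \<ge> 0"
    and M: "\<And>w. Im w \<ge> 0 \<Longrightarrow> norm (f w) \<le> M * exp (c * Im w)"
    and A: "\<And>v. v \<ge> 0 \<Longrightarrow> norm (f (\<i> * complex_of_real v)) \<le> A * exp (h * v)"
    and w: "Im w \<ge> 0"
  shows "norm (f w) \<le> M * exp (h * Im w)"
proof -
  define g where "g = (\<lambda>z. f z * exp (\<i> * complex_of_real h * z))"
  have ng: "norm (g z) = norm (f z) * exp (- (h * Im z))" for z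
    by (simp add: g_def norm_mult)
  have g: "g holomorphic_on UNIV" unfolding g_def by (intro holomorphic_intros f)
  define c' where "c' = c + \<bar>h\<bar> + 1"
  have c': "c' > 0" using c by (simp add: c'_def)
  have M0: "M \<ge> 0" using order_trans[OF norm_ge_zero M[of 0]] by simp
  have gM: "norm (g z) \<le> M * exp (c' * Im z)" if z: "Im z \<ge> 0" for z
  proof -
    have "norm (g z) \<le> M * exp (c * Im z) * exp (- (h * Im z))"
      unfolding ng using z by (intro mult_right_mono M) auto
    also have "\<dots> = M * exp ((c - h) * Im z)" by (simp add: mult.assoc exp_add[symmetric] algebra_simps)
    also have "\<dots> \<le> M * exp (c' * Im z)"
      using z M0 by (intro mult_left_mono) (auto simp: c'_def intro!: mult_right_mono)
    finally show ?thesis .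
  qed
  have gA: "norm (g (\<i> * complex_of_real v)) \<le> max M A" if v: "v \<ge> 0" for v
  proof -
    have "norm (g (\<i> * complex_of_real v)) \<le> A * exp (h * v) * exp (- (h * v))"
      unfolding ng using A[OF v] by (intro mult_mono) (auto intro: order_trans[OF norm_ge_zero])
    also have "\<dots> = A" by (simp add: mult.assoc exp_add[symmetric])
    finally show ?thesis by simp
  qed
  have Q1: "norm (g z) \<le> max M A" if "Re z \<ge> 0" "Im z \<ge> 0" for z
    by (rule quadrant_bounded[OF g c' _ gM gA that]) auto
  \<comment> \<open>Reflecting \<open>z\<close> to \<open>- cnj z\<close> carries the left quadrant
    to the right one; the outer conjugation restores holomorphy.\<close>
  define g2 where "g2 = cnj \<circ> (\<lambda>z. g (- z)) \<circ> cnj"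
  have Q2: "norm (g z) \<le> max M A" if z: "Re z \<le> 0" "Im z \<ge> 0" for z
  proof -
    have "(\<lambda>z. g (- z)) holomorphic_on UNIV"
      using holomorphic_on_compose[of uminus UNIV g] holomorphic_on_subset[OF g]
      by (simp add: o_def holomorphic_intros)
    hence g2: "g2 holomorphic_on UNIV"
      unfolding g2_def using holomorphic_on_compose_cnj_cnj[of "\<lambda>z. g (- z)" UNIV]
      by (auto simp: o_assoc intro: holomorphic_on_subset[OF _ subset_UNIV])
    have n2: "norm (g2 z) = norm (g (- cnj z))" for z by (simp add: g2_def)
    have "norm (g2 (- cnj z)) \<le> max M A"
    proof (rule quadrant_bounded[OF g2 c', of M])
      fix w assume "0 \<le> Re w" "0 \<le> Im w"
      thus "norm (g2 w) \<le> M * exp (c' * Im w)" unfolding n2 using gM[of "- cnj w"] by simp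
    next
      fix v :: real assume "v \<ge> 0"
      thus "norm (g2 (\<i> * complex_of_real v)) \<le> max M A" unfolding n2 using gA[of v] by simp
    qed (use z in auto)
    thus ?thesis unfolding n2 by simp
  qed
  have "norm (g w) \<le> M"
  proof (rule halfplane_bounded[OF g _ _ w])
    fix z assume "Im z \<ge> 0"
    thus "norm (g z) \<le> max M A" using Q1[of z] Q2[of z] by linarith
  next
    fix u show "norm (g (complex_of_real u)) \<le> M" using gM[of "complex_of_real u"] by simp
  qed
  hence "norm (f w) * exp (- (h * Im w)) * exp (h * Im w) \<le> M * exp (h * Im w)"
    unfolding ng by (intro mult_right_mono) auto
  thus ?thesis by (simp add: mult.assoc exp_add[symmetric])
qed

section \<open>Trigonometric polynomials on tube domains\<close>

definition tpoly :: "(real^'m) set \<Rightarrow> (real^'m \<Rightarrow> complex) \<Rightarrow> complex^'m \<Rightarrow> complex" where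
  "tpoly \<Lambda> q z = (\<Sum>l\<in>\<Lambda>. q l * exp (\<i> * cinner z l))"

definition tpoly_deriv :: "(real^'m) set \<Rightarrow> (real^'m \<Rightarrow> complex) \<Rightarrow> complex^'m \<Rightarrow> complex^'m \<Rightarrow> complex" where
  "tpoly_deriv \<Lambda> q z v = (\<Sum>l\<in>\<Lambda>. q l * (exp (\<i> * cinner z l) * (\<i> * cinner v l)))"

lemma cinner_add: "cinner (z + w) l = cinner z l + cinner w l"
  by (simp add: cinner_def sum.distrib distrib_right)

lemma cinner_smult: "cinner (c *s z) l = c * cinner z l"
  by (simp add: cinner_def sum_distrib_left mult.assoc)

lemma cinner_cvec: "cinner (cvec x) l = complex_of_real (x \<bullet> l)"
  by (simp add: cinner_def cvec_def inner_vec_def)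

lemma tpoly_cvec: "tpoly \<Lambda> q (cvec x) = (\<Sum>l\<in>\<Lambda>. q l * echar l x)"
  by (simp add: tpoly_def cinner_cvec echar_def cis_conv_exp)

lemma cvec_add: "cvec (x + y) = cvec x + cvec y"
  and cvec_scaleR: "cvec (r *\<^sub>R x) = complex_of_real r *s cvec x"
  by (simp_all add: cvec_def vec_eq_iff)

lemma norm_cvec [simp]: "norm (cvec x) = norm x"
  by (simp add: norm_vec_def cvec_def)

lemma norm_smult_complex: "norm (c *s (z :: complex^'m)) = norm c * norm z"
  unfolding norm_vec_def by (simp add: norm_mult L2_set_right_distrib)

lemma imvec_add: "imvec (z + w) = imvec z + imvec w"
  and imvec_cvec [simp]: "imvec (cvec x) = 0"
  by (simp_all add: imvec_def cvec_def vec_eq_iff)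

lemma imvec_decompose: "imvec (cvec x + \<i> *s cvec y) = y"
  by (simp add: imvec_def cvec_def vec_eq_iff)

lemma norm_imvec_le: "norm (imvec z) \<le> norm z"
  unfolding norm_vec_def imvec_def by (intro L2_set_mono) (auto simp: abs_Im_le_cmod)

definition revec :: "complex^'m \<Rightarrow> real^'m" where
  "revec z = (\<chi> i. Re (z $ i))"

lemma complex_vec_decompose: "z = cvec (revec z) + \<i> *s cvec (imvec z)"
  by (simp add: cvec_def revec_def imvec_def vec_eq_iff complex_eq_iff)

lemma tpoly_line:
  "tpoly \<Lambda> q (z + w *s v) = (\<Sum>l\<in>\<Lambda>. q l * exp (\<i> * cinner z l) * exp (\<i> * (w * cinner v l)))"
  by (simp add: tpoly_def cinner_add cinner_smult distrib_left exp_add mult.assoc)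

lemma tpoly_diff: "tpoly \<Lambda> q z - tpoly \<Lambda> r z = tpoly \<Lambda> (\<lambda>l. q l - r l) z"
  by (simp add: tpoly_def sum_subtractf left_diff_distrib)

lemma tpoly_extend:
  "finite \<Lambda>' \<Longrightarrow> \<Lambda> \<subseteq> \<Lambda>' \<Longrightarrow> tpoly \<Lambda> q = tpoly \<Lambda>' (\<lambda>l. if l \<in> \<Lambda> then q l else 0)"
  unfolding tpoly_def fun_eq_iff by (intro allI sum.mono_neutral_cong_left) auto

lemma holomorphic_tpoly_line: "(\<lambda>w. tpoly \<Lambda> q (z + w *s v)) holomorphic_on S"
  unfolding tpoly_line by (intro holomorphic_intros)

text \<open>On the complex line through \<open>x\<close> in direction \<open>y\<close>, the factor
  \<open>exp (\<i> * w * H)\<close> makes every term bounded in the upper half-plane. The sum of the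
  norms of the coefficients is an a priori bound, which the maximum principle replaces by the real
  supremum \<open>M\<close>.\<close>

lemma tpoly_halfplane:
  assumes H: "\<And>l. l \<in> \<Lambda> \<Longrightarrow> - (y \<bullet> l) \<le> H"
    and M: "\<And>x. norm (tpoly \<Lambda> q (cvec x)) \<le> M"
  shows "norm (tpoly \<Lambda> q (cvec x + \<i> *s cvec y)) \<le> M * exp H"
proof -
  define f where "f = (\<lambda>w. tpoly \<Lambda> q (cvec x + w *s cvec y) * exp (\<i> * w * complex_of_real H))"
  have "norm (f \<i>) \<le> M"
  proof (rule halfplane_bounded[of f])
    show "f holomorphic_on UNIV"
      unfolding f_def by (intro holomorphic_intros holomorphic_tpoly_line)
    fix w :: complex assume w: "Im w \<ge> 0"
    have "norm (f w) = norm (\<Sum>l\<in>\<Lambda>. q l * exp (\<i> * complex_of_real (x \<bullet> l)) * exp (\<i> * (w * complex_of_real (y \<bullet> l + H))))"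
      unfolding f_def tpoly_line sum_distrib_right
      by (intro arg_cong[of _ _ norm] sum.cong refl) (simp add: cinner_cvec exp_add[symmetric] algebra_simps)
    also have "\<dots> \<le> (\<Sum>l\<in>\<Lambda>. norm (q l))"
    proof (rule sum_norm_le)
      fix l assume "l \<in> \<Lambda>"
      hence "- (Im w * (y \<bullet> l + H)) \<le> 0" using H w by (simp add: add.commute) (metis H add.commute diff_ge_0_iff_ge diff_minus_eq_add mult_nonneg_nonneg)
      hence "exp (- (Im w * (y \<bullet> l + H))) \<le> 1" by simp
      thus "norm (q l * exp (\<i> * complex_of_real (x \<bullet> l)) * exp (\<i> * (w * complex_of_real (y \<bullet> l + H)))) \<le> norm (q l)"
        by (simp add: norm_mult mult_left_le del: of_real_add)
    qed
    finally show "norm (f w) \<le> (\<Sum>l\<in>\<Lambda>. norm (q l))" .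
  next
    fix u :: real
    have "cvec x + complex_of_real u *s cvec y = cvec (x + u *\<^sub>R y)" by (simp add: cvec_add cvec_scaleR)
    thus "norm (f (complex_of_real u)) \<le> M" using M[of "x + u *\<^sub>R y"] by (simp add: f_def norm_mult)
  qed auto
  hence "norm (tpoly \<Lambda> q (cvec x + \<i> *s cvec y)) * exp (- H) * exp H \<le> M * exp H"
    by (intro mult_right_mono) (auto simp: f_def norm_mult)
  thus ?thesis by (simp add: mult.assoc exp_add[symmetric])
qed

text \<open>By Cauchy-Schwarz \<open>C * norm (imvec z)\<close> is an admissible \<open>H\<close> in
  the half-plane bound, whatever the direction of \<open>imvec z\<close>.\<close>

lemma tpoly_tube_bound:
  assumes C: "\<And>l. l \<in> \<Lambda> \<Longrightarrow> norm l \<le> C"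
    and M: "\<And>x. norm (tpoly \<Lambda> q (cvec x)) \<le> M"
  shows "norm (tpoly \<Lambda> q z) \<le> M * exp (C * norm (imvec z))"
proof -
  have "norm (tpoly \<Lambda> q (cvec (revec z) + \<i> *s cvec (imvec z))) \<le> M * exp (C * norm (imvec z))"
  proof (rule tpoly_halfplane[OF _ M])
    fix l assume "l \<in> \<Lambda>"
    have "- (imvec z \<bullet> l) \<le> norm (imvec z) * norm l"
      using Cauchy_Schwarz_ineq2[of "imvec z" l] by linarith
    also have "\<dots> \<le> norm (imvec z) * C" using C[OF \<open>l \<in> \<Lambda>\<close>] by (intro mult_left_mono) auto
    finally show "- (imvec z \<bullet> l) \<le> C * norm (imvec z)" by (simp add: mult.commute)
  qed
  thus ?thesis by (simp flip: complex_vec_decompose)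
qed

lemma bounded_linear_cinner: "bounded_linear (\<lambda>z :: complex^'m. cinner z l)"
  unfolding cinner_def
  by (intro bounded_linear_sum bounded_linear_mult_left[THEN bounded_linear_compose] bounded_linear_vec_nth)

lemma tpoly_has_derivative:
  fixes q :: "real^'m \<Rightarrow> complex"
  shows "(tpoly \<Lambda> q has_derivative tpoly_deriv \<Lambda> q z) (at z within S)"
proof -
  have d: "((\<lambda>z. exp (\<i> * cinner z l)) has_derivative (\<lambda>v. exp (\<i> * cinner z l) * (\<i> * cinner v l))) (at z within S)" for l :: "real^'m"
  proof -
    have "((\<lambda>z. \<i> * cinner z l) has_derivative (\<lambda>v. \<i> * cinner v l)) (at z within S)"
      by (intro bounded_linear_imp_has_derivative bounded_linear_compose[OF bounded_linear_mult_right bounded_linear_cinner])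
    moreover have "(exp has_derivative (*) (exp (\<i> * cinner z l))) (at (\<i> * cinner z l))"
      using DERIV_exp unfolding has_field_derivative_def .
    ultimately show ?thesis by (rule has_derivative_compose)
  qed
  show ?thesis
    unfolding tpoly_def[abs_def] tpoly_deriv_def[abs_def]
    by (intro has_derivative_sum has_derivative_mult_right d)
qed

lemma tpoly_deriv_smult: "tpoly_deriv \<Lambda> q z (c *s v) = c * tpoly_deriv \<Lambda> q z v"
  by (simp add: tpoly_deriv_def cinner_smult sum_distrib_left mult_ac)

text \<open>Cauchy's estimate on a unit disc in the complex direction \<open>v\<close>.\<close>

lemma tpoly_bernstein:
  assumes C: "\<And>l. l \<in> \<Lambda> \<Longrightarrow> norm l \<le> C" and C0: "C \<ge> 0"
    and M: "\<And>x. norm (tpoly \<Lambda> q (cvec x)) \<le> M"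
  shows "norm (tpoly_deriv \<Lambda> q z v) \<le> M * exp (C * (norm (imvec z) + 1)) * norm v"
proof (cases "v = 0")
  case True
  thus ?thesis by (simp add: tpoly_deriv_def cinner_def)
next
  case False
  \<comment> \<open>With a unit vector, the unit disc in \<open>w\<close> moves the imaginary part
    by at most 1, which is the \<open>+ 1\<close> in the exponent.\<close>
  define u where "u = complex_of_real (1 / norm v) *s v"
  have u: "norm u = 1" using False by (simp add: u_def norm_smult_complex norm_divide)
  have v: "v = complex_of_real (norm v) *s u" using False by (simp add: u_def vec_eq_iff)
  have M0: "M \<ge> 0" by (rule order_trans[OF norm_ge_zero M[of 0]])
  define f where "f = (\<lambda>w. tpoly \<Lambda> q (z + w *s u))"
  have "(f has_field_derivative tpoly_deriv \<Lambda> q z u) (at 0)"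
    unfolding f_def tpoly_line tpoly_deriv_def
    by (auto intro!: derivative_eq_intros simp: mult_ac)
  hence "deriv f 0 = tpoly_deriv \<Lambda> q z u" by (rule DERIV_imp_deriv)
  moreover have "norm ((deriv ^^ 1) f 0) \<le> fact 1 * (M * exp (C * (norm (imvec z) + 1))) / 1 ^ 1"
  proof (rule Cauchy_inequality)
    show "f holomorphic_on ball 0 1" "continuous_on (cball 0 1) f"
      unfolding f_def by (intro holomorphic_tpoly_line holomorphic_on_imp_continuous_on)+
    fix w :: complex assume w: "norm (0 - w) = 1"
    have "norm (imvec (z + w *s u)) \<le> norm (imvec z) + norm (imvec (w *s u))"
      unfolding imvec_add by (rule norm_triangle_ineq)
    also have "norm (imvec (w *s u)) \<le> norm (w *s u)" by (rule norm_imvec_le)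
    also have "norm (w *s u) = 1" using w u by (simp add: norm_smult_complex)
    finally have *: "norm (imvec (z + w *s u)) \<le> norm (imvec z) + 1" by simp
    have "norm (f w) \<le> M * exp (C * norm (imvec (z + w *s u)))"
      unfolding f_def by (rule tpoly_tube_bound[OF C M])
    also have "\<dots> \<le> M * exp (C * (norm (imvec z) + 1))"
      using * C0 M0 by (intro mult_left_mono) (auto intro: mult_left_mono)
    finally show "norm (f w) \<le> M * exp (C * (norm (imvec z) + 1))" .
  qed auto
  ultimately have "norm (tpoly_deriv \<Lambda> q z u) \<le> M * exp (C * (norm (imvec z) + 1))" by simp
  hence "norm v * norm (tpoly_deriv \<Lambda> q z u) \<le> norm v * (M * exp (C * (norm (imvec z) + 1)))"
    by (intro mult_left_mono) auto
  moreover have "tpoly_deriv \<Lambda> q z v = complex_of_real (norm v) * tpoly_deriv \<Lambda> q z u"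
    by (subst v) (rule tpoly_deriv_smult)
  ultimately show ?thesis by (simp add: norm_mult mult.commute)
qed

text \<open>Mean value inequality on the real subspace, where \<open>imvec\<close> vanishes and
  Bernstein's constant is \<open>exp C\<close>.\<close>

lemma tpoly_lipschitz:
  fixes q :: "real^'m \<Rightarrow> complex"
  assumes C: "\<And>l. l \<in> \<Lambda> \<Longrightarrow> norm l \<le> C" and C0: "C \<ge> 0"
    and M: "\<And>x. norm (tpoly \<Lambda> q (cvec x)) \<le> M"
  shows "norm (tpoly \<Lambda> q (cvec x) - tpoly \<Lambda> q (cvec y)) \<le> M * exp C * norm (x - y)"
proof -
  define S where "S = {z :: complex^'m. imvec z = 0}"
  have "convex S"
    unfolding S_def convex_def by (auto simp: imvec_def vec_eq_iff)
  have M0: "M \<ge> 0" by (rule order_trans[OF norm_ge_zero M[of 0]])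
  have "norm (tpoly \<Lambda> q (cvec x) - tpoly \<Lambda> q (cvec y)) \<le> M * exp C * norm (cvec x - cvec y)"
  proof (rule differentiable_bound[OF \<open>convex S\<close>])
    show "(tpoly \<Lambda> q has_derivative tpoly_deriv \<Lambda> q z) (at z within S)" for z by (rule tpoly_has_derivative)
    fix z assume "z \<in> S"
    thus "onorm (tpoly_deriv \<Lambda> q z) \<le> M * exp C"
      using tpoly_bernstein[OF C C0 M, of z] M0 by (intro onorm_bound) (auto simp: S_def)
  qed (auto simp: S_def)
  also have "cvec x - cvec y = cvec (x - y)" by (simp add: cvec_def vec_eq_iff)
  finally show ?thesis by simp
qed

section \<open>Averaging over a small cube, and undoing it\<close>

definition boxmean :: "real \<Rightarrow> (real^'m \<Rightarrow> complex) \<Rightarrow> real^'m \<Rightarrow> complex" where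
  "boxmean d f x = complex_of_real (1 / d ^ CARD('m)) * integral (cbox 0 (d *\<^sub>R One)) (\<lambda>u. f (x + u))"

lemma boxmean_le:
  fixes f :: "real^'m \<Rightarrow> complex"
  assumes "continuous_on UNIV f" "d > 0" "\<And>u. u \<in> cbox 0 (d *\<^sub>R One) \<Longrightarrow> norm (f (x + u)) \<le> e"
  shows "norm (boxmean d f x) \<le> e"
proof -
  have "norm (integral (cbox 0 (d *\<^sub>R One)) (\<lambda>u. f (x + u))) \<le> e * d ^ CARD('m)"
    using assms by (intro integral_cell_bound continuous_intros continuous_on_compose2[OF assms(1)]) auto
  thus ?thesis using assms(2) by (simp add: boxmean_def norm_mult norm_divide norm_power pos_divide_le_eq)
qed

lemma boxmean_diff:
  fixes f g :: "real^'m \<Rightarrow> complex"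
  assumes "\<And>a b. f integrable_on cbox a b" "\<And>a b. g integrable_on cbox a b"
  shows "boxmean d (\<lambda>x. f x - g x) x = boxmean d f x - boxmean d g x"
proof -
  have "(\<lambda>u. h (x + u)) integrable_on cbox 0 (d *\<^sub>R One)" if "\<And>a b. h integrable_on cbox a b" for h :: "real^'m \<Rightarrow> complex"
    using integrable_shift_cbox[OF that[of x "x + d *\<^sub>R One"], of x] by (simp add: add.commute)
  thus ?thesis unfolding boxmean_def using assms
    by (simp only: Henstock_Kurzweil_Integration.integral_diff right_diff_distrib)
qed

lemma integrable_continuous_UNIV: "continuous_on UNIV f \<Longrightarrow> f integrable_on cbox a b"
  for f :: "real^'m \<Rightarrow> complex"
  by (rule integrable_continuous[OF continuous_on_subset]) auto

lemma boxmean_const: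
  fixes d :: real
  assumes d: "d > 0"
  shows "boxmean d (\<lambda>_. c) (x :: real^'m) = c"
proof -
  have "measure lborel (cbox 0 (d *\<^sub>R One) :: (real^'m) set) = d ^ CARD('m)"
    using d by (subst content_cbox_cart) (auto simp: interval_ne_empty_cart)
  thus ?thesis using d by (simp add: boxmean_def scaleR_conv_of_real)
qed

text \<open>Characters are eigenfunctions of the cube average; the eigenvalue at \<open>l\<close> is
  the factor that relates Fourier coefficients before and after averaging.\<close>

lemma boxmean_echar: "boxmean d (echar l) x = boxmean d (echar l) 0 * echar l x"
  by (simp add: boxmean_def echar_add mult_ac)

lemma boxmean_trig:
  fixes q :: "real^'m \<Rightarrow> complex"
  shows "boxmean d (\<lambda>x. \<Sum>l\<in>\<Lambda>. q l * echar l x) x = (\<Sum>l\<in>\<Lambda>. q l * boxmean d (echar l) 0 * echar l x)"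
proof -
  have i: "(\<lambda>u. q l * echar l (x + u)) integrable_on cbox 0 (d *\<^sub>R One)" for l
    by (intro integrable_continuous continuous_intros)
  have "boxmean d (\<lambda>x. \<Sum>l\<in>\<Lambda>. q l * echar l x) x = (\<Sum>l\<in>\<Lambda>. boxmean d (\<lambda>x. q l * echar l x) x)"
    unfolding boxmean_def
    by (cases "finite \<Lambda>") (simp_all add: Henstock_Kurzweil_Integration.integral_sum[OF _ i] sum_distrib_left)
  also have "\<dots> = (\<Sum>l\<in>\<Lambda>. q l * boxmean d (echar l) 0 * echar l x)"
  proof (rule sum.cong[OF refl])
    fix l
    have "boxmean d (\<lambda>x. q l * echar l x) x = q l * boxmean d (echar l) x"
      by (simp add: boxmean_def)
    thus "boxmean d (\<lambda>x. q l * echar l x) x = q l * boxmean d (echar l) 0 * echar l x"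
      using boxmean_echar[of d l x] by simp
  qed
  finally show ?thesis .
qed

text \<open>The polynomial exceeds its cube average by at most half its supremum, so
  \<open>M \<le> E + M / 2\<close>. This can be solved for \<open>M\<close> because a trigonometric
  polynomial is bounded.\<close>

lemma tpoly_sup_le_boxmean:
  fixes q :: "real^'m \<Rightarrow> complex" and d :: real
  assumes C: "\<And>l. l \<in> \<Lambda> \<Longrightarrow> norm l \<le> C" and C0: "C \<ge> 0" and fin: "finite \<Lambda>"
    and d: "d > 0" "d * CARD('m) * exp C \<le> 1 / 2"
    and E: "\<And>x :: real^'m. norm (boxmean d (\<lambda>x. tpoly \<Lambda> q (cvec x)) x) \<le> E"
  shows "norm (tpoly \<Lambda> q (cvec x)) \<le> 2 * E"
proof -
  define P where "P = (\<lambda>x. tpoly \<Lambda> q (cvec x))"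
  have P: "continuous_on UNIV P" unfolding P_def tpoly_cvec by (intro continuous_intros)
  have bdd: "bdd_above (range (\<lambda>x. norm (P x)))"
  proof (rule bdd_aboveI[where M = "\<Sum>l\<in>\<Lambda>. norm (q l)"], clarify)
    fix x show "norm (P x) \<le> (\<Sum>l\<in>\<Lambda>. norm (q l))"
      unfolding P_def tpoly_cvec by (rule sum_norm_le) (simp add: norm_mult)
  qed
  define M where "M = (SUP x. norm (P x))"
  have M: "norm (P x) \<le> M" for x unfolding M_def by (rule cSUP_upper[OF _ bdd]) auto
  have M0: "M \<ge> 0" by (rule order_trans[OF norm_ge_zero M])
  have "norm (P x) \<le> E + M / 2" for x
  proof -
    have "norm (boxmean d (\<lambda>y. P y - P x) x) \<le> M / 2"
    proof (rule boxmean_le)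
      fix u :: "real^'m" assume u: "u \<in> cbox 0 (d *\<^sub>R One)"
      have "norm (P (x + u) - P x) \<le> M * exp C * norm (x + u - x)"
        unfolding P_def using M unfolding P_def by (intro tpoly_lipschitz C C0)
      also have "\<dots> \<le> M * exp C * (d * CARD('m))"
        using cbox_corner_norm[OF u] d M0 by (intro mult_left_mono) auto
      also have "\<dots> = M * (d * CARD('m) * exp C)" by simp
      also have "\<dots> \<le> M * (1 / 2)" by (intro mult_left_mono d M0)
      finally show "norm (P (x + u) - P x) \<le> M / 2" by simp
    qed (use d in \<open>auto intro!: continuous_intros P\<close>)
    moreover have "boxmean d (\<lambda>y. P y - P x) x = boxmean d P x - P x"
      using boxmean_diff[of P "\<lambda>_. P x" d x] boxmean_const[of d "P x" x] d(1) P
      by (simp add: integrable_continuous_UNIV)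
    moreover have "norm (P x) \<le> norm (boxmean d P x) + norm (boxmean d P x - P x)" by norm
    ultimately show ?thesis using E[of x] unfolding P_def by simp
  qed
  hence "M \<le> E + M / 2" unfolding M_def by (intro cSUP_least) auto
  hence "M \<le> 2 * E" by linarith
  thus ?thesis using M[of x] unfolding P_def by linarith
qed

section \<open>Stepanoff almost periodic functions\<close>

lemma li_integrable: "locally_integrable f \<Longrightarrow> f integrable_on cbox a b"
  unfolding locally_integrable_def using set_lebesgue_integral_eq_integral(1) by blast

lemma li_abs_integrable: "locally_integrable f \<Longrightarrow> f absolutely_integrable_on cbox a b"
  unfolding locally_integrable_def by blast

lemma li_norm_integrable: "locally_integrable f \<Longrightarrow> (\<lambda>x. norm (f x)) integrable_on cbox a b"
  using li_abs_integrable absolutely_integrable_on_def by blast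

lemma li_shift_abs:
  assumes "locally_integrable f"
  shows "(\<lambda>u. f (x + u)) absolutely_integrable_on cbox a b"
proof -
  have "(\<lambda>u. f (u + x)) integrable_on cbox (a + x - x) (b + x - x)"
    by (rule integrable_shift_cbox[OF li_integrable[OF assms]])
  moreover have "(\<lambda>u. norm (f (u + x))) integrable_on cbox (a + x - x) (b + x - x)"
    by (rule integrable_shift_cbox[OF li_norm_integrable[OF assms]])
  ultimately show ?thesis by (simp add: absolutely_integrable_on_def add.commute)
qed

lemma li_shift:
  assumes "locally_integrable f" shows "locally_integrable (\<lambda>u. f (x + u))"
  using li_shift_abs[OF assms] unfolding locally_integrable_def by blast

lemma li_diff:
  "locally_integrable f \<Longrightarrow> locally_integrable g \<Longrightarrow> locally_integrable (\<lambda>x. f x - g x)"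
  unfolding locally_integrable_def by (blast intro: set_integral_diff(1))

lemma li_continuous: "continuous_on UNIV f \<Longrightarrow> locally_integrable f"
  unfolding locally_integrable_def
  by (intro allI absolutely_integrable_continuous) (rule continuous_on_subset, auto)

text \<open>Local integrability gives measurability of the truncations to growing cubes, and these
  converge pointwise.\<close>

lemma li_measurable:
  fixes f :: "real^'m \<Rightarrow> complex"
  assumes "locally_integrable f" shows "f \<in> borel_measurable lebesgue"
proof (rule borel_measurable_LIMSEQ_metric)
  show "(\<lambda>x. indicator (cub (real n)) x *\<^sub>R f x) \<in> borel_measurable lebesgue" for n
    using li_abs_integrable[OF assms] unfolding set_integrable_def cub_def
    by (intro borel_measurable_integrable) auto
  fix x :: "real^'m"
  have "\<forall>\<^sub>F n in sequentially. indicator (cub (real n)) x *\<^sub>R f x = f x"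
  proof (rule eventually_sequentiallyI)
    fix n assume "nat \<lceil>norm x\<rceil> \<le> n"
    hence "norm x \<le> real n" by linarith
    hence "x \<in> cub (real n)" using component_le_norm_cart[of x] unfolding mem_cub by (meson order_trans)
    thus "indicator (cub (real n)) x *\<^sub>R f x = f x" by simp
  qed
  thus "(\<lambda>n. indicator (cub (real n)) x *\<^sub>R f x) \<longlonglongrightarrow> f x" by (rule tendsto_eventually)
qed

lemma negligible_iff_AE_lborel: "negligible {x. \<not> P x} \<longleftrightarrow> (AE x in lborel. P x)"
  for P :: "'a::euclidean_space \<Rightarrow> bool"
proof -
  have "negligible {x. \<not> P x} \<longleftrightarrow> (AE x in lebesgue. P x)"
  proof
    assume "negligible {x. \<not> P x}"
    thus "AE x in lebesgue. P x" unfolding eventually_ae_filter negligible_iff_null_sets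
      by (intro bexI[of _ "{x. \<not> P x}"]) auto
  next
    assume "AE x in lebesgue. P x"
    then obtain N where "N \<in> null_sets lebesgue" "{x. \<not> P x} \<subseteq> N"
      unfolding eventually_ae_filter by auto
    thus "negligible {x. \<not> P x}" unfolding negligible_iff_null_sets[symmetric] using negligible_subset by blast
  qed
  thus ?thesis by (simp add: AE_completion_iff)
qed

text \<open>Order 1 is implied by every order \<open>p \<ge> 1\<close> and is all that the later
  arguments use. Real integrals replace the extended ones, local integrability being part of the
  notion.\<close>

definition S1_ap :: "(real^'m \<Rightarrow> complex) \<Rightarrow> bool" where
  "S1_ap f \<longleftrightarrow> locally_integrable f \<and>
     (\<forall>e>0. \<exists>l>0. \<forall>a. \<exists>\<tau>\<in>cube a l. \<forall>x.
        integral (cbox 0 One) (\<lambda>u. norm (f (x + u + \<tau>) - f (x + u))) \<le> e)"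

lemma S1_ap_period:
  fixes f :: "real^'m \<Rightarrow> complex"
  assumes f: "S1_ap f" and e: "e > 0"
  obtains l where "l > 0" "\<And>a. \<exists>\<tau>\<in>cube a l. \<forall>x. integral (cbox 0 One) (\<lambda>u. norm (f (x + u + \<tau>) - f (x + u))) \<le> e"
proof -
  have "\<exists>l>0. \<forall>a. \<exists>\<tau>\<in>cube a l. \<forall>x. integral (cbox 0 One) (\<lambda>u. norm (f (x + u + \<tau>) - f (x + u))) \<le> e"
    using f e by (simp add: S1_ap_def)
  then obtain l where l: "l > 0 \<and> (\<forall>a. \<exists>\<tau>\<in>cube a l. \<forall>x. integral (cbox 0 One) (\<lambda>u. norm (f (x + u + \<tau>) - f (x + u))) \<le> e)"
    by (rule exE)
  show ?thesis by (rule that[of l]) (use l in auto)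
qed

text \<open>A pointwise substitute for Hoelder's inequality: where \<open>t > e\<close>, the factor
  \<open>(t / e) powr (p - 1)\<close> is at least 1.\<close>

lemma powr_le_interpolate:
  assumes "p \<ge> 1" "e > 0" "t \<ge> (0::real)"
  shows "t \<le> e + t powr p * e powr (1 - p)"
proof (cases "t \<le> e")
  case True
  thus ?thesis by (simp add: add_increasing2)
next
  case False
  hence t: "t > e" "t > 0" using assms by auto
  have "t = t powr p * t powr (1 - p)" using t by (simp add: powr_add[symmetric])
  also have "\<dots> \<le> t powr p * e powr (1 - p)"
    using t assms by (intro mult_left_mono powr_mono2') auto
  finally show ?thesis using assms by linarith
qed

text \<open>Integrating the pointwise interpolation over the unit cube gives
  \<open>e + e powr p * e powr (1 - p)\<close>, which is \<open>2 * e\<close>; hence the choice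
  \<open>e = e0 / 2\<close>.\<close>

lemma stepanoff_imp_S1_ap:
  fixes f :: "real^'m \<Rightarrow> complex"
  assumes p: "p \<ge> 1" and f: "stepanoff_ap p f"
  shows "S1_ap f"
  unfolding S1_ap_def
proof (intro conjI allI impI)
  show li: "locally_integrable f" using f by (simp add: stepanoff_ap_def)
  fix e0 :: real assume e0: "e0 > 0"
  define e where "e = e0 / 2"
  have e: "e > 0" using e0 by (simp add: e_def)
  have "\<exists>l>0. \<forall>a. \<exists>\<tau>\<in>cube a l.
        (SUP x. (\<integral>\<^sup>+ u\<in>cbox 0 One. ennreal (norm (f (x + u + \<tau>) - f (x + u)) powr p) \<partial>lborel))
          < ennreal (e powr p)"
    using f e unfolding stepanoff_ap_def by blast
  then obtain l where l: "l > 0" "\<And>a. \<exists>\<tau>\<in>cube a l.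
        (SUP x. (\<integral>\<^sup>+ u\<in>cbox 0 One. ennreal (norm (f (x + u + \<tau>) - f (x + u)) powr p) \<partial>lborel))
          < ennreal (e powr p)" by blast
  show "\<exists>l>0. \<forall>a. \<exists>\<tau>\<in>cube a l. \<forall>x. integral (cbox 0 One) (\<lambda>u. norm (f (x + u + \<tau>) - f (x + u))) \<le> e0"
  proof (intro exI conjI allI)
    fix a
    obtain \<tau> where \<tau>: "\<tau> \<in> cube a l" "(SUP x. (\<integral>\<^sup>+ u\<in>cbox 0 One. ennreal (norm (f (x + u + \<tau>) - f (x + u)) powr p) \<partial>lborel)) < ennreal (e powr p)"
      using l(2) by blast
    have "integral (cbox 0 One) (\<lambda>u. norm (f (x + u + \<tau>) - f (x + u))) \<le> e0" for x
    proof -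
      define g where "g = (\<lambda>u. f (x + u + \<tau>) - f (x + u))"
      have lg: "locally_integrable g"
        unfolding g_def using li_diff[OF li_shift[OF li, of "x + \<tau>"] li_shift[OF li, of x]] by (simp add: add_ac)
      have mg [measurable]: "g \<in> borel_measurable lebesgue" by (rule li_measurable[OF lg])
      let ?D = "cbox 0 One :: (real^'m) set"
      have [measurable]: "?D \<in> sets lebesgue" by simp
      have D: "emeasure lebesgue ?D = 1"
        by (simp add: inner_sum_left_Basis)
      have gp: "(\<integral>\<^sup>+ u\<in>?D. ennreal (norm (g u) powr p) \<partial>lborel) \<le> ennreal (e powr p)"
        using \<tau>(2) unfolding g_def by (intro less_imp_le le_less_trans[OF SUP_upper \<tau>(2)]) auto
      have "ennreal (integral ?D (\<lambda>u. norm (g u))) = (\<integral>\<^sup>+ u. ennreal (norm (g u)) * indicator ?D u \<partial>lborel)"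
        by (rule nn_integral_has_integral_lebesgue'[symmetric])
           (use li_norm_integrable[OF lg] in auto)
      also have "\<dots> = (\<integral>\<^sup>+ u. ennreal (norm (g u)) * indicator ?D u \<partial>lebesgue)"
        by (simp add: nn_integral_completion)
      also have "\<dots> \<le> (\<integral>\<^sup>+ u. ennreal e * indicator ?D u + ennreal (e powr (1 - p)) * (ennreal (norm (g u) powr p) * indicator ?D u) \<partial>lebesgue)"
      proof (rule nn_integral_mono)
        fix u
        have "ennreal (norm (g u)) \<le> ennreal (e + norm (g u) powr p * e powr (1 - p))"
          using p e by (intro ennreal_leI powr_le_interpolate) auto
        also have "\<dots> = ennreal e + ennreal (e powr (1 - p)) * ennreal (norm (g u) powr p)"
          using e by (simp add: ennreal_plus ennreal_mult' mult.commute)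
        finally show "ennreal (norm (g u)) * indicator ?D u \<le> ennreal e * indicator ?D u + ennreal (e powr (1 - p)) * (ennreal (norm (g u) powr p) * indicator ?D u)"
          by (auto split: split_indicator)
      qed
      also have "\<dots> = (\<integral>\<^sup>+ u. ennreal e * indicator ?D u \<partial>lebesgue) + (\<integral>\<^sup>+ u. ennreal (e powr (1 - p)) * (ennreal (norm (g u) powr p) * indicator ?D u) \<partial>lebesgue)"
        by (rule nn_integral_add) measurable
      also have "(\<integral>\<^sup>+ u. ennreal e * indicator ?D u \<partial>lebesgue) = ennreal e"
        using D by (subst nn_integral_cmult) auto
      also have "(\<integral>\<^sup>+ u. ennreal (e powr (1 - p)) * (ennreal (norm (g u) powr p) * indicator ?D u) \<partial>lebesgue) =
         ennreal (e powr (1 - p)) * (\<integral>\<^sup>+ u. ennreal (norm (g u) powr p) * indicator ?D u \<partial>lebesgue)"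
        by (rule nn_integral_cmult) measurable
      also have "(\<integral>\<^sup>+ u. ennreal (norm (g u) powr p) * indicator ?D u \<partial>lebesgue) \<le> ennreal (e powr p)"
        using gp by (simp add: nn_integral_completion)
      also have "ennreal (e powr (1 - p)) * ennreal (e powr p) = ennreal e"
        using e by (simp add: ennreal_mult'[symmetric] powr_add[symmetric])
      also have "ennreal e + ennreal e = ennreal e0"
        using e by (simp add: ennreal_plus[symmetric] e_def del: ennreal_plus)
      finally have "ennreal (integral ?D (\<lambda>u. norm (g u))) \<le> ennreal e0"
        by (simp add: add_left_mono mult_left_mono)
      thus ?thesis using e0 unfolding g_def by simp
    qed
    with \<tau>(1) show "\<exists>\<tau>\<in>cube a l. \<forall>x. integral (cbox 0 One) (\<lambda>u. norm (f (x + u + \<tau>) - f (x + u))) \<le> e0" by blast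
  qed (rule l(1))
qed

text \<open>For a Borel function the joint measurability of \<open>f (x + u)\<close> is immediate,
  which the exchange of integrals below relies on.\<close>

lemma borel_representative:
  fixes f :: "real^'m \<Rightarrow> complex"
  assumes "f \<in> borel_measurable lebesgue"
  obtains f' where "f' \<in> borel_measurable borel" "negligible {x. f x \<noteq> f' x}"
proof -
  have "(\<lambda>x. Re (f x)) \<in> borel_measurable lebesgue" "(\<lambda>x. Im (f x)) \<in> borel_measurable lebesgue"
    using assms by measurable
  from this[THEN completion_ex_borel_measurable_real]
  obtain g h where gh: "g \<in> borel_measurable lborel" "AE x in lborel. Re (f x) = g x"
    "h \<in> borel_measurable lborel" "AE x in lborel. Im (f x) = h x"
    by blast
  define f' where "f' = (\<lambda>x. complex_of_real (g x) + \<i> * complex_of_real (h x))"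
  have "AE x in lborel. f x = f' x"
    using gh(2,4) by eventually_elim (simp add: f'_def complex_eq_iff)
  hence "negligible {x. f x \<noteq> f' x}" using negligible_iff_AE_lborel[of "\<lambda>x. f x = f' x"] by simp
  moreover have "f' \<in> borel_measurable borel" unfolding f'_def using gh by simp
  ultimately show ?thesis using that by blast
qed

lemma negligible_translate:
  fixes N :: "(real^'m) set"
  assumes "negligible N" shows "negligible {u. x + u \<in> N}"
proof -
  have "{u. x + u \<in> N} = (+) (- x) ` N" by force
  thus ?thesis using negligible_translation[OF assms, of "- x"] by simp
qed

lemma S1_ap_spike:
  fixes f :: "real^'m \<Rightarrow> complex"
  assumes f: "S1_ap f" and N: "negligible {x. f x \<noteq> f' x}"
  shows "S1_ap f'"
proof -
  let ?N = "{x. f x \<noteq> f' x}"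
  have li: "locally_integrable f" using f by (simp add: S1_ap_def)
  have "locally_integrable f'"
    unfolding locally_integrable_def
  proof (intro allI)
    fix a b show "f' absolutely_integrable_on cbox a b"
      by (rule absolutely_integrable_spike[OF li_abs_integrable[OF li] N]) auto
  qed
  moreover have "integral (cbox 0 One) (\<lambda>u. norm (f' (x + u + \<tau>) - f' (x + u))) =
      integral (cbox 0 One) (\<lambda>u. norm (f (x + u + \<tau>) - f (x + u)))" for x \<tau>
  proof (rule integral_spike)
    show "negligible ({u. (x + \<tau>) + u \<in> ?N} \<union> {u. x + u \<in> ?N})"
      by (intro negligible_Un negligible_translate N)
  qed (auto simp: add_ac)
  ultimately show ?thesis using f unfolding S1_ap_def by simp
qed

text \<open>An almost period carries any unit cube into the fixed cube of side \<open>l + 1\<close>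
  at the origin, at the cost of 1 in the integral.\<close>

lemma S1_ap_bounded:
  fixes f :: "real^'m \<Rightarrow> complex"
  assumes f: "S1_ap f"
  obtains B where "B > 0" "\<And>x. integral (cbox 0 One) (\<lambda>u. norm (f (x + u))) \<le> B"
proof -
  have li: "locally_integrable f" using f by (simp add: S1_ap_def)
  obtain l where l: "l > 0" "\<And>a. \<exists>\<tau>\<in>cube a l. \<forall>x. integral (cbox 0 One) (\<lambda>u. norm (f (x + u + \<tau>) - f (x + u))) \<le> 1"
    by (rule S1_ap_period[OF f zero_less_one]) (rule that)
  define B where "B = 1 + integral (cbox 0 ((l + 1) *\<^sub>R One)) (\<lambda>y. norm (f y))"
  show ?thesis
  proof (rule that[of B])
    show "B > 0" unfolding B_def
      by (intro add_pos_nonneg integral_nonneg li_norm_integrable li) auto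
    fix x
    obtain \<tau> where \<tau>: "\<tau> \<in> cube (- x) l" "\<And>x. integral (cbox 0 One) (\<lambda>u. norm (f (x + u + \<tau>) - f (x + u))) \<le> 1"
      using l(2) by blast
    have i1: "(\<lambda>u. norm (f (x + u + \<tau>) - f (x + u))) integrable_on cbox 0 One"
      using li_norm_integrable[OF li_diff[OF li_shift[OF li, of "x + \<tau>"] li_shift[OF li, of x]]] by (simp add: add_ac)
    have i2: "(\<lambda>u. norm (f (x + \<tau> + u))) integrable_on cbox 0 One"
      by (rule li_norm_integrable[OF li_shift[OF li]])
    have "integral (cbox 0 One) (\<lambda>u. norm (f (x + u))) \<le>
        integral (cbox 0 One) (\<lambda>u. norm (f (x + u + \<tau>) - f (x + u)) + norm (f (x + \<tau> + u)))"
    proof (rule integral_le)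
      show "(\<lambda>u. norm (f (x + u))) integrable_on cbox 0 One" by (rule li_norm_integrable[OF li_shift[OF li]])
      show "(\<lambda>u. norm (f (x + u + \<tau>) - f (x + u)) + norm (f (x + \<tau> + u))) integrable_on cbox 0 One"
        by (rule integrable_add[OF i1 i2])
      fix u
      show "norm (f (x + u)) \<le> norm (f (x + u + \<tau>) - f (x + u)) + norm (f (x + \<tau> + u))"
        using norm_triangle_sub[of "f (x + u)" "f (x + u + \<tau>)"] by (simp add: add_ac norm_minus_commute)
    qed
    also have "\<dots> = integral (cbox 0 One) (\<lambda>u. norm (f (x + u + \<tau>) - f (x + u))) + integral (cbox 0 One) (\<lambda>u. norm (f (x + \<tau> + u)))"
      by (rule Henstock_Kurzweil_Integration.integral_add[OF i1 i2])
    also have "integral (cbox 0 One) (\<lambda>u. norm (f (x + \<tau> + u))) = integral (cbox (x + \<tau>) (x + \<tau> + One)) (\<lambda>y. norm (f y))"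
      using integral_shift_cbox_plus[of 0 One "\<lambda>y. norm (f y)" "x + \<tau>"] by (simp add: o_def add_ac)
    also have "\<dots> \<le> integral (cbox 0 ((l + 1) *\<^sub>R One)) (\<lambda>y. norm (f y))"
    proof (rule integral_subset_le)
      have "0 \<le> (x + \<tau>) $ i \<and> (x + \<tau>) $ i \<le> l" for i
        using \<tau>(1) by (auto simp: cube_def mem_box_cart algebra_simps dest!: spec[of _ i])
      thus "cbox (x + \<tau>) (x + \<tau> + One) \<subseteq> cbox 0 ((l + 1) *\<^sub>R One)"
        by (auto simp: mem_box_cart subset_iff) (smt (verit, best))+
    qed (auto intro: li_norm_integrable[OF li])
    finally show "integral (cbox 0 One) (\<lambda>u. norm (f (x + u))) \<le> B"
      using \<tau>(2)[of x] unfolding B_def by linarith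
  qed
qed

text \<open>Bohr's condition implies the colouring: an almost period brings every translation vector
  into a fixed compact cube, and by uniform continuity finitely many balls covering that cube give
  finitely many classes.\<close>

lemma bohr_imp_ap:
  fixes g :: "real^'m \<Rightarrow> complex"
  assumes cont: "continuous_on UNIV g"
    and per: "\<And>e. e > 0 \<Longrightarrow> \<exists>l>0. \<forall>a. \<exists>\<tau>\<in>cube a l. \<forall>x. norm (g (x + \<tau>) - g x) \<le> e"
  shows "ap g"
  unfolding ap_def
proof (intro conjI allI impI cont)
  fix e0 :: real assume e0: "e0 > 0"
  \<comment> \<open>The comparison of two translates goes through a common net point and costs
    \<open>4 * e\<close> on either side, which stays below \<open>16 * e\<close>.\<close>
  define e where "e = e0 / 16"
  have e: "e > 0" using e0 by (simp add: e_def)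
  obtain l where l: "l > 0" "\<And>a. \<exists>\<tau>\<in>cube a l. \<forall>x. norm (g (x + \<tau>) - g x) \<le> e"
    using per[OF e] by blast
  define Q where "Q = (cube 0 l :: (real^'m) set)"
  have red: "\<exists>\<tau>. \<tau> + t \<in> Q \<and> (\<forall>x. norm (g (x + \<tau>) - g x) \<le> e)" for t
  proof -
    obtain \<tau> where \<tau>: "\<tau> \<in> cube (- t) l" "\<And>x. norm (g (x + \<tau>) - g x) \<le> e" using l(2) by blast
    have i: "- (t $ i) \<le> \<tau> $ i \<and> \<tau> $ i \<le> l - t $ i" for i
      using \<tau>(1) by (auto simp: cube_def mem_box_cart algebra_simps)
    have "0 \<le> (\<tau> + t) $ i \<and> (\<tau> + t) $ i \<le> l" for i
      using i[of i] by (simp only: vector_add_component) linarith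
    hence "\<tau> + t \<in> Q" by (auto simp: Q_def cube_def mem_box_cart)
    with \<tau>(2) show ?thesis by blast
  qed
  have compQ: "compact Q" by (simp add: Q_def cube_def)
  \<comment> \<open>Uniform continuity near the compact cube is transported to the whole space by
    almost periods, at the cost of \<open>e\<close> at either end.\<close>
  have unif: "\<exists>d>0. \<forall>x h. norm h < d \<longrightarrow> norm (g (x + h) - g x) \<le> 3 * e"
  proof -
    define K where "K = {y + h |y h. y \<in> Q \<and> h \<in> cball 0 1}"
    have "compact K" unfolding K_def by (rule compact_sums[OF compQ]) simp
    hence "uniformly_continuous_on K g"
      by (intro compact_uniformly_continuous continuous_on_subset[OF cont]) auto
    then obtain d where d: "d > 0" "\<And>x y. x \<in> K \<Longrightarrow> y \<in> K \<Longrightarrow> dist y x < d \<Longrightarrow> dist (g y) (g x) < e"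
      using e unfolding uniformly_continuous_on_def by metis
    have "norm (g (x + h) - g x) \<le> 3 * e" if h: "norm h < min d 1" for x h
    proof -
      obtain \<tau> where \<tau>: "\<tau> + x \<in> Q" "\<And>x. norm (g (x + \<tau>) - g x) \<le> e" using red by blast
      have "\<tau> + x \<in> K" unfolding K_def using \<tau>(1) by (intro CollectI exI[of _ "\<tau> + x"] exI[of _ 0]) simp
      moreover have "\<tau> + x + h \<in> K" unfolding K_def using \<tau>(1) h by (intro CollectI exI[of _ "\<tau> + x"] exI[of _ h]) simp
      ultimately have "dist (g (\<tau> + x + h)) (g (\<tau> + x)) < e" using h by (intro d) (auto simp: dist_norm)
      moreover have "norm (g (\<tau> + x + h) - g (x + h)) \<le> e" using \<tau>(2)[of "x + h"] by (simp add: add_ac)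
      moreover have "norm (g (\<tau> + x) - g x) \<le> e" using \<tau>(2)[of x] by (simp add: add_ac)
      moreover have "norm (g (x + h) - g x) \<le> norm (g (\<tau> + x + h) - g (\<tau> + x)) + norm (g (\<tau> + x + h) - g (x + h)) + norm (g (\<tau> + x) - g x)"
        by norm
      ultimately show ?thesis by (simp add: dist_norm)
    qed
    thus ?thesis using d(1) by (intro exI[of _ "min d 1"]) auto
  qed
  then obtain d where d: "d > 0" "\<And>x h. norm h < d \<Longrightarrow> norm (g (x + h) - g x) \<le> 3 * e" by blast
  obtain k where k: "finite k" "Q \<subseteq> (\<Union>x\<in>k. ball x d)"
    using compQ d(1) unfolding compact_eq_totally_bounded by metis
  have "\<exists>y. y \<in> k \<and> (\<forall>x. norm (g (x + t) - g (x + y)) \<le> 4 * e)" for t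
  proof -
    obtain \<tau> where \<tau>: "\<tau> + t \<in> Q" "\<And>x. norm (g (x + \<tau>) - g x) \<le> e" using red by blast
    obtain y where y: "y \<in> k" "dist y (\<tau> + t) < d" using k(2) \<tau>(1) by auto
    have "norm (g (x + t) - g (x + y)) \<le> 4 * e" for x
    proof -
      have "norm (g (x + t + \<tau>) - g (x + t)) \<le> e" by (rule \<tau>(2))
      moreover have "norm (g ((x + y) + ((\<tau> + t) - y)) - g (x + y)) \<le> 3 * e"
        using y(2) by (intro d) (simp add: dist_norm norm_minus_commute)
      hence "norm (g (x + t + \<tau>) - g (x + y)) \<le> 3 * e" by (simp add: algebra_simps)
      moreover have "norm (g (x + t) - g (x + y)) \<le> norm (g (x + t + \<tau>) - g (x + t)) + norm (g (x + t + \<tau>) - g (x + y))"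
        by norm
      ultimately show ?thesis by linarith
    qed
    thus ?thesis using y(1) by blast
  qed
  then obtain y where y: "\<And>t. y t \<in> k" "\<And>t x. norm (g (x + t) - g (x + y t)) \<le> 4 * e" by metis
  define c where "c = (\<lambda>t. to_nat_on k (y t))"
  have "finite (range c)"
    by (rule finite_subset[of _ "to_nat_on k ` k"]) (use k y in \<open>auto simp: c_def\<close>)
  moreover have "norm (g (x + s) - g (x + t)) \<le> e0" if "c s = c t" for s t x
  proof -
    have "y s = y t" using that y(1) k(1) unfolding c_def
      by (metis countable_finite inj_on_def inj_on_to_nat_on)
    hence "norm (g (x + s) - g (x + y t)) \<le> 4 * e" "norm (g (x + t) - g (x + y t)) \<le> 4 * e"
      using y(2)[of x s] y(2)[of x t] by auto
    moreover have "norm (g (x + s) - g (x + t)) \<le> norm (g (x + s) - g (x + y t)) + norm (g (x + t) - g (x + y t))" by norm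
    ultimately show ?thesis using e unfolding e_def by linarith
  qed
  ultimately show "\<exists>c :: real^'m \<Rightarrow> nat. finite (range c) \<and>
        (\<forall>s t. c s = c t \<longrightarrow> (\<forall>x. norm (g (x + s) - g (x + t)) \<le> e0))"
    by blast
qed

lemma boxmean_translated: "boxmean d f x = complex_of_real (1 / d ^ CARD('m)) * integral (cbox x (x + d *\<^sub>R One)) f"
  for f :: "real^'m \<Rightarrow> complex"
  using integral_shift_cbox_plus[of 0 "d *\<^sub>R One" f x] by (simp add: boxmean_def o_def add.commute)

text \<open>The integral over a box is continuous in both corners, which move together with
  \<open>x\<close>.\<close>

lemma continuous_boxmean:
  fixes f :: "real^'m \<Rightarrow> complex"
  assumes f: "locally_integrable f" and d: "0 < d"
  shows "continuous_on UNIV (boxmean d f)"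
proof -
  have "continuous_on UNIV (\<lambda>x. integral (cbox x (x + d *\<^sub>R One)) f)"
    unfolding continuous_on_iff
  proof (intro ballI allI impI)
    fix x :: "real^'m" and e :: real assume e: "e > 0"
    define a b where "a = x - One" and "b = x + d *\<^sub>R One + (One :: real^'m)"
    obtain \<delta> where \<delta>: "\<delta> > 0" "\<And>c' d'. c' \<in> cbox a b \<Longrightarrow> d' \<in> cbox a b \<Longrightarrow> norm (c' - x) \<le> \<delta> \<Longrightarrow> norm (d' - (x + d *\<^sub>R One)) \<le> \<delta>
        \<Longrightarrow> norm (integral (cbox c' d') f - integral (cbox x (x + d *\<^sub>R One)) f) < e"
    proof (rule indefinite_integral_continuous[OF li_integrable[OF f, of a b] _ _ e])
      show "x \<in> cbox a b" "x + d *\<^sub>R One \<in> cbox a b" using d by (auto simp: a_def b_def mem_box_cart)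
    qed blast
    have "dist (integral (cbox y (y + d *\<^sub>R One)) f) (integral (cbox x (x + d *\<^sub>R One)) f) < e" if y: "dist y x < min \<delta> 1" for y
      unfolding dist_norm
    proof (rule \<delta>(2))
      have "\<bar>y $ i - x $ i\<bar> \<le> 1" for i
        using component_le_norm_cart[of "y - x" i] y by (simp add: dist_norm)
      hence *: "x $ i - 1 \<le> y $ i" "y $ i \<le> x $ i + 1" for i by (smt (verit))+
      have **: "y $ i \<le> x $ i + d + 1" "x $ i \<le> y $ i + d + 1" for i using * d by (smt (verit))+
      show "y \<in> cbox a b" "y + d *\<^sub>R One \<in> cbox a b" using * ** by (auto simp: a_def b_def mem_box_cart algebra_simps)
    qed (use y in \<open>auto simp: dist_norm\<close>)
    thus "\<exists>\<delta>>0. \<forall>x'\<in>UNIV. dist x' x < \<delta> \<longrightarrow> dist (integral (cbox x' (x' + d *\<^sub>R One)) f) (integral (cbox x (x + d *\<^sub>R One)) f) < e"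
      using \<delta>(1) by (intro exI[of _ "min \<delta> 1"]) auto
  qed
  thus ?thesis unfolding boxmean_translated by (intro continuous_intros)
qed

text \<open>The cube of side \<open>d\<close> lies in the unit cube, so an almost period in the
  integral sense with accuracy \<open>e * d ^ CARD('m)\<close> is one in the uniform sense with
  accuracy \<open>e\<close> for the average.\<close>

lemma ap_boxmean:
  fixes f :: "real^'m \<Rightarrow> complex"
  assumes f: "S1_ap f" and d: "0 < d" "d \<le> 1"
  shows "ap (boxmean d f)"
proof (rule bohr_imp_ap)
  have li: "locally_integrable f" using f by (simp add: S1_ap_def)
  show "continuous_on UNIV (boxmean d f)" by (rule continuous_boxmean[OF li d(1)])
  fix e :: real assume e: "e > 0"
  have dd: "d ^ CARD('m) > 0" using d by simp
  hence "e * d ^ CARD('m) > 0" using e by simp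
  then obtain l where l: "l > 0" "\<And>a. \<exists>\<tau>\<in>cube a l. \<forall>x. integral (cbox 0 One) (\<lambda>u. norm (f (x + u + \<tau>) - f (x + u))) \<le> e * d ^ CARD('m)"
    by (rule S1_ap_period[OF f]) (rule that)
  have "norm (boxmean d f (x + \<tau>) - boxmean d f x) \<le> e"
    if \<tau>: "\<And>x. integral (cbox 0 One) (\<lambda>u. norm (f (x + u + \<tau>) - f (x + u))) \<le> e * d ^ CARD('m)" for x \<tau>
  proof -
    have lg: "locally_integrable (\<lambda>u. f (x + \<tau> + u) - f (x + u))"
      by (rule li_diff[OF li_shift[OF li] li_shift[OF li]])
    have "boxmean d f (x + \<tau>) - boxmean d f x = complex_of_real (1 / d ^ CARD('m)) * integral (cbox 0 (d *\<^sub>R One)) (\<lambda>u. f (x + \<tau> + u) - f (x + u))"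
      unfolding boxmean_def right_diff_distrib[symmetric]
      by (subst Henstock_Kurzweil_Integration.integral_diff) (auto intro: li_integrable[OF li_shift[OF li]])
    hence eq: "norm (boxmean d f (x + \<tau>) - boxmean d f x) = norm (integral (cbox 0 (d *\<^sub>R One)) (\<lambda>u. f (x + \<tau> + u) - f (x + u))) / d ^ CARD('m)"
      using d by (simp add: norm_mult norm_divide norm_power)
    have "norm (integral (cbox 0 (d *\<^sub>R One)) (\<lambda>u. f (x + \<tau> + u) - f (x + u))) \<le> integral (cbox 0 (d *\<^sub>R One)) (\<lambda>u. norm (f (x + \<tau> + u) - f (x + u)))"
      by (intro integral_norm_bound_integral li_integrable[OF lg] li_norm_integrable[OF lg]) auto
    also have "\<dots> \<le> integral (cbox 0 One) (\<lambda>u. norm (f (x + \<tau> + u) - f (x + u)))"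
      by (intro integral_subset_le li_norm_integrable[OF lg])
         (use d in \<open>auto simp: mem_box_cart subset_iff intro: order_trans\<close>)
    also have "\<dots> = integral (cbox 0 One) (\<lambda>u. norm (f (x + u + \<tau>) - f (x + u)))" by (simp add: add_ac)
    also have "\<dots> \<le> e * d ^ CARD('m)" by (rule \<tau>)
    finally show ?thesis unfolding eq using dd by (simp only: pos_divide_le_eq)
  qed
  hence "\<exists>\<tau>\<in>cube a l. \<forall>x. norm (boxmean d f (x + \<tau>) - boxmean d f x) \<le> e" for a
    using l(2)[of a] by (elim bexE) (rule bexI, auto)
  thus "\<exists>l>0. \<forall>a. \<exists>\<tau>\<in>cube a l. \<forall>x. norm (boxmean d f (x + \<tau>) - boxmean d f x) \<le> e"
    using l(1) by (intro exI[of _ l]) simp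
qed

section \<open>Fourier coefficients of \<open>f\<close> and of its cube averages\<close>

lemma borel_set_integrable:
  fixes g :: "real^'m \<Rightarrow> 'b::{euclidean_space}"
  assumes "g \<in> borel_measurable borel" "g absolutely_integrable_on cbox a b"
  shows "set_integrable lborel (cbox a b) g"
proof -
  have "(\<lambda>x. indicator (cbox a b) x *\<^sub>R g x) \<in> borel_measurable lborel"
    using assms(1) by measurable
  thus ?thesis using assms(2) unfolding set_integrable_def by (simp add: integrable_completion)
qed

lemma cub_translate_subset:
  assumes "u \<in> cbox 0 (d *\<^sub>R One)" "d \<le> 1"
  shows "cbox (u - N *\<^sub>R One) (u + N *\<^sub>R One) \<subseteq> (cub (N + 1) :: (real^'m) set)"
    and "cub (N - 1) \<subseteq> cbox (u - N *\<^sub>R One) (u + N *\<^sub>R (One :: real^'m))"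
proof -
  have u: "0 \<le> u $ i" "u $ i \<le> 1" for i using assms by (auto simp: mem_box_cart intro: order_trans)
  show "cbox (u - N *\<^sub>R One) (u + N *\<^sub>R One) \<subseteq> cub (N + 1)"
  proof
    fix x assume "x \<in> cbox (u - N *\<^sub>R One) (u + N *\<^sub>R One)"
    hence x: "u $ i - N \<le> x $ i" "x $ i \<le> u $ i + N" for i by (auto simp: mem_box_cart)
    have "\<bar>x $ i\<bar> \<le> N + 1" for i using x[of i] u[of i] unfolding abs_le_iff by linarith
    thus "x \<in> cub (N + 1)" by (simp add: mem_cub)
  qed
  show "cub (N - 1) \<subseteq> cbox (u - N *\<^sub>R One) (u + N *\<^sub>R One)"
  proof
    fix x :: "real^'m" assume "x \<in> cub (N - 1)"
    hence x: "\<bar>x $ i\<bar> \<le> N - 1" for i by (simp add: mem_cub)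
    have "u $ i - N \<le> x $ i \<and> x $ i \<le> u $ i + N" for i
      using x[of i] u[of i] unfolding abs_le_iff by linarith
    thus "x \<in> cbox (u - N *\<^sub>R One) (u + N *\<^sub>R One)" by (simp add: mem_box_cart)
  qed
qed

text \<open>Fubini with a bounded weight \<open>e\<close>. For \<open>u\<close> in the small cube
  the inner integrals of norms are at most the mass of \<open>f\<close> on the cube enlarged by 1,
  which gives joint integrability.\<close>

lemma integral_swap_translates:
  fixes f e :: "real^'m \<Rightarrow> complex"
  assumes f: "f \<in> borel_measurable borel" and li: "locally_integrable f" and d: "0 < d" "d \<le> 1"
    and e: "continuous_on UNIV e" "\<And>x. norm (e x) \<le> 1"
  shows "integral (cub N) (\<lambda>x. integral (cbox 0 (d *\<^sub>R One)) (\<lambda>u. f (x + u)) * e x) =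
     integral (cbox 0 (d *\<^sub>R One)) (\<lambda>u. integral (cub N) (\<lambda>x. f (x + u) * e x))"
proof -
  let ?D = "cbox 0 (d *\<^sub>R One) :: (real^'m) set"
  let ?Q = "cub N :: (real^'m) set"
  have em [measurable]: "e \<in> borel_measurable borel" by (rule borel_measurable_continuous_onI[OF e(1)])
  note [measurable] = f
  have Qm [measurable]: "?Q \<in> sets borel" by (simp add: cub_def)
  define h where "h = (\<lambda>u x. indicator ?D u *\<^sub>R (indicator ?Q x *\<^sub>R (f (x + u) * e x)))"
  have hm [measurable]: "case_prod h \<in> borel_measurable (lborel \<Otimes>\<^sub>M lborel)"
    unfolding h_def by measurable
  define B where "B = integral (cub (N + 1)) (\<lambda>y. norm (f y))"
  have B0: "B \<ge> 0" unfolding B_def cub_def by (intro integral_nonneg li_norm_integrable li) auto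
  have lt: "locally_integrable (\<lambda>x. f (x + u))" for u
    using li_shift[OF li, of u] by (simp add: add.commute)
  have int1: "set_integrable lborel ?Q (\<lambda>x. f (x + u))" for u
    unfolding cub_def by (intro borel_set_integrable li_abs_integrable lt) measurable
  have intD: "set_integrable lborel ?D (\<lambda>u. f (x + u))" for x
    by (intro borel_set_integrable li_shift_abs li) measurable
  have int2: "set_integrable lborel ?Q (\<lambda>x. f (x + u) * e x)" for u
    using int1[of u] unfolding set_integrable_def
    by (rule Bochner_Integration.integrable_bound)
       (use e in \<open>auto simp: norm_mult intro!: AE_I2 mult_right_le_one_le mult_left_mono mult_left_le\<close>)
  have bnd: "(\<integral>x. norm (h u x) \<partial>lborel) \<le> indicator ?D u * B" for u
  proof (cases "u \<in> ?D")
    case True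
    have i3: "set_integrable lborel ?Q (\<lambda>x. norm (f (x + u)))" using int1[of u] by (rule set_integrable_norm)
    have "(\<integral>x. norm (h u x) \<partial>lborel) \<le> (\<integral>x. indicator ?Q x *\<^sub>R norm (f (x + u)) \<partial>lborel)"
      using i3 e True unfolding set_integrable_def
      by (intro integral_mono') (auto simp: h_def norm_mult mult_left_le split: split_indicator)
    also have "\<dots> = integral ?Q (\<lambda>x. norm (f (x + u)))"
      using set_borel_integral_eq_integral(2)[OF i3] by (simp add: set_lebesgue_integral_def)
    also have "\<dots> = integral (cbox (u - N *\<^sub>R One) (u + N *\<^sub>R One)) (\<lambda>y. norm (f y))"
      using integral_shift_cbox_plus[of "- (N *\<^sub>R One)" "N *\<^sub>R One" "\<lambda>y. norm (f y)" u]
      by (simp add: cub_def o_def add.commute)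
    also have "\<dots> \<le> B"
      unfolding B_def using cub_translate_subset(1)[OF True d(2)] li_norm_integrable[OF li]
      by (intro integral_subset_le) (auto simp: cub_def)
    finally show ?thesis using True by simp
  qed (simp add: h_def)
  have "integrable (lborel \<Otimes>\<^sub>M lborel) (case_prod h)"
  proof (rule lborel_pair.Fubini_integrable[OF hm])
    have "integrable lborel (\<lambda>u. indicator ?D u *\<^sub>R B)"
      using emeasure_lborel_cbox_finite[of 0 "d *\<^sub>R One :: real^'m"] by (intro integrable_indicator) auto
    hence "integrable lborel (\<lambda>u. indicator ?D u * B)" by simp
    thus "integrable lborel (\<lambda>x. \<integral>y. norm (case (x, y) of (x, y) \<Rightarrow> h x y) \<partial>lborel)"
    proof (rule Bochner_Integration.integrable_bound)
      show "(\<lambda>x. \<integral>y. norm (case (x, y) of (x, y) \<Rightarrow> h x y) \<partial>lborel) \<in> borel_measurable lborel"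
        by measurable
      show "AE u in lborel. norm (\<integral>y. norm (case (u, y) of (x, y) \<Rightarrow> h x y) \<partial>lborel) \<le> norm (indicator ?D u * B)"
        using bnd B0 by (auto intro!: AE_I2 simp: abs_mult)
    qed
    have "integrable lborel (h u)" for u
      unfolding h_def using int2[of u] unfolding set_integrable_def by (intro integrable_scaleR_right)
    thus "AE u in lborel. integrable lborel (\<lambda>y. case (u, y) of (x, y) \<Rightarrow> h x y)"
      by simp
  qed
  note hint = this
  have swap: "(\<integral>x. (\<integral>u. h u x \<partial>lborel) \<partial>lborel) = (\<integral>u. (\<integral>x. h u x \<partial>lborel) \<partial>lborel)"
    by (rule lborel_pair.Fubini_integral[OF hint])
  have hx: "(\<integral>u. h u x \<partial>lborel) = indicator ?Q x *\<^sub>R (integral ?D (\<lambda>u. f (x + u)) * e x)" for x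
  proof -
    have "(\<integral>u. h u x \<partial>lborel) = (\<integral>u. (indicator ?D u *\<^sub>R f (x + u)) * (indicator ?Q x *\<^sub>R e x) \<partial>lborel)"
      unfolding h_def by (intro Bochner_Integration.integral_cong refl) (auto split: split_indicator)
    also have "\<dots> = (\<integral>u. indicator ?D u *\<^sub>R f (x + u) \<partial>lborel) * (indicator ?Q x *\<^sub>R e x)"
      by (rule integral_mult_left_zero)
    also have "(\<integral>u. indicator ?D u *\<^sub>R f (x + u) \<partial>lborel) = integral ?D (\<lambda>u. f (x + u))"
      using set_borel_integral_eq_integral(2)[OF intD[of x]] by (simp add: set_lebesgue_integral_def)
    finally show ?thesis by simp
  qed
  have hu: "(\<integral>x. h u x \<partial>lborel) = indicator ?D u *\<^sub>R integral ?Q (\<lambda>x. f (x + u) * e x)" for u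
  proof -
    have "(\<integral>x. h u x \<partial>lborel) = indicator ?D u *\<^sub>R (\<integral>x. indicator ?Q x *\<^sub>R (f (x + u) * e x) \<partial>lborel)"
      unfolding h_def by (rule integral_scaleR_right)
    thus ?thesis
      using set_borel_integral_eq_integral(2)[OF int2[of u]] by (simp add: set_lebesgue_integral_def)
  qed
  have "set_integrable lborel ?Q (\<lambda>x. integral ?D (\<lambda>u. f (x + u)) * e x)"
    using lborel_pair.integrable_snd[OF hint] unfolding hx set_integrable_def .
  moreover have "set_integrable lborel ?D (\<lambda>u. integral ?Q (\<lambda>x. f (x + u) * e x))"
    using lborel_pair.integrable_fst[OF hint] unfolding hu set_integrable_def .
  ultimately show ?thesis
    using swap unfolding hx hu
    by (simp add: set_borel_integral_eq_integral(2)[symmetric] set_lebesgue_integral_def)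
qed

lemma continuous_integral_translates:
  fixes f :: "real^'m \<Rightarrow> complex"
  assumes "locally_integrable f" "R > 0"
  shows "continuous_on UNIV (\<lambda>u. integral (cub R) (\<lambda>x. f (x + u)))"
proof -
  have "continuous_on UNIV (\<lambda>u. complex_of_real ((2 * R) ^ CARD('m)) * boxmean (2 * R) f (u - R *\<^sub>R One))"
    by (intro continuous_intros continuous_on_compose2[OF continuous_boxmean[OF assms(1)]]) (use assms in auto)
  moreover have "complex_of_real ((2 * R) ^ CARD('m)) * boxmean (2 * R) f (u - R *\<^sub>R One) = integral (cub R) (\<lambda>x. f (x + u))" for u
  proof -
    have eq: "u - R *\<^sub>R One + (2 * R) *\<^sub>R One = u + R *\<^sub>R (One :: real^'m)"
      by (simp add: vec_eq_iff)
    show ?thesis using assms(2) unfolding boxmean_translated add.commute[of _ u] integral_cub_translate eq by simp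
  qed
  ultimately show ?thesis by simp
qed

lemma Re_integral: "g integrable_on S \<Longrightarrow> Re (integral S g) = integral S (\<lambda>x. Re (g x))"
  using integral_linear[OF _ bounded_linear_Re, of g S] by (simp add: o_def)

text \<open>As \<open>f\<close> may be unbounded, its mass in a shell cannot be read off a pointwise
  bound. The average of \<open>norm (f x)\<close> over unit cubes is at most \<open>B\<close>,
  however, and its integrals over cubes larger or smaller by 1 enclose those of
  \<open>norm (f x)\<close>; so the volume of the shell between \<open>N - 2\<close> and
  \<open>N + 2\<close> enters.\<close>

lemma shell_bound:
  fixes f :: "real^'m \<Rightarrow> complex"
  assumes f: "f \<in> borel_measurable borel" and li: "locally_integrable f"
    and B: "\<And>x. integral (cbox 0 One) (\<lambda>u. norm (f (x + u))) \<le> B" and N: "N > 2"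
  shows "integral (cub (N + 1)) (\<lambda>x. norm (f x)) - integral (cub (N - 1)) (\<lambda>x. norm (f x)) \<le>
     B * ((2 * (N + 2)) ^ CARD('m) - (2 * (N - 2)) ^ CARD('m))"
proof -
  \<comment> \<open>The norm is made complex so that the results on \<open>boxmean\<close> and on
    the exchange of integrals apply.\<close>
  define F where "F = (\<lambda>x. complex_of_real (norm (f x)))"
  have Fm: "F \<in> borel_measurable borel" unfolding F_def using f by measurable
  have Fn: "norm (F x) = norm (f x)" for x by (simp add: F_def)
  have Fli: "locally_integrable F"
    unfolding locally_integrable_def
  proof (intro allI)
    fix a b
    have "F integrable_on cbox a b"
      unfolding F_def using integrable_linear[OF li_norm_integrable[OF li] bounded_linear_of_real, of a b]
      by (simp add: o_def)
    thus "F absolutely_integrable_on cbox a b"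
      unfolding absolutely_integrable_on_def Fn using li_norm_integrable[OF li] by blast
  qed
  let ?D = "cbox 0 (1 *\<^sub>R One) :: (real^'m) set"
  define \<psi> where "\<psi> = boxmean 1 F"
  have \<psi>c: "continuous_on UNIV \<psi>" unfolding \<psi>_def by (rule continuous_boxmean[OF Fli]) simp
  have \<psi>eq: "\<psi> x = integral ?D (\<lambda>u. F (x + u))" for x by (simp add: \<psi>_def boxmean_def)
  have Re\<psi>: "Re (\<psi> x) = integral ?D (\<lambda>u. norm (f (x + u)))" for x
    unfolding \<psi>eq by (subst Re_integral[OF li_integrable[OF li_shift[OF Fli]]]) (simp add: F_def)
  have \<psi>0: "Re (\<psi> x) \<ge> 0" and \<psi>B: "Re (\<psi> x) \<le> B" for x
    unfolding Re\<psi> using B[of x] by (auto intro!: integral_nonneg li_norm_integrable[OF li_shift[OF li]])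
  define J where "J = (\<lambda>R. integral (cub R) (\<lambda>x. norm (f x)))"
  define I where "I = (\<lambda>R u. integral (cub R) (\<lambda>x. F (x + u)))"
  have ReI: "Re (I R u) = integral (cbox (u - R *\<^sub>R One) (u + R *\<^sub>R One)) (\<lambda>x. norm (f x))" for R u
    unfolding I_def add.commute[of _ u] integral_cub_translate
    by (subst Re_integral[OF li_integrable[OF Fli]]) (simp add: F_def)
  have Ic: "continuous_on UNIV (I R)" if "R > 0" for R
    unfolding I_def by (rule continuous_integral_translates[OF Fli that])
  have swap: "Re (integral (cub R) \<psi>) = integral ?D (\<lambda>u. Re (I R u))" if "R > 0" for R
  proof -
    have "integral (cub R) \<psi> = integral ?D (I R)"
      using integral_swap_translates[OF Fm Fli, of 1 "\<lambda>_. 1" R] by (simp add: \<psi>eq[abs_def] I_def[abs_def])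
    thus ?thesis using Ic[OF that] by (simp only: Re_integral[OF integrable_continuous_UNIV])
  qed
  have D1: "measure lborel ?D = 1"
    by (subst content_cbox_cart) (auto simp: interval_ne_empty_cart)
  have intRe: "(\<lambda>u. Re (I R u)) integrable_on ?D" if "R > 0" for R
    by (intro integrable_continuous continuous_intros continuous_on_subset[OF Ic[OF that]]) auto
  have e1: "N + 2 - 1 = N + 1" and e2: "N - 2 + 1 = N - 1" by simp_all
  have 1: "J (N + 1) \<le> integral ?D (\<lambda>u. Re (I (N + 2) u))"
  proof -
    have "J (N + 1) = integral ?D (\<lambda>_. J (N + 1))" using D1 by simp
    also have "\<dots> \<le> integral ?D (\<lambda>u. Re (I (N + 2) u))"
    proof (rule integral_le[OF _ intRe])
      fix u assume u: "u \<in> ?D"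
      show "J (N + 1) \<le> Re (I (N + 2) u)"
        unfolding ReI J_def using cub_translate_subset(2)[OF u, of "N + 2", unfolded e1] li_norm_integrable[OF li]
        by (intro integral_subset_le) (simp_all add: cub_def)
    qed (use N in auto)
    finally show ?thesis .
  qed
  have 2: "integral ?D (\<lambda>u. Re (I (N - 2) u)) \<le> J (N - 1)"
  proof -
    have "integral ?D (\<lambda>u. Re (I (N - 2) u)) \<le> integral ?D (\<lambda>_. J (N - 1))"
    proof (rule integral_le[OF intRe])
      fix u assume u: "u \<in> ?D"
      show "Re (I (N - 2) u) \<le> J (N - 1)"
        unfolding ReI J_def using cub_translate_subset(1)[OF u, of "N - 2", unfolded e2] li_norm_integrable[OF li]
        by (intro integral_subset_le) (simp_all add: cub_def)
    qed (use N in auto)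
    thus ?thesis using D1 by simp
  qed
  have sub: "cub (N - 2) \<subseteq> (cub (N + 2) :: (real^'m) set)" by (auto simp: subset_iff mem_cub intro: order_trans)
  have c: "continuous_on UNIV (\<lambda>x. Re (\<psi> x))" by (intro continuous_intros \<psi>c)
  note ii = integrable_setdiff[OF integrable_integral[OF integrable_cub] integrable_integral[OF integrable_cub] negligible_setdiff[OF sub]]
  have "Re (integral (cub (N + 2)) \<psi>) - Re (integral (cub (N - 2)) \<psi>) =
      integral (cub (N + 2)) (\<lambda>x. Re (\<psi> x)) - integral (cub (N - 2)) (\<lambda>x. Re (\<psi> x))"
    by (simp add: Re_integral[OF integrable_cub[OF \<psi>c]])
  also have "\<dots> = integral (cub (N + 2) - cub (N - 2)) (\<lambda>x. Re (\<psi> x))"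
    by (rule integral_setdiff[symmetric]) (intro integrable_cub c negligible_setdiff sub)+
  also have "\<dots> \<le> integral (cub (N + 2) - cub (N - 2) :: (real^'m) set) (\<lambda>_. B)"
    by (intro integral_le ii c \<psi>B continuous_intros)
  also have "\<dots> = integral (cub (N + 2) :: (real^'m) set) (\<lambda>_. B) - integral (cub (N - 2) :: (real^'m) set) (\<lambda>_. B)"
    by (rule integral_setdiff) (intro integrable_cub continuous_intros negligible_setdiff sub)+
  also have "\<dots> = B * ((2 * (N + 2)) ^ CARD('m) - (2 * (N - 2)) ^ CARD('m))"
    using N content_cub[of "N + 2", where 'm='m] content_cub[of "N - 2", where 'm='m]
    by (simp add: cub_def algebra_simps)
  finally have "Re (integral (cub (N + 2)) \<psi>) - Re (integral (cub (N - 2)) \<psi>) \<le> B * ((2 * (N + 2)) ^ CARD('m) - (2 * (N - 2)) ^ CARD('m))" .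
  moreover have "integral (cub R) (\<lambda>x. norm (f x)) = J R" for R by (simp add: J_def)
  ultimately show ?thesis using 1 2 N swap[of "N + 2"] swap[of "N - 2"] by simp
qed

lemma fourier_avg_boxavg: "fourier_avg f l N = boxavg N (\<lambda>x. f x * echar (- l) x)"
  by (simp add: fourier_avg_def boxavg_def cub_def echar_def cis_conv_exp)

text \<open>After exchanging integrals, an average over \<open>u\<close> of integrals over shifted
  cubes appears. If the shifts are ignored the multiplier factors out; each shift costs at most
  twice the mass of a shell, which is of lower order than the volume of the cube.\<close>

lemma boxavg_boxmean_asymp:
  fixes f :: "real^'m \<Rightarrow> complex"
  assumes f: "f \<in> borel_measurable borel" and li: "locally_integrable f" and d: "0 < d" "d \<le> 1"
    and B: "\<And>x. integral (cbox 0 One) (\<lambda>u. norm (f (x + u))) \<le> B"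
  shows "((\<lambda>N. boxavg N (\<lambda>x. boxmean d f x * echar (- l) x) - boxmean d (echar l) 0 * fourier_avg f l N) \<longlongrightarrow> 0) at_top"
proof (rule tendsto_0_le[where K = 1])
  let ?m = "CARD('m)"
  define R where "R = (\<lambda>N::real. 2 * B * ((1 + 2 / N) ^ ?m - (1 - 2 / N) ^ ?m))"
  have "(R \<longlongrightarrow> 2 * B * ((1 + 0) ^ ?m - (1 - 0) ^ ?m)) at_top"
    unfolding R_def
    by (intro tendsto_intros tendsto_divide_0[OF tendsto_const] filterlim_at_top_imp_at_infinity filterlim_ident)
  thus "(R \<longlongrightarrow> 0) at_top" by simp
  show "\<forall>\<^sub>F N in at_top. norm (boxavg N (\<lambda>x. boxmean d f x * echar (- l) x) - boxmean d (echar l) 0 * fourier_avg f l N) \<le> norm (R N) * 1"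
    using eventually_gt_at_top[of 2]
  proof eventually_elim
    case (elim N)
    let ?D = "cbox 0 (d *\<^sub>R One) :: (real^'m) set"
    define \<phi> where "\<phi> = (\<lambda>x. f x * echar (- l) x)"
    have "continuous_on UNIV (echar (- l) :: real^'m \<Rightarrow> complex)" by (intro continuous_intros)
    hence em: "echar (- l) \<in> borel_measurable borel" by (rule borel_measurable_continuous_onI)
    have \<phi>m: "\<phi> \<in> borel_measurable borel" unfolding \<phi>_def using f em by measurable
    have \<phi>n: "norm (\<phi> x) = norm (f x)" for x by (simp add: \<phi>_def norm_mult)
    have \<phi>li: "locally_integrable \<phi>"
      unfolding locally_integrable_def
    proof (intro allI)
      fix a b show "\<phi> absolutely_integrable_on cbox a b"
      proof (rule measurable_bounded_by_integrable_imp_absolutely_integrable)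
        show "\<phi> \<in> borel_measurable (lebesgue_on (cbox a b))"
          using \<phi>m by (intro measurable_restrict_space1 measurable_completion) simp
        show "(\<lambda>x. norm (f x)) integrable_on cbox a b" by (rule li_norm_integrable[OF li])
      qed (auto simp: \<phi>n)
    qed
    define A where "A = (\<lambda>u. integral (cub N) (\<lambda>x. \<phi> (x + u)))"
    have Ac: "continuous_on UNIV A" unfolding A_def by (rule continuous_integral_translates[OF \<phi>li]) (use elim in auto)
    define \<delta> where "\<delta> = integral (cub (N + 1)) (\<lambda>x. norm (f x)) - integral (cub (N - 1)) (\<lambda>x. norm (f x))"
    have Adiff: "norm (A u - A 0) \<le> 2 * \<delta>" if u: "u \<in> ?D" for u
    proof -
      have "A u = integral (cbox (u - N *\<^sub>R One) (u + N *\<^sub>R One)) \<phi>" for u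
        unfolding A_def add.commute[of _ u] integral_cub_translate ..
      moreover have "(0 :: real^'m) \<in> ?D" using d by (simp add: mem_box_cart)
      ultimately show ?thesis
        using integral_sandwich[where f = \<phi> and a = "- ((N + 1) *\<^sub>R One)" and b = "(N + 1) *\<^sub>R One" and S = "cbox (u - N *\<^sub>R One) (u + N *\<^sub>R One)" and T = "cbox (0 - N *\<^sub>R One) (0 + N *\<^sub>R One)" and c = "- ((N - 1) *\<^sub>R One)" and d = "(N - 1) *\<^sub>R One"]
          cub_translate_subset[OF u d(2), of N] cub_translate_subset[of 0 d N] d(2) li_abs_integrable[OF \<phi>li]
        unfolding \<delta>_def \<phi>n cub_def by auto
    qed
    have "integral (cub N) (\<lambda>x. boxmean d f x * echar (- l) x) =
        complex_of_real (1 / d ^ ?m) * integral (cub N) (\<lambda>x. integral ?D (\<lambda>u. f (x + u)) * echar (- l) x)"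
      unfolding boxmean_def by (simp add: mult.assoc)
    also have "integral (cub N) (\<lambda>x. integral ?D (\<lambda>u. f (x + u)) * echar (- l) x) = integral ?D (\<lambda>u. integral (cub N) (\<lambda>x. f (x + u) * echar (- l) x))"
      by (rule integral_swap_translates[OF f li d]) (auto intro!: continuous_intros)
    also have "\<dots> = integral ?D (\<lambda>u. echar l u * A u)"
    proof -
      have "f (x + u) * echar (- l) x = echar l u * \<phi> (x + u)" for x u
      proof -
        have "echar l u * \<phi> (x + u) = (echar l u * echar (- l) u) * (f (x + u) * echar (- l) x)"
          by (simp only: \<phi>_def echar_add mult_ac)
        thus ?thesis by simp
      qed
      thus ?thesis by (simp add: A_def)
    qed
    finally have "integral (cub N) (\<lambda>x. boxmean d f x * echar (- l) x) = complex_of_real (1 / d ^ ?m) * integral ?D (\<lambda>u. echar l u * A u)" .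
    moreover have "boxmean d (echar l) 0 * integral (cub N) \<phi> = complex_of_real (1 / d ^ ?m) * integral ?D (\<lambda>u. echar l u * A 0)"
      by (simp add: boxmean_def A_def)
    ultimately have XY: "integral (cub N) (\<lambda>x. boxmean d f x * echar (- l) x) - boxmean d (echar l) 0 * integral (cub N) \<phi> =
        complex_of_real (1 / d ^ ?m) * integral ?D (\<lambda>u. echar l u * (A u - A 0))"
    proof -
      have "integral ?D (\<lambda>u. echar l u * A u - echar l u * A 0) = integral ?D (\<lambda>u. echar l u * A u) - integral ?D (\<lambda>u. echar l u * A 0)"
        by (rule Henstock_Kurzweil_Integration.integral_diff; intro integrable_continuous continuous_intros continuous_on_subset[OF Ac]) auto
      thus ?thesis
        using \<open>integral (cub N) (\<lambda>x. boxmean d f x * echar (- l) x) = complex_of_real (1 / d ^ ?m) * integral ?D (\<lambda>u. echar l u * A u)\<close>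
          \<open>boxmean d (echar l) 0 * integral (cub N) \<phi> = complex_of_real (1 / d ^ ?m) * integral ?D (\<lambda>u. echar l u * A 0)\<close>
        by (simp only: right_diff_distrib)
    qed
    have "boxavg N (\<lambda>x. boxmean d f x * echar (- l) x) - boxmean d (echar l) 0 * fourier_avg f l N =
        complex_of_real (1 / (2 * N) ^ ?m) *
          (integral (cub N) (\<lambda>x. boxmean d f x * echar (- l) x) - boxmean d (echar l) 0 * integral (cub N) \<phi>)"
      unfolding fourier_avg_boxavg \<phi>_def[symmetric] boxavg_def
      by (simp only: right_diff_distrib mult.left_commute)
    also have "\<dots> = complex_of_real (1 / (2 * N) ^ ?m) * boxmean d (\<lambda>u. echar l u * (A u - A 0)) 0"
      unfolding XY by (simp add: boxmean_def)
    finally have "boxavg N (\<lambda>x. boxmean d f x * echar (- l) x) - boxmean d (echar l) 0 * fourier_avg f l N =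
        complex_of_real (1 / (2 * N) ^ ?m) * boxmean d (\<lambda>u. echar l u * (A u - A 0)) 0" .
    hence "norm (boxavg N (\<lambda>x. boxmean d f x * echar (- l) x) - boxmean d (echar l) 0 * fourier_avg f l N) =
        norm (boxmean d (\<lambda>u. echar l u * (A u - A 0)) 0) / (2 * N) ^ ?m"
      using elim by (simp add: norm_mult norm_divide norm_power)
    also have "norm (boxmean d (\<lambda>u. echar l u * (A u - A 0)) 0) \<le> 2 * \<delta>"
      by (rule boxmean_le) (use Adiff d in \<open>auto intro!: continuous_intros Ac simp: norm_mult\<close>)
    also have "\<delta> \<le> B * ((2 * (N + 2)) ^ ?m - (2 * (N - 2)) ^ ?m)"
      unfolding \<delta>_def by (rule shell_bound[OF f li B elim])
    also have "2 * (B * ((2 * (N + 2)) ^ ?m - (2 * (N - 2)) ^ ?m)) / (2 * N) ^ ?m = R N"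
    proof -
      have "R N = 2 * B * (((2 * (N + 2)) / (2 * N)) ^ ?m - ((2 * (N - 2)) / (2 * N)) ^ ?m)"
      proof -
        have "(2 * (N + 2)) / (2 * N) = 1 + 2 / N" "(2 * (N - 2)) / (2 * N) = 1 - 2 / N"
          using elim by (auto simp: field_simps)
        thus ?thesis by (simp only: R_def)
      qed
      thus ?thesis unfolding power_divide by (simp add: diff_divide_distrib right_diff_distrib)
    qed
    finally show ?case using elim by (simp add: divide_right_mono)
  qed
qed

text \<open>On a cube this small the character stays within \<open>1 / 2\<close> of its value 1 at
  the corner.\<close>

lemma boxmean_echar_close:
  fixes l :: "real^'m" and d :: real
  assumes d: "0 < d" "d * CARD('m) * norm l \<le> 1 / 2"
  shows "norm (boxmean d (echar l) 0) \<ge> 1 / 2"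
proof -
  have "norm (boxmean d (\<lambda>u. echar l u - 1) 0) \<le> 1 / 2"
  proof (rule boxmean_le)
    fix u :: "real^'m" assume u: "u \<in> cbox 0 (d *\<^sub>R One)"
    have "norm (echar l u - echar l 0) \<le> \<bar>u \<bullet> l - 0 \<bullet> l\<bar>" by (rule norm_echar_diff_le)
    also have "\<dots> \<le> norm u * norm l" using Cauchy_Schwarz_ineq2[of u l] by simp
    also have "\<dots> \<le> (d * CARD('m)) * norm l" using cbox_corner_norm[OF u] d by (intro mult_right_mono) auto
    finally show "norm (echar l (0 + u) - 1) \<le> 1 / 2" using d by simp
  qed (use d in \<open>auto intro!: continuous_intros\<close>)
  moreover have "boxmean d (\<lambda>u. echar l u - 1) 0 = boxmean d (echar l) 0 - 1"
    using boxmean_diff[of "echar l" "\<lambda>_. 1" d 0] boxmean_const[of d 1 "0 :: real^'m"] d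
    by (auto simp: integrable_continuous_UNIV continuous_intros)
  ultimately show ?thesis
    using norm_triangle_ineq2[of 1 "boxmean d (echar l) 0"] by (simp add: norm_minus_commute)
qed

lemma small_box_exists: "\<exists>d>0. d \<le> (1::real) \<and> d * c \<le> 1 / 2"
proof (intro exI conjI)
  have c: "2 * (\<bar>c\<bar> + 1) > 0" by simp
  show "1 / (2 * (\<bar>c\<bar> + 1)) > 0" "1 / (2 * (\<bar>c\<bar> + 1)) \<le> 1" by (simp_all add: field_simps)
  show "1 / (2 * (\<bar>c\<bar> + 1)) * c \<le> 1 / 2" using c by (simp add: field_simps)
qed

text \<open>The limit exists because the cube average is almost periodic and so has a mean, and
  because a cube small enough for the given \<open>l\<close> has a nonzero multiplier by which to
  divide. The identity then follows for every admissible \<open>d\<close>, also where the multiplier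
  vanishes.\<close>

theorem fourier_coeff_S1_ap:
  fixes f :: "real^'m \<Rightarrow> complex"
  assumes f: "f \<in> borel_measurable borel" and ap: "S1_ap f"
  shows "(fourier_avg f l \<longlongrightarrow> fourier_coeff f l) at_top"
    and "0 < d \<Longrightarrow> d \<le> 1 \<Longrightarrow> coef (boxmean d f) l = boxmean d (echar l) 0 * fourier_coeff f l"
proof -
  have li: "locally_integrable f" using ap by (simp add: S1_ap_def)
  obtain B where B: "\<And>x. integral (cbox 0 One) (\<lambda>u. norm (f (x + u))) \<le> B"
    using S1_ap_bounded[OF ap] by blast
  have lim: "((\<lambda>N. boxmean d (echar l) 0 * fourier_avg f l N) \<longlongrightarrow> coef (boxmean d f) l) at_top"
    if d: "0 < d" "d \<le> 1" for d
  proof -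
    have "((\<lambda>N. boxavg N (\<lambda>x. boxmean d f x * echar (- l) x)) \<longlongrightarrow> coef (boxmean d f) l) at_top"
      unfolding coef_def by (intro mean_tendsto ap_mult ap_boxmean ap d ap_echar)
    from tendsto_diff[OF this boxavg_boxmean_asymp[OF f li d B, of l]] show ?thesis by simp
  qed
  obtain d0 where d0: "d0 > 0" "d0 \<le> 1" "d0 * (CARD('m) * norm l) \<le> 1 / 2"
    using small_box_exists[of "CARD('m) * norm l"] by blast
  have nz: "boxmean d0 (echar l) 0 \<noteq> 0"
    using boxmean_echar_close[where d = d0 and l = l] d0 by (auto simp: mult.assoc)
  from tendsto_divide[OF lim[OF d0(1,2)] tendsto_const nz]
  have "(fourier_avg f l \<longlongrightarrow> coef (boxmean d0 f) l / boxmean d0 (echar l) 0) at_top"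
    using nz by simp
  thus L: "(fourier_avg f l \<longlongrightarrow> fourier_coeff f l) at_top"
    unfolding fourier_coeff_def by (metis tendsto_Lim trivial_limit_at_top_linorder)
  assume d: "0 < d" "d \<le> 1"
  show "coef (boxmean d f) l = boxmean d (echar l) 0 * fourier_coeff f l"
    by (rule tendsto_unique[OF _ lim[OF d] tendsto_mult[OF tendsto_const L]]) auto
qed

section \<open>Limits of bandlimited trigonometric polynomials\<close>

text \<open>Converse of \<open>bohr_imp_ap\<close>: if \<open>s\<close> represents \<open>t\<close>
  in the net, \<open>t - s\<close> is an almost period, and it lies in the given cube when
  \<open>t\<close> is the centre and half the side exceeds all norms in the net.\<close>

lemma ap_period:
  fixes g :: "real^'m \<Rightarrow> complex"
  assumes g: "ap g" and e: "e > 0"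
  obtains l where "l > 0" "\<And>a. \<exists>\<tau>\<in>cube a l. \<forall>x. norm (g (x + \<tau>) - g x) \<le> e"
proof -
  obtain T where T: "finite T" "\<And>t. \<exists>s\<in>T. \<forall>x. norm (g (x + t) - g (x + s)) \<le> e"
    using ap_net[OF g e] by blast
  obtain R where R: "\<And>s. s \<in> T \<Longrightarrow> norm s \<le> R"
    using finite_imp_bounded[OF T(1)] unfolding bounded_iff by blast
  define L where "L = max R 0 + 1"
  show ?thesis
  proof (rule that[of "2 * L"])
    show "2 * L > 0" by (simp add: L_def)
    fix a :: "real^'m"
    define t where "t = a + L *\<^sub>R One"
    obtain s where s: "s \<in> T" "\<And>x. norm (g (x + t) - g (x + s)) \<le> e" using T(2)[of t] by blast
    have si: "\<bar>s $ i\<bar> \<le> L" for i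
      using R[OF s(1)] component_le_norm_cart[of s i] unfolding L_def by linarith
    have "t - s \<in> cube a (2 * L)"
      unfolding cube_def
    proof (simp only: mem_box_cart, intro allI)
      fix i show "a $ i \<le> (t - s) $ i \<and> (t - s) $ i \<le> (a + (2 * L) *\<^sub>R One) $ i"
        using si[of i] by (simp add: t_def abs_le_iff)
    qed
    moreover have "norm (g (x + (t - s)) - g x) \<le> e" for x
      using s(2)[of "x - s"] by (simp add: algebra_simps)
    ultimately show "\<exists>\<tau>\<in>cube a (2 * L). \<forall>x. norm (g (x + \<tau>) - g x) \<le> e" by blast
  qed
qed

lemma ap_imp_S1_ap:
  fixes g :: "real^'m \<Rightarrow> complex"
  assumes g: "ap g" shows "S1_ap g"
  unfolding S1_ap_def
proof (intro conjI allI impI)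
  show li: "locally_integrable g" by (rule li_continuous[OF ap_continuous[OF g]])
  fix e :: real assume e: "e > 0"
  obtain l where l: "l > 0" "\<And>a. \<exists>\<tau>\<in>cube a l. \<forall>x. norm (g (x + \<tau>) - g x) \<le> e"
    by (rule ap_period[OF g e]) (rule that)
  have D1: "measure lborel (cbox 0 One :: (real^'m) set) = 1"
    by (subst content_cbox_cart) (auto simp: interval_ne_empty_cart)
  show "\<exists>l>0. \<forall>a. \<exists>\<tau>\<in>cube a l. \<forall>x. integral (cbox 0 One) (\<lambda>u. norm (g (x + u + \<tau>) - g (x + u))) \<le> e"
  proof (intro exI conjI allI)
    fix a
    obtain \<tau> where \<tau>: "\<tau> \<in> cube a l" "\<And>x. norm (g (x + \<tau>) - g x) \<le> e" using l(2)[of a] by blast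
    have "integral (cbox 0 One) (\<lambda>u. norm (g (x + u + \<tau>) - g (x + u))) \<le> integral (cbox 0 One :: (real^'m) set) (\<lambda>_. e)" for x
      by (intro integral_le \<tau>(2) integrable_continuous continuous_intros ap_continuous_on[OF g])
    hence "integral (cbox 0 One) (\<lambda>u. norm (g (x + u + \<tau>) - g (x + u))) \<le> e" for x
      using D1 by simp
    with \<tau>(1) show "\<exists>\<tau>\<in>cube a l. \<forall>x. integral (cbox 0 One) (\<lambda>u. norm (g (x + u + \<tau>) - g (x + u))) \<le> e"
      by blast
  qed (rule l(1))
qed

lemma coef_eq_fourier_coeff: "coef g l = fourier_coeff g l"
  by (simp add: coef_def mean_def fourier_coeff_def fourier_avg_boxavg[abs_def])

lemma coef_trig:
  fixes q :: "real^'m \<Rightarrow> complex"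
  assumes "finite \<Lambda>"
  shows "coef (\<lambda>x. \<Sum>l\<in>\<Lambda>. q l * echar l x) k = (if k \<in> \<Lambda> then q k else 0)"
proof -
  have "coef (\<lambda>x. \<Sum>l\<in>\<Lambda>. q l * echar l x) k = (\<Sum>l\<in>\<Lambda>. q l * (if l = k then 1 else 0))"
    by (subst coef_sum) (auto simp: coef_cmult coef_echar ap_cmult)
  also have "\<dots> = (if k \<in> \<Lambda> then q k else 0)"
    using assms by (simp add: sum.delta if_distrib cong: if_cong)
  finally show ?thesis .
qed

lemma ap_trig: "ap (\<lambda>x. \<Sum>l\<in>\<Lambda>. q l * echar l x)"
  by (intro ap_sum ap_cmult ap_echar)

lemma tpoly_shift_imaginary:
  "tpoly \<Lambda> q (cvec x + \<i> *s cvec y) = (\<Sum>l\<in>\<Lambda>. (q l * complex_of_real (exp (- (y \<bullet> l)))) * echar l x)"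
proof -
  have "exp (\<i> * (\<i> * cinner (cvec y) l)) = complex_of_real (exp (- (y \<bullet> l)))" for l
    by (simp add: cinner_cvec exp_of_real[symmetric] flip: mult.assoc)
  moreover have "exp (\<i> * cinner (cvec x) l) = echar l x" for l
    by (simp add: cinner_cvec echar_def cis_conv_exp)
  ultimately show ?thesis unfolding tpoly_line by (simp only: mult_ac)
qed

lemma tpoly_translate: "tpoly \<Lambda> q (z + cvec t) = tpoly \<Lambda> (\<lambda>l. q l * echar l t) z"
  by (simp add: tpoly_def cinner_add cinner_cvec distrib_left exp_add echar_def cis_conv_exp mult_ac)

text \<open>The extension needs uniform Cauchyness on the real space and frequencies in a common
  ball; the frequency sets may change with \<open>n\<close>. The rate \<open>2 / Suc n\<close> is
  twice the accuracy \<open>1 / Suc n\<close> of the approximation, the factor 2 being the price of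
  undoing the cube average.\<close>

locale tpoly_limit =
  fixes \<Lambda> :: "nat \<Rightarrow> (real^'m) set" and q :: "nat \<Rightarrow> real^'m \<Rightarrow> complex" and C :: real
  assumes fin: "finite (\<Lambda> n)" and norm_le: "l \<in> \<Lambda> n \<Longrightarrow> norm l \<le> C" and C0: "C \<ge> 0"
    and cauchy: "norm (tpoly (\<Lambda> n) (q n) (cvec x) - tpoly (\<Lambda> m) (q m) (cvec x)) \<le> 2 / Suc n + 2 / Suc m"
begin

definition F :: "complex^'m \<Rightarrow> complex" where
  "F z = lim (\<lambda>n. tpoly (\<Lambda> n) (q n) z)"

text \<open>Putting a difference of two approximants over the union of their frequencies, still in
  the ball of radius \<open>C\<close>, makes the tube bound and the derivative bound applicable to
  it.\<close>

lemma difference: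
  obtains s where "\<And>z. tpoly (\<Lambda> n) (q n) z - tpoly (\<Lambda> m) (q m) z = tpoly (\<Lambda> n \<union> \<Lambda> m) s z"
    "\<And>z v. tpoly_deriv (\<Lambda> n) (q n) z v - tpoly_deriv (\<Lambda> m) (q m) z v = tpoly_deriv (\<Lambda> n \<union> \<Lambda> m) s z v"
proof -
  define s where "s = (\<lambda>l. (if l \<in> \<Lambda> n then q n l else 0) - (if l \<in> \<Lambda> m then q m l else 0))"
  have f: "finite (\<Lambda> n \<union> \<Lambda> m)" using fin by simp
  have "(\<Sum>l\<in>\<Lambda> n. q n l * t l) - (\<Sum>l\<in>\<Lambda> m. q m l * t l) = (\<Sum>l\<in>\<Lambda> n \<union> \<Lambda> m. s l * t l)" for t :: "real^'m \<Rightarrow> complex"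
  proof -
    have "(\<Sum>l\<in>\<Lambda> n. q n l * t l) = (\<Sum>l\<in>\<Lambda> n \<union> \<Lambda> m. (if l \<in> \<Lambda> n then q n l else 0) * t l)"
      by (rule sum.mono_neutral_cong_left[OF f]) auto
    moreover have "(\<Sum>l\<in>\<Lambda> m. q m l * t l) = (\<Sum>l\<in>\<Lambda> n \<union> \<Lambda> m. (if l \<in> \<Lambda> m then q m l else 0) * t l)"
      by (rule sum.mono_neutral_cong_left[OF f]) auto
    ultimately show ?thesis by (simp add: s_def left_diff_distrib sum_subtractf)
  qed
  thus ?thesis by (intro that[of s]) (auto simp: tpoly_def tpoly_deriv_def)
qed

lemma tube_cauchy:
  "norm (tpoly (\<Lambda> n) (q n) z - tpoly (\<Lambda> m) (q m) z) \<le> (2 / Suc n + 2 / Suc m) * exp (C * norm (imvec z))"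
proof -
  obtain s where s: "\<And>z. tpoly (\<Lambda> n) (q n) z - tpoly (\<Lambda> m) (q m) z = tpoly (\<Lambda> n \<union> \<Lambda> m) s z"
    by (rule difference[of n m]) (rule that)
  show ?thesis unfolding s
    by (rule tpoly_tube_bound) (use norm_le cauchy[of n _ m] in \<open>auto simp: s\<close>)
qed

lemma deriv_cauchy:
  "norm (tpoly_deriv (\<Lambda> n) (q n) z v - tpoly_deriv (\<Lambda> m) (q m) z v) \<le>
     (2 / Suc n + 2 / Suc m) * exp (C * (norm (imvec z) + 1)) * norm v"
proof -
  obtain s where s: "\<And>z. tpoly (\<Lambda> n) (q n) z - tpoly (\<Lambda> m) (q m) z = tpoly (\<Lambda> n \<union> \<Lambda> m) s z"
    "\<And>z v. tpoly_deriv (\<Lambda> n) (q n) z v - tpoly_deriv (\<Lambda> m) (q m) z v = tpoly_deriv (\<Lambda> n \<union> \<Lambda> m) s z v"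
    by (rule difference[of n m]) (rule that)
  show ?thesis unfolding s(2)
    by (rule tpoly_bernstein) (use norm_le C0 cauchy[of n _ m] in \<open>auto simp: s(1)\<close>)
qed

lemma two_over_Suc_tendsto: "(\<lambda>n. 2 / real (Suc n)) \<longlonglongrightarrow> 0"
  using tendsto_mult_right[OF LIMSEQ_Suc[OF lim_const_over_n[of "2::real"]], of 1] by simp

lemma Cauchy_of_bound:
  fixes a :: "nat \<Rightarrow> complex"
  assumes "\<And>n m. norm (a n - a m) \<le> (2 / Suc n + 2 / Suc m) * K"
  shows "convergent a" "norm (a n - lim a) \<le> 2 / Suc n * K"
proof -
  have K: "K \<ge> 0" using order_trans[OF norm_ge_zero assms[of 0 0]] by simp
  have "Cauchy a"
  proof (rule metric_CauchyI)
    fix e :: real assume e: "e > 0"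
    have "(\<lambda>n. 2 / real (Suc n) * K) \<longlonglongrightarrow> 0 * K" by (intro tendsto_intros two_over_Suc_tendsto)
    hence "\<forall>\<^sub>F n in sequentially. 2 / real (Suc n) * K < e / 2" using e by (intro order_tendstoD) auto
    then obtain n0 where n0: "\<And>n. n \<ge> n0 \<Longrightarrow> 2 / real (Suc n) * K < e / 2"
      unfolding eventually_sequentially by blast
    have "dist (a m) (a n) < e" if "m \<ge> n0" "n \<ge> n0" for m n
    proof -
      have "norm (a m - a n) \<le> 2 / Suc m * K + 2 / Suc n * K" using assms[of m n] by (simp add: distrib_right)
      thus ?thesis using n0[OF that(1)] n0[OF that(2)] by (simp add: dist_norm)
    qed
    thus "\<exists>M. \<forall>m\<ge>M. \<forall>n\<ge>M. dist (a m) (a n) < e" by blast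
  qed
  thus conv: "convergent a" by (rule Cauchy_convergent)
  show "norm (a n - lim a) \<le> 2 / Suc n * K"
  proof (rule tendsto_le[OF _ _ tendsto_norm[OF tendsto_diff[OF tendsto_const]]])
    show "a \<longlonglongrightarrow> lim a" using conv by (simp add: convergent_LIMSEQ_iff)
    have "(\<lambda>m. (2 / real (Suc n) + 2 / real (Suc m)) * K) \<longlonglongrightarrow> (2 / real (Suc n) + 0) * K"
      by (intro tendsto_intros two_over_Suc_tendsto)
    thus "(\<lambda>m. (2 / real (Suc n) + 2 / real (Suc m)) * K) \<longlonglongrightarrow> 2 / Suc n * K" by simp
    show "\<forall>\<^sub>F m in sequentially. norm (a n - a m) \<le> (2 / real (Suc n) + 2 / real (Suc m)) * K"
      using assms by simp
  qed auto
qed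

lemma tpoly_tendsto_F: "(\<lambda>n. tpoly (\<Lambda> n) (q n) z) \<longlonglongrightarrow> F z"
  using Cauchy_of_bound(1)[OF tube_cauchy] unfolding F_def convergent_LIMSEQ_iff .

lemma tpoly_close_F: "norm (tpoly (\<Lambda> n) (q n) z - F z) \<le> 2 / Suc n * exp (C * norm (imvec z))"
  unfolding F_def by (rule Cauchy_of_bound(2)[OF tube_cauchy])

definition DF :: "complex^'m \<Rightarrow> complex^'m \<Rightarrow> complex" where
  "DF z v = lim (\<lambda>n. tpoly_deriv (\<Lambda> n) (q n) z v)"

lemma deriv_bound':
  "norm (tpoly_deriv (\<Lambda> n) (q n) z v - tpoly_deriv (\<Lambda> m) (q m) z v) \<le>
     (2 / Suc n + 2 / Suc m) * (exp (C * (norm (imvec z) + 1)) * norm v)"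
  using deriv_cauchy[of n z v m] by (simp only: mult.assoc)

text \<open>By Bernstein's inequality for differences the derivatives converge uniformly on balls,
  so the limit may be differentiated term by term.\<close>

lemma F_has_derivative: "(F has_derivative DF z) (at z)"
proof -
  define S where "S = ball (0 :: complex^'m) (norm z + 1)"
  have zS: "z \<in> S" "open S" "convex S" by (auto simp: S_def)
  \<comment> \<open>For \<open>x\<close> in the ball, \<open>norm (imvec x) + 1\<close> is at most
    \<open>norm z + 2\<close>.\<close>
  define K where "K = exp (C * (norm z + 2))"
  have "\<exists>g. \<forall>x\<in>S. (\<lambda>n. tpoly (\<Lambda> n) (q n) x) \<longlonglongrightarrow> g x \<and> (g has_derivative DF x) (at x within S)"
  proof (rule has_derivative_sequence[OF zS(3) tpoly_has_derivative _ zS(1) tpoly_tendsto_F])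
    fix e :: real assume e: "e > 0"
    have "(\<lambda>n. 2 / real (Suc n) * K) \<longlonglongrightarrow> 0 * K" by (intro tendsto_intros two_over_Suc_tendsto)
    hence "\<forall>\<^sub>F n in sequentially. 2 / real (Suc n) * K < e" using e by (intro order_tendstoD) auto
    thus "\<forall>\<^sub>F n in sequentially. \<forall>x\<in>S. \<forall>h. norm (tpoly_deriv (\<Lambda> n) (q n) x h - DF x h) \<le> e * norm h"
    proof eventually_elim
      case (elim n)
      show ?case
      proof (intro ballI allI)
        fix x h assume x: "x \<in> S"
        have "norm (imvec x) + 1 \<le> norm z + 2" using norm_imvec_le[of x] x by (simp add: S_def)
        hence "exp (C * (norm (imvec x) + 1)) \<le> K" unfolding K_def using C0 by (simp add: mult_left_mono)
        have "norm (tpoly_deriv (\<Lambda> n) (q n) x h - DF x h) \<le> 2 / Suc n * (exp (C * (norm (imvec x) + 1)) * norm h)"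
          unfolding DF_def by (rule Cauchy_of_bound(2)[OF deriv_bound'])
        also have "\<dots> \<le> 2 / Suc n * (K * norm h)"
          using \<open>exp _ \<le> K\<close> by (intro mult_left_mono mult_right_mono) auto
        also have "\<dots> = (2 / Suc n * K) * norm h" by simp
        also have "\<dots> \<le> e * norm h" using elim by (intro mult_right_mono) auto
        finally show "norm (tpoly_deriv (\<Lambda> n) (q n) x h - DF x h) \<le> e * norm h" .
      qed
    qed
  qed
  then obtain g where g0: "\<forall>x\<in>S. (\<lambda>n. tpoly (\<Lambda> n) (q n) x) \<longlonglongrightarrow> g x \<and> (g has_derivative DF x) (at x within S)"
    by (rule exE)
  have g: "\<And>x. x \<in> S \<Longrightarrow> (\<lambda>n. tpoly (\<Lambda> n) (q n) x) \<longlonglongrightarrow> g x"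
    "\<And>x. x \<in> S \<Longrightarrow> (g has_derivative DF x) (at x within S)" by (simp_all add: g0)
  have "(g has_derivative DF z) (at z)" using g(2)[OF zS(1)] unfolding at_within_open[OF zS(1,2)] .
  moreover have "g x = F x" if "x \<in> S" for x
    using LIMSEQ_unique[OF g(1)[OF that] tpoly_tendsto_F] .
  ultimately show ?thesis by (rule has_derivative_transform_within_open[OF _ zS(2,1)])
qed

lemma DF_smult: "DF z (c *s v) = c * DF z v"
proof -
  have "(\<lambda>n. tpoly_deriv (\<Lambda> n) (q n) z v) \<longlonglongrightarrow> DF z v" for v
    using Cauchy_of_bound(1)[OF deriv_bound'] unfolding DF_def convergent_LIMSEQ_iff .
  note t = this
  have "(\<lambda>n. tpoly_deriv (\<Lambda> n) (q n) z (c *s v)) \<longlonglongrightarrow> c * DF z v"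
    unfolding tpoly_deriv_smult by (intro tendsto_intros t)
  thus ?thesis by (rule LIMSEQ_unique[OF t])
qed

lemma entire_F: "entire_fn F"
  unfolding entire_fn_def using F_has_derivative DF_smult by blast

lemma continuous_F: "continuous_on S F"
  using F_has_derivative by (meson continuous_at_imp_continuous_on has_derivative_continuous)

lemma holomorphic_F_line: "(\<lambda>w. F (z + w *s v)) holomorphic_on UNIV"
proof -
  have "((\<lambda>w. F (z + w *s v)) has_field_derivative DF (z + w *s v) v) (at w)" for w
  proof -
    have bl: "bounded_linear (\<lambda>w. w *s v)"
    proof (rule bounded_linear_intro[where K = "norm v"])
      show "norm (x *s v) \<le> norm x * norm v" for x by (simp add: norm_smult_complex)
    qed (auto simp: vec_eq_iff algebra_simps)
    have "((\<lambda>w. z + w *s v) has_derivative (\<lambda>h. h *s v)) (at w)"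
      using has_derivative_add[OF has_derivative_const bounded_linear_imp_has_derivative[OF bl]] by simp
    from has_derivative_compose[OF this F_has_derivative]
    have "((\<lambda>w. F (z + w *s v)) has_derivative (\<lambda>h. DF (z + w *s v) (h *s v))) (at w)" .
    thus ?thesis unfolding has_field_derivative_def DF_smult by (simp add: mult.commute[of _ "DF _ _"])
  qed
  thus ?thesis by (auto simp: holomorphic_on_def field_differentiable_def intro: has_field_derivative_at_within)
qed

text \<open>Comparison with the single polynomial of index 0, which obeys the tube bound; its
  distance from \<open>F\<close> carries the same exponential.\<close>

lemma F_bound:
  obtains M where "M > 0" "\<And>z. norm (F z) \<le> M * exp (C * norm (imvec z))"
proof -
  define M0 where "M0 = (\<Sum>l\<in>\<Lambda> 0. norm (q 0 l))"
  have M0: "M0 \<ge> 0" by (simp add: M0_def sum_nonneg)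
  show ?thesis
  proof (rule that[of "M0 + 2"])
    fix z
    have "norm (tpoly (\<Lambda> 0) (q 0) z) \<le> M0 * exp (C * norm (imvec z))"
      unfolding M0_def
    proof (rule tpoly_tube_bound[OF norm_le])
      fix x show "norm (tpoly (\<Lambda> 0) (q 0) (cvec x)) \<le> (\<Sum>l\<in>\<Lambda> 0. norm (q 0 l))"
        unfolding tpoly_cvec by (rule sum_norm_le) (simp add: norm_mult)
    qed
    moreover have "norm (tpoly (\<Lambda> 0) (q 0) z - F z) \<le> 2 * exp (C * norm (imvec z))"
      using tpoly_close_F[of 0 z] by simp
    moreover have "norm (F z) \<le> norm (tpoly (\<Lambda> 0) (q 0) z) + norm (tpoly (\<Lambda> 0) (q 0) z - F z)" by norm
    ultimately show "norm (F z) \<le> (M0 + 2) * exp (C * norm (imvec z))" by (simp add: distrib_right)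
  qed (use M0 in simp)
qed

lemma exponential_type_F: "exponential_type F"
proof -
  obtain M where M: "M > 0" "\<And>z. norm (F z) \<le> M * exp (C * norm (imvec z))" using F_bound by blast
  have "norm (F z) \<le> M * exp (C * norm z)" for z
    using M(2)[of z] mult_left_mono[OF norm_imvec_le[of z] C0] M(1)
    by (smt (verit) exp_le_cancel_iff mult_left_mono)
  thus ?thesis unfolding exponential_type_def by blast
qed

text \<open>For fixed \<open>y\<close> the error of the approximants is uniform in \<open>x\<close>,
  so both almost periodicity and coefficients pass to the limit.\<close>

lemma ap_F_horizontal: "ap (\<lambda>x. F (cvec x + \<i> *s cvec y))"
  and coef_F_horizontal_tendsto:
    "(\<lambda>n. if l \<in> \<Lambda> n then q n l * complex_of_real (exp (- (y \<bullet> l))) else 0) \<longlonglongrightarrow> coef (\<lambda>x. F (cvec x + \<i> *s cvec y)) l"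
proof -
  define p where "p = (\<lambda>n x. tpoly (\<Lambda> n) (q n) (cvec x + \<i> *s cvec y))"
  have app: "ap (p n)" for n unfolding p_def tpoly_shift_imaginary by (rule ap_trig)
  define K where "K = exp (C * norm y)"
  have close: "norm (p n x - F (cvec x + \<i> *s cvec y)) \<le> 2 / Suc n * K" for n x
    using tpoly_close_F[of n "cvec x + \<i> *s cvec y"] by (simp add: p_def K_def imvec_decompose)
  have t: "(\<lambda>n. 2 / real (Suc n) * K) \<longlonglongrightarrow> 0"
    using tendsto_mult_right[OF two_over_Suc_tendsto, of K] by simp
  show apF: "ap (\<lambda>x. F (cvec x + \<i> *s cvec y))"
  proof (rule ap_uniform_limit)
    fix e :: real assume "e > 0"
    hence "\<forall>\<^sub>F n in sequentially. 2 / real (Suc n) * K < e" using t by (intro order_tendstoD) auto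
    then obtain n where n: "2 / real (Suc n) * K < e" using eventually_happens[of _ sequentially] by auto
    have "norm (F (cvec x + \<i> *s cvec y) - p n x) \<le> e" for x
      using close[of n x] n by (simp add: norm_minus_commute)
    with app show "\<exists>h. ap h \<and> (\<forall>x. norm (F (cvec x + \<i> *s cvec y) - h x) \<le> e)" by blast
  qed
  have "uniform_limit UNIV p (\<lambda>x. F (cvec x + \<i> *s cvec y)) sequentially"
  proof (rule uniform_limitI)
    fix e :: real assume "e > 0"
    hence "\<forall>\<^sub>F n in sequentially. 2 / real (Suc n) * K < e" using t by (intro order_tendstoD) auto
    thus "\<forall>\<^sub>F n in sequentially. \<forall>x\<in>UNIV. dist (p n x) (F (cvec x + \<i> *s cvec y)) < e"
    proof eventually_elim
      case (elim n)
      thus ?case using close[of n] by (auto simp: dist_norm intro: le_less_trans)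
    qed
  qed
  from coef_tendsto[OF apF app this, of l]
  show "(\<lambda>n. if l \<in> \<Lambda> n then q n l * complex_of_real (exp (- (y \<bullet> l))) else 0) \<longlonglongrightarrow> coef (\<lambda>x. F (cvec x + \<i> *s cvec y)) l"
    unfolding p_def tpoly_shift_imaginary coef_trig[OF fin] .
qed

lemma cvec_zero_shift: "cvec x + \<i> *s cvec 0 = cvec x"
  by (simp add: cvec_def vec_eq_iff)

lemma ap_F: "ap (\<lambda>x. F (cvec x))"
  using ap_F_horizontal[of 0] by (simp add: cvec_zero_shift)

text \<open>Each approximant gains this factor when moved to height \<open>y\<close>, and its
  coefficients converge. The identity links the growth of \<open>F\<close> in imaginary directions
  with the position of its frequencies.\<close>

lemma coef_F_horizontal:
  "coef (\<lambda>x. F (cvec x + \<i> *s cvec y)) l = complex_of_real (exp (- (y \<bullet> l))) * coef (\<lambda>x. F (cvec x)) l"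
proof -
  have "(\<lambda>n. if l \<in> \<Lambda> n then q n l else 0) \<longlonglongrightarrow> coef (\<lambda>x. F (cvec x)) l"
    using coef_F_horizontal_tendsto[of l 0] by (simp add: cvec_zero_shift cong: if_cong)
  hence "(\<lambda>n. complex_of_real (exp (- (y \<bullet> l))) * (if l \<in> \<Lambda> n then q n l else 0)) \<longlonglongrightarrow>
      complex_of_real (exp (- (y \<bullet> l))) * coef (\<lambda>x. F (cvec x)) l"
    by (intro tendsto_intros)
  moreover have "(\<lambda>n. complex_of_real (exp (- (y \<bullet> l))) * (if l \<in> \<Lambda> n then q n l else 0)) =
      (\<lambda>n. if l \<in> \<Lambda> n then q n l * complex_of_real (exp (- (y \<bullet> l))) else 0)" by auto
  ultimately show ?thesis using LIMSEQ_unique[OF coef_F_horizontal_tendsto[of l y]] by simp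
qed

lemma coef_F_outside: "(\<And>n. l \<notin> \<Lambda> n) \<Longrightarrow> coef (\<lambda>x. F (cvec x)) l = 0"
  using coef_F_horizontal_tendsto[of l 0] LIMSEQ_unique[OF _ tendsto_const] by (simp add: cvec_zero_shift) 

text \<open>The exponential in the average contributes \<open>exp (y \<bullet> l)\<close>, which
  cancels the factor gained at height \<open>y\<close>; hence the limit is the same for every
  \<open>y\<close>.\<close>

lemma dirichlet_F: "(dirichlet_avg F y l \<longlongrightarrow> coef (\<lambda>x. F (cvec x)) l) at_top"
proof -
  define G where "G = (\<lambda>x. F (cvec x + \<i> *s cvec y))"
  have eq: "dirichlet_avg F y l = (\<lambda>N. complex_of_real (exp (y \<bullet> l)) * boxavg N (\<lambda>x. G x * echar (- l) x))"
  proof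
    fix N
    have "exp (- \<i> * cinner (cvec x + \<i> *s cvec y) l) = complex_of_real (exp (y \<bullet> l)) * echar (- l) x" for x
    proof -
      have "- \<i> * cinner (cvec x + \<i> *s cvec y) l = complex_of_real (y \<bullet> l) + \<i> * complex_of_real (x \<bullet> - l)"
        by (simp add: cinner_add cinner_smult cinner_cvec algebra_simps)
      thus ?thesis by (simp only: exp_add exp_of_real echar_def cis_conv_exp)
    qed
    hence "F (cvec x + \<i> *s cvec y) * exp (- \<i> * cinner (cvec x + \<i> *s cvec y) l) = complex_of_real (exp (y \<bullet> l)) * (G x * echar (- l) x)" for x
      by (simp add: G_def)
    thus "dirichlet_avg F y l N = complex_of_real (exp (y \<bullet> l)) * boxavg N (\<lambda>x. G x * echar (- l) x)"
      unfolding dirichlet_avg_def boxavg_cmult[symmetric] boxavg_def cub_def by simp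
  qed
  have "((\<lambda>N. boxavg N (\<lambda>x. G x * echar (- l) x)) \<longlongrightarrow> coef G l) at_top"
    unfolding coef_def G_def by (intro mean_tendsto ap_mult ap_F_horizontal ap_echar)
  hence "(dirichlet_avg F y l \<longlongrightarrow> complex_of_real (exp (y \<bullet> l)) * coef G l) at_top"
    unfolding eq by (intro tendsto_intros)
  also have "complex_of_real (exp (y \<bullet> l)) * coef G l = coef (\<lambda>x. F (cvec x)) l"
    unfolding G_def coef_F_horizontal by (simp add: mult.assoc[symmetric] of_real_mult[symmetric] exp_add[symmetric] del: of_real_mult)
  finally show ?thesis .
qed

text \<open>A real translation changes the coefficients of an approximant and keeps its frequencies,
  so the maximum principle carries the bound from the real space to the tube.\<close>

lemma F_translate_bound:
  assumes \<tau>: "\<And>x. norm (F (cvec (x + \<tau>)) - F (cvec x)) \<le> e"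
  shows "norm (F (z + cvec \<tau>) - F z) \<le> e * exp (C * norm (imvec z))"
proof -
  have "norm (tpoly (\<Lambda> n) (q n) (z + cvec \<tau>) - tpoly (\<Lambda> n) (q n) z) \<le> (e + 2 * (2 / Suc n)) * exp (C * norm (imvec z))" for n
    unfolding tpoly_translate tpoly_diff
  proof (rule tpoly_tube_bound[OF norm_le])
    fix x
    have "norm (tpoly (\<Lambda> n) (q n) (cvec x + cvec \<tau>) - tpoly (\<Lambda> n) (q n) (cvec x)) \<le>
       norm (tpoly (\<Lambda> n) (q n) (cvec (x + \<tau>)) - F (cvec (x + \<tau>))) + norm (F (cvec (x + \<tau>)) - F (cvec x)) + norm (tpoly (\<Lambda> n) (q n) (cvec x) - F (cvec x))"
      unfolding cvec_add by norm
    also have "\<dots> \<le> 2 / Suc n + e + 2 / Suc n"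
      using tpoly_close_F[of n "cvec (x + \<tau>)"] tpoly_close_F[of n "cvec x"] \<tau>[of x] by simp
    finally show "norm (tpoly (\<Lambda> n) (\<lambda>l. q n l * echar l \<tau> - q n l) (cvec x)) \<le> e + 2 * (2 / Suc n)"
      unfolding tpoly_translate tpoly_diff by simp
  qed
  note le = this
  have l1: "(\<lambda>n. norm (tpoly (\<Lambda> n) (q n) (z + cvec \<tau>) - tpoly (\<Lambda> n) (q n) z)) \<longlonglongrightarrow> norm (F (z + cvec \<tau>) - F z)"
    by (intro tendsto_intros tpoly_tendsto_F)
  have l2: "(\<lambda>n. (e + 2 * (2 / Suc n)) * exp (C * norm (imvec z))) \<longlonglongrightarrow> (e + 2 * 0) * exp (C * norm (imvec z))"
    by (intro tendsto_intros two_over_Suc_tendsto)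
  have "norm (F (z + cvec \<tau>) - F z) \<le> (e + 2 * 0) * exp (C * norm (imvec z))"
    by (rule LIMSEQ_le[OF l1 l2]) (use le in blast)
  thus ?thesis by simp
qed

lemma bohr_F:
  assumes "bounded K" shows "bohr_ap_tube K F"
  unfolding bohr_ap_tube_def
proof (intro conjI allI impI continuous_F)
  fix \<epsilon> :: real assume \<epsilon>: "\<epsilon> > 0"
  obtain R where R: "\<And>y. y \<in> K \<Longrightarrow> norm y \<le> R" using assms unfolding bounded_iff by blast
  \<comment> \<open>The factor \<open>1 / 2\<close> turns a weak bound on the supremum into the
    strict one; the absolute value covers an empty \<open>K\<close>, for which \<open>R\<close> may
    be negative.\<close>
  define e where "e = \<epsilon> / 2 * exp (- (C * \<bar>R\<bar>))"
  have e: "e > 0" using \<epsilon> by (simp add: e_def)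
  obtain l where l: "l > 0" "\<And>a. \<exists>\<tau>\<in>cube a l. \<forall>x. norm (F (cvec (x + \<tau>)) - F (cvec x)) \<le> e"
    by (rule ap_period[OF ap_F e]) (rule that)
  show "\<exists>l>0. \<forall>a. \<exists>\<tau>\<in>cube a l. (SUP z\<in>tube K. ereal (norm (F (z + cvec \<tau>) - F z))) < ereal \<epsilon>"
  proof (intro exI conjI allI)
    fix a
    obtain \<tau> where \<tau>: "\<tau> \<in> cube a l" "\<And>x. norm (F (cvec (x + \<tau>)) - F (cvec x)) \<le> e" using l(2)[of a] by blast
    have "(SUP z\<in>tube K. ereal (norm (F (z + cvec \<tau>) - F z))) \<le> ereal (\<epsilon> / 2)"
    proof (rule SUP_least)
      fix z assume "z \<in> tube K"
      hence "norm (imvec z) \<le> \<bar>R\<bar>" using R[of "imvec z"] by (simp add: tube_def)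
      have "norm (F (z + cvec \<tau>) - F z) \<le> e * exp (C * norm (imvec z))" by (rule F_translate_bound[OF \<tau>(2)])
      also have "\<dots> \<le> e * exp (C * \<bar>R\<bar>)"
        using \<open>norm (imvec z) \<le> \<bar>R\<bar>\<close> C0 e by (intro mult_left_mono) (auto intro: mult_left_mono)
      also have "\<dots> = \<epsilon> / 2" by (simp add: e_def mult.assoc exp_add[symmetric])
      finally show "ereal (norm (F (z + cvec \<tau>) - F z)) \<le> ereal (\<epsilon> / 2)" by simp
    qed
    also have "\<dots> < ereal \<epsilon>" using \<epsilon> by simp
    finally show "\<exists>\<tau>\<in>cube a l. (SUP z\<in>tube K. ereal (norm (F (z + cvec \<tau>) - F z))) < ereal \<epsilon>" using \<tau>(1) by blast
  qed (rule l(1))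
qed

end

section \<open>The indicator and the support function\<close>

context tpoly_limit
begin

lemma F_halfplane:
  assumes H: "\<And>n l. l \<in> \<Lambda> n \<Longrightarrow> - (y \<bullet> l) \<le> H" and M: "\<And>x. norm (F (cvec x)) \<le> M"
  shows "norm (F (cvec x + \<i> *s cvec y)) \<le> M * exp H"
proof -
  have le: "norm (tpoly (\<Lambda> n) (q n) (cvec x + \<i> *s cvec y)) \<le> (M + 2 / Suc n) * exp H" for n
  proof (rule tpoly_halfplane[OF H])
    fix x
    show "norm (tpoly (\<Lambda> n) (q n) (cvec x)) \<le> M + 2 / Suc n"
      using tpoly_close_F[of n "cvec x"] M[of x] norm_triangle_sub[of "tpoly (\<Lambda> n) (q n) (cvec x)" "F (cvec x)"]
      by simp
  qed
  have "(\<lambda>n. (M + 2 / real (Suc n)) * exp H) \<longlonglongrightarrow> (M + 0) * exp H"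
    by (intro tendsto_intros two_over_Suc_tendsto)
  from LIMSEQ_le[OF tendsto_norm[OF tpoly_tendsto_F] this] le
  show ?thesis by auto
qed

text \<open>At height \<open>r\<close> times \<open>y\<close> the half-plane bound reads
  \<open>M * exp (r * H)\<close>, and the contribution of \<open>M\<close> vanishes when the
  logarithm is divided by \<open>r\<close>.\<close>

lemma P_indicator_le:
  assumes H: "\<And>n l. l \<in> \<Lambda> n \<Longrightarrow> - (y \<bullet> l) \<le> H"
  shows "P_indicator F y \<le> ereal H"
  unfolding P_indicator_def
proof (rule SUP_least)
  fix x
  obtain M where M: "M > 0" "\<And>z. norm (F z) \<le> M * exp (C * norm (imvec z))" using F_bound by blast
  have M': "norm (F (cvec x)) \<le> M" for x using M(2)[of "cvec x"] by simp
  let ?v = "\<lambda>r. let w = F (cvec x + \<i> *s cvec (r *\<^sub>R y)) in if w = 0 then -\<infinity> else ereal (ln (norm w) / r)"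
  have "Limsup at_top ?v \<le> Limsup at_top (\<lambda>r. ereal (ln M / r + H))"
  proof (rule Limsup_mono)
    show "\<forall>\<^sub>F r in at_top. ?v r \<le> ereal (ln M / r + H)"
      using eventually_gt_0
    proof eventually_elim
      case (elim r)
      define w where "w = F (cvec x + \<i> *s cvec (r *\<^sub>R y))"
      have "- ((r *\<^sub>R y) \<bullet> l) \<le> r * H" if "l \<in> \<Lambda> n" for l n
        using mult_left_mono[OF H[OF that], of r] elim by simp
      hence w: "norm w \<le> M * exp (r * H)" unfolding w_def by (rule F_halfplane[OF _ M'])
      show ?case
      proof (cases "w = 0")
        case False
        hence "ln (norm w) \<le> ln (M * exp (r * H))" using w M(1) by (subst ln_le_cancel_iff) auto
        also have "\<dots> = ln M + r * H" using M(1) by (simp add: ln_mult)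
        finally have "ln (norm w) / r \<le> (ln M + r * H) / r" using elim by (intro divide_right_mono) auto
        also have "\<dots> = ln M / r + H" using elim by (simp add: add_divide_distrib)
        finally show ?thesis using False by (simp add: w_def Let_def)
      qed (simp add: w_def Let_def)
    qed
  qed
  also have "\<dots> = ereal H"
  proof (rule lim_imp_Limsup)
    have "((\<lambda>r. ln M / r + H) \<longlongrightarrow> 0 + H) at_top"
      by (intro tendsto_intros tendsto_divide_0[OF tendsto_const] filterlim_at_top_imp_at_infinity filterlim_ident)
    thus "((\<lambda>r. ereal (ln M / r + H)) \<longlongrightarrow> ereal H) at_top" by simp
  qed auto
  finally show "Limsup at_top ?v \<le> ereal H" .
qed

text \<open>If the indicator were smaller, some \<open>h\<close> in between would bound
  \<open>F\<close> by \<open>M * exp (h * r)\<close> at height \<open>r\<close> times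
  \<open>y\<close> for all \<open>x\<close> at once. The coefficient on the real space would then be
  at most \<open>M * exp (r * (h + y \<bullet> l))\<close> in norm, which tends to 0.\<close>

lemma le_P_indicator:
  assumes l: "coef (\<lambda>x. F (cvec x)) l \<noteq> 0"
  shows "ereal (l \<bullet> - y) \<le> P_indicator F y"
proof (rule ccontr)
  assume "\<not> ?thesis"
  hence "P_indicator F y < ereal (- (y \<bullet> l))" by (simp add: inner_commute)
  then obtain h where h: "P_indicator F y < ereal h" "ereal h < ereal (- (y \<bullet> l))"
    using ereal_dense2 by blast
  have hl: "h + y \<bullet> l < 0" using h(2) by simp
  obtain M where M: "M > 0" "\<And>z. norm (F z) \<le> M * exp (C * norm (imvec z))" using F_bound by blast
  have imv: "imvec (cvec x + w *s cvec y) = Im w *\<^sub>R y" for x w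
    by (simp add: imvec_def cvec_def vec_eq_iff)
  have eqr: "cvec x + (\<i> * complex_of_real r) *s cvec y = cvec x + \<i> *s cvec (r *\<^sub>R y)" for x r
    by (simp add: cvec_def vec_eq_iff)
  have growth: "norm (F (cvec x + \<i> *s cvec (r *\<^sub>R y))) \<le> M * exp (h * r)" if r: "r \<ge> 0" for x r
  proof -
    define f where "f = (\<lambda>w. F (cvec x + w *s cvec y))"
    have f: "f holomorphic_on UNIV" unfolding f_def by (rule holomorphic_F_line)
    have fM: "norm (f w) \<le> M * exp ((C * norm y) * Im w)" if "Im w \<ge> 0" for w
      using M(2)[of "cvec x + w *s cvec y"] that unfolding f_def imv by (simp add: mult_ac)
    let ?v = "\<lambda>r. let w = F (cvec x + \<i> *s cvec (r *\<^sub>R y)) in if w = 0 then -\<infinity> else ereal (ln (norm w) / r)"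
    have "Limsup at_top ?v \<le> P_indicator F y"
      unfolding P_indicator_def by (rule SUP_upper) simp
    hence "Limsup at_top ?v < ereal h" using h(1) by simp
    hence "\<forall>\<^sub>F r in at_top. ?v r < ereal h" by (rule Limsup_lessD)
    hence "\<forall>\<^sub>F r in at_top. norm (f (\<i> * complex_of_real r)) \<le> exp (h * r)"
      using eventually_gt_0
    proof eventually_elim
      case (elim r)
      show ?case
      proof (cases "f (\<i> * complex_of_real r) = 0")
        case False
        hence "ln (norm (f (\<i> * complex_of_real r))) / r < h"
          using elim(1) unfolding f_def eqr by (simp add: Let_def)
        hence "ln (norm (f (\<i> * complex_of_real r))) < h * r" using elim(2) by (simp add: pos_divide_less_eq)
        hence "exp (ln (norm (f (\<i> * complex_of_real r)))) \<le> exp (h * r)" by simp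
        thus ?thesis using False by simp
      qed simp
    qed
    then obtain R where R: "\<And>r. r \<ge> R \<Longrightarrow> norm (f (\<i> * complex_of_real r)) \<le> exp (h * r)"
      unfolding eventually_at_top_linorder by blast
    \<comment> \<open>The limsup controls the ray beyond some \<open>R\<close> that depends on
      \<open>x\<close>; \<open>K\<close> absorbs the initial segment and is discarded again by
      Phragmen-Lindelof.\<close>
    define K where "K = M * exp ((C * norm y) * \<bar>R\<bar>) * exp (\<bar>h\<bar> * \<bar>R\<bar>)"
    have K: "K \<ge> 0" using M(1) by (simp add: K_def)
    have ray: "norm (f (\<i> * complex_of_real v)) \<le> (K + 1) * exp (h * v)" if v: "v \<ge> 0" for v
    proof (cases "v \<ge> R")
      case True
      have "exp (h * v) * 1 \<le> exp (h * v) * (K + 1)" using K by (intro mult_left_mono) auto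
      thus ?thesis using R[OF True] by (simp only: mult.commute mult_1_right)
    next
      case False
      hence vR: "v \<le> \<bar>R\<bar>" by linarith
      have "norm (f (\<i> * complex_of_real v)) \<le> M * exp ((C * norm y) * v)" using fM[of "\<i> * complex_of_real v"] v by simp
      also have "\<dots> \<le> M * exp ((C * norm y) * \<bar>R\<bar>)" using vR M(1) C0 by (simp add: mult_left_mono)
      also have "\<dots> = K * exp (- (\<bar>h\<bar> * \<bar>R\<bar>))" by (simp add: K_def mult.assoc exp_add[symmetric])
      also have "\<dots> \<le> K * exp (h * v)"
      proof -
        have "\<bar>h * v\<bar> \<le> \<bar>h\<bar> * \<bar>R\<bar>" using vR v by (simp add: abs_mult mult_left_mono)
        hence "- (\<bar>h\<bar> * \<bar>R\<bar>) \<le> h * v" by linarith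
        thus ?thesis using K by (intro mult_left_mono) auto
      qed
      also have "\<dots> \<le> (K + 1) * exp (h * v)" by (simp add: distrib_right)
      finally show ?thesis .
    qed
    have "norm (f (\<i> * complex_of_real r)) \<le> M * exp (h * Im (\<i> * complex_of_real r))"
      by (rule phragmen_lindelof_halfplane[OF f _ fM ray]) (use C0 r in auto)
    thus ?thesis unfolding f_def eqr by simp
  qed
  define a where "a = norm (coef (\<lambda>x. F (cvec x)) l)"
  have a_le: "a \<le> M * exp (r * (h + y \<bullet> l))" if r: "r \<ge> 0" for r
  proof -
    have "norm (coef (\<lambda>x. F (cvec x + \<i> *s cvec (r *\<^sub>R y))) l) \<le> M * exp (h * r)"
      by (intro norm_coef_le ap_F_horizontal growth r)
    hence "exp (- (r * (y \<bullet> l))) * a \<le> M * exp (h * r)"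
      unfolding coef_F_horizontal norm_mult a_def by simp
    hence "exp (r * (y \<bullet> l)) * (exp (- (r * (y \<bullet> l))) * a) \<le> exp (r * (y \<bullet> l)) * (M * exp (h * r))"
      by (intro mult_left_mono) auto
    moreover have "exp (r * (y \<bullet> l)) * (exp (- (r * (y \<bullet> l))) * a) = a"
      by (simp add: exp_minus)
    moreover have "exp (r * (y \<bullet> l)) * (M * exp (h * r)) = M * exp (r * (h + y \<bullet> l))"
      by (simp add: distrib_left exp_add mult_ac)
    ultimately show ?thesis by simp
  qed
  have "((\<lambda>r. M * exp (r * (h + y \<bullet> l))) \<longlongrightarrow> M * 0) at_top"
  proof (intro tendsto_intros)
    have "filterlim (\<lambda>r. (h + y \<bullet> l) * r) at_bot at_top"
      by (rule filterlim_tendsto_neg_mult_at_bot[OF tendsto_const hl filterlim_ident])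
    hence "filterlim (\<lambda>r. r * (h + y \<bullet> l)) at_bot at_top" by (simp only: mult.commute)
    thus "((\<lambda>r. exp (r * (h + y \<bullet> l))) \<longlongrightarrow> 0) at_top"
      by (rule filterlim_compose[OF exp_at_bot])
  qed
  hence "a \<le> M * 0"
  proof (rule tendsto_lowerbound)
    show "\<forall>\<^sub>F r in at_top. a \<le> M * exp (r * (h + y \<bullet> l))"
      using eventually_gt_0 by eventually_elim (rule a_le, simp)
  qed auto
  thus False using l by (simp add: a_def)
qed

text \<open>The upper bound is tested against all real numbers above the support function, which
  also covers the value \<open>-\<infinity>\<close> for an empty spectrum.\<close>

lemma P_indicator_F:
  assumes sp: "\<And>n. \<Lambda> n \<subseteq> S" "S = {l. coef (\<lambda>x. F (cvec x)) l \<noteq> 0}"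
  shows "P_indicator F y = support_fn S (- y)"
proof (rule antisym)
  show "P_indicator F y \<le> support_fn S (- y)"
  proof (rule ereal_le_real)
    fix H assume H: "support_fn S (- y) \<le> ereal H"
    show "P_indicator F y \<le> ereal H"
    proof (rule P_indicator_le)
      fix n l assume "l \<in> \<Lambda> n"
      hence "l \<in> S" using sp(1) by blast
      hence "ereal (l \<bullet> - y) \<le> support_fn S (- y)" unfolding support_fn_def by (rule SUP_upper)
      from order_trans[OF this H] show "- (y \<bullet> l) \<le> H" by (simp add: inner_commute)
    qed
  qed
  show "support_fn S (- y) \<le> P_indicator F y"
    unfolding support_fn_def using le_P_indicator by (intro SUP_least) (simp add: sp(2))
qed

end

text \<open>Lebesgue's differentiation theorem for cubes with a corner at \<open>x\<close>: the
  averages of the difference vanish for all small sides, and almost everywhere they converge to its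
  value.\<close>

lemma eq_of_boxmean_eq:
  fixes f g :: "real^'m \<Rightarrow> complex"
  assumes f: "locally_integrable f" and g: "locally_integrable g"
    and eq: "\<And>d x. 0 < d \<Longrightarrow> d \<le> 1 \<Longrightarrow> boxmean d f x = boxmean d g x"
  shows "negligible {x. f x \<noteq> g x}"
proof -
  define h where "h = (\<lambda>x. f x - g x)"
  have li: "locally_integrable h" unfolding h_def by (rule li_diff[OF f g])
  obtain N where N: "negligible N" "\<And>x e. x \<notin> N \<Longrightarrow> 0 < e \<Longrightarrow>
       \<exists>d>0. \<forall>r. 0 < r \<and> r < d \<longrightarrow> norm (integral (cbox x (x + r *\<^sub>R One)) h /\<^sub>R r ^ DIM(real^'m) - h x) < e"
    using integrable_ccontinuous_explicit[OF li_integrable[OF li]] by blast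
  have "h x = 0" if x: "x \<notin> N" for x
  proof (rule ccontr)
    assume "h x \<noteq> 0"
    then obtain d where d: "d > 0" "\<And>r. 0 < r \<Longrightarrow> r < d \<Longrightarrow> norm (integral (cbox x (x + r *\<^sub>R One)) h /\<^sub>R r ^ DIM(real^'m) - h x) < norm (h x)"
      using N(2)[OF x, of "norm (h x)"] by auto
    define r where "r = min (d / 2) 1"
    have r: "0 < r" "r < d" "r \<le> 1" using d(1) by (auto simp: r_def)
    have "boxmean r h x = 0"
      unfolding h_def using eq[OF r(1,3), of x]
      by (subst boxmean_diff) (auto intro: li_integrable f g)
    hence "integral (cbox x (x + r *\<^sub>R One)) h = 0" using r(1) by (simp add: boxmean_translated)
    thus False using d(2)[OF r(1,2)] by simp
  qed
  hence "{x. f x \<noteq> g x} \<subseteq> N" by (auto simp: h_def)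
  thus ?thesis using N(1) negligible_subset by blast
qed

text \<open>On polynomials the cube average is inverted by dividing each coefficient by the
  multiplier \<open>b\<close>, which does not vanish on the ball of radius \<open>C\<close>. That
  the limit agrees with \<open>f\<close> is seen from the cube averages of both for all small
  sides.\<close>

lemma bandlimited_extension:
  fixes f :: "real^'m \<Rightarrow> complex"
  assumes f: "f \<in> borel_measurable borel" and ap: "S1_ap f"
    and C: "\<forall>l\<in>spectrum_ap f. norm l \<le> C" and C0: "C \<ge> 0"
  shows "\<exists>\<Lambda> q. tpoly_limit \<Lambda> q C \<and> (\<forall>n. \<Lambda> n \<subseteq> spectrum_ap f) \<and>
     (\<forall>l. coef (\<lambda>x. tpoly_limit.F \<Lambda> q (cvec x)) l = fourier_coeff f l) \<and>
     negligible {x. f x \<noteq> tpoly_limit.F \<Lambda> q (cvec x)}"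
proof -
  \<comment> \<open>One condition serves two ends: it bounds the inverse of the cube average, and
    since \<open>exp C\<close> exceeds \<open>C\<close> it keeps the multiplier away from 0 on the
    ball.\<close>
  obtain d where d: "d > 0" "d \<le> 1" "d * (CARD('m) * exp C) \<le> 1 / 2"
    using small_box_exists[of "CARD('m) * exp C"] by blast
  define b :: "real^'m \<Rightarrow> complex" where "b = (\<lambda>l. boxmean d (echar l) 0)"
  have b: "b l \<noteq> 0" if l: "norm l \<le> C" for l
  proof -
    have "norm l \<le> exp C" using l exp_ge_add_one_self[of C] by linarith
    hence "d * (CARD('m) * norm l) \<le> d * (CARD('m) * exp C)" using d(1) by (intro mult_left_mono) auto
    hence "d * CARD('m) * norm l \<le> 1 / 2" using d(3) by (simp add: mult.assoc)
    from boxmean_echar_close[OF d(1) this] show ?thesis by (auto simp: b_def)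
  qed
  define g where "g = boxmean d f"
  have g: "ap g" unfolding g_def by (rule ap_boxmean[OF ap d(1,2)])
  have cg: "coef g l = b l * fourier_coeff f l" for l
    unfolding g_def b_def by (rule fourier_coeff_S1_ap(2)[OF f ap d(1,2)])
  have "\<exists>\<Lambda> q. finite \<Lambda> \<and> (\<forall>l\<in>\<Lambda>. coef g l \<noteq> 0) \<and> (\<forall>x. norm (g x - (\<Sum>l\<in>\<Lambda>. q l * echar l x)) \<le> 1 / Suc n)" for n
    using ap_approximation[OF g, of "1 / Suc n"] by (metis of_nat_0_less_iff zero_less_Suc zero_less_divide_1_iff)
  then obtain \<Lambda> q where \<Lambda>: "\<And>n. finite (\<Lambda> n)" "\<And>n l. l \<in> \<Lambda> n \<Longrightarrow> coef g l \<noteq> 0"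
    and q: "\<And>n x. norm (g x - (\<Sum>l\<in>\<Lambda> n. q n l * echar l x)) \<le> 1 / Suc n" by metis
  have sp: "\<Lambda> n \<subseteq> spectrum_ap f" for n using \<Lambda>(2) by (auto simp: cg spectrum_ap_def)
  have nl: "norm l \<le> C" if "l \<in> \<Lambda> n" for l n using sp C that by blast
  define r where "r = (\<lambda>n l. q n l / b l)"
  have bm: "boxmean d (\<lambda>x. tpoly (\<Lambda> n) (r n) (cvec x)) x = (\<Sum>l\<in>\<Lambda> n. q n l * echar l x)" for n x
    unfolding tpoly_cvec boxmean_trig using b nl by (intro sum.cong) (auto simp: r_def b_def)
  have cont: "continuous_on UNIV (\<lambda>x. tpoly \<Lambda>' q' (cvec x))" for \<Lambda>' :: "(real^'m) set" and q'
    unfolding tpoly_cvec by (intro continuous_intros)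
  interpret L: tpoly_limit \<Lambda> r C
  proof
    fix n m x
    define s where "s = (\<lambda>l. (if l \<in> \<Lambda> n then r n l else 0) - (if l \<in> \<Lambda> m then r m l else 0))"
    have f: "finite (\<Lambda> n \<union> \<Lambda> m)" using \<Lambda>(1) by simp
    have s: "tpoly (\<Lambda> n \<union> \<Lambda> m) s z = tpoly (\<Lambda> n) (r n) z - tpoly (\<Lambda> m) (r m) z" for z
      using tpoly_extend[OF f, of "\<Lambda> n" "r n"] tpoly_extend[OF f, of "\<Lambda> m" "r m"]
      by (simp add: tpoly_diff s_def)
    have "norm (tpoly (\<Lambda> n \<union> \<Lambda> m) s (cvec x)) \<le> 2 * (1 / Suc n + 1 / Suc m)"
    proof (rule tpoly_sup_le_boxmean[OF _ C0 f d(1)])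
      fix x
      have "boxmean d (\<lambda>x. tpoly (\<Lambda> n \<union> \<Lambda> m) s (cvec x)) x = (\<Sum>l\<in>\<Lambda> n. q n l * echar l x) - (\<Sum>l\<in>\<Lambda> m. q m l * echar l x)"
        unfolding s by (subst boxmean_diff) (simp_all add: bm integrable_continuous_UNIV cont)
      moreover have "norm ((\<Sum>l\<in>\<Lambda> n. q n l * echar l x) - (\<Sum>l\<in>\<Lambda> m. q m l * echar l x)) \<le>
         norm (g x - (\<Sum>l\<in>\<Lambda> n. q n l * echar l x)) + norm (g x - (\<Sum>l\<in>\<Lambda> m. q m l * echar l x))" by norm
      ultimately show "norm (boxmean d (\<lambda>x. tpoly (\<Lambda> n \<union> \<Lambda> m) s (cvec x)) x) \<le> 1 / Suc n + 1 / Suc m"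
        using q[of x n] q[of x m] by simp
    qed (use nl d in \<open>auto simp: mult.assoc\<close>)
    thus "norm (tpoly (\<Lambda> n) (r n) (cvec x) - tpoly (\<Lambda> m) (r m) (cvec x)) \<le> 2 / Suc n + 2 / Suc m"
      unfolding s by simp
  qed (use \<Lambda> nl C0 in auto)
  define Fr where "Fr = (\<lambda>x. L.F (cvec x))"
  have apF: "ap Fr" unfolding Fr_def by (rule L.ap_F)
  have S1F: "S1_ap Fr" by (rule ap_imp_S1_ap[OF apF])
  have FB: "Fr \<in> borel_measurable borel" by (rule borel_measurable_continuous_onI[OF ap_continuous[OF apF]])
  \<comment> \<open>The limit averages back to \<open>g\<close>: the error \<open>3 / Suc n\<close>
    adds \<open>2 / Suc n\<close> from the limit and \<open>1 / Suc n\<close> from the approximation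
    of \<open>g\<close>.\<close>
  have bF: "boxmean d Fr x = g x" for x
  proof -
    have "norm (boxmean d Fr x - g x) \<le> 3 / Suc n" for n
    proof -
      have "norm (boxmean d (\<lambda>x. tpoly (\<Lambda> n) (r n) (cvec x) - Fr x) x) \<le> 2 / Suc n"
      proof (rule boxmean_le)
        show "continuous_on UNIV (\<lambda>x. tpoly (\<Lambda> n) (r n) (cvec x) - Fr x)"
          by (intro continuous_intros cont ap_continuous apF)
        fix u show "norm (tpoly (\<Lambda> n) (r n) (cvec (x + u)) - Fr (x + u)) \<le> 2 / Suc n"
          using L.tpoly_close_F[of n "cvec (x + u)"] by (simp add: Fr_def)
      qed (rule d)
      moreover have "boxmean d (\<lambda>x. tpoly (\<Lambda> n) (r n) (cvec x) - Fr x) x = (\<Sum>l\<in>\<Lambda> n. q n l * echar l x) - boxmean d Fr x"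
        by (subst boxmean_diff) (simp_all add: bm integrable_continuous_UNIV cont ap_continuous apF)
      moreover have "norm (boxmean d Fr x - g x) \<le> norm ((\<Sum>l\<in>\<Lambda> n. q n l * echar l x) - boxmean d Fr x) + norm (g x - (\<Sum>l\<in>\<Lambda> n. q n l * echar l x))"
        by norm
      ultimately have "norm (boxmean d Fr x - g x) \<le> 2 / Suc n + 1 / Suc n" using q[of x n] by simp
      thus ?thesis by (simp add: add_divide_distrib[symmetric])
    qed
    moreover have "(\<lambda>n. 3 / real (Suc n)) \<longlonglongrightarrow> 0" by (rule LIMSEQ_Suc[OF lim_const_over_n])
    ultimately have "norm (boxmean d Fr x - g x) \<le> 0" by (intro LIMSEQ_le_const) auto
    thus ?thesis by simp
  qed
  \<comment> \<open>Inside the ball the multiplier can be divided out; outside it both coefficients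
    vanish.\<close>
  have cF: "coef Fr l = fourier_coeff f l" for l
  proof (cases "norm l \<le> C")
    case True
    have "boxmean d Fr = g" using bF by (simp add: fun_eq_iff)
    hence "coef g l = b l * fourier_coeff Fr l"
      using fourier_coeff_S1_ap(2)[OF FB S1F d(1,2), of l] by (simp add: b_def)
    thus ?thesis using cg[of l] b[OF True] by (simp add: coef_eq_fourier_coeff)
  next
    case False
    hence "coef Fr l = 0" unfolding Fr_def using nl by (intro L.coef_F_outside) auto
    moreover have "fourier_coeff f l = 0" using C False by (auto simp: spectrum_ap_def)
    ultimately show ?thesis by simp
  qed
  have "negligible {x. f x \<noteq> Fr x}"
  proof (rule eq_of_boxmean_eq)
    show "locally_integrable f" "locally_integrable Fr" using ap S1F by (auto simp: S1_ap_def)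
    \<comment> \<open>The side \<open>e\<close> now varies, whereas the construction used the single
      side \<open>d\<close>; equal coefficients make the averages equal for each side by
      uniqueness.\<close>
    fix e :: real and x assume e: "0 < e" "e \<le> 1"
    have a: "ap (boxmean e f)" "ap (boxmean e Fr)" by (rule ap_boxmean[OF _ e], rule ap S1F)+
    have "boxmean e f x - boxmean e Fr x = 0"
    proof (rule ap_uniqueness[OF ap_diff[OF a]])
      fix l
      show "coef (\<lambda>x. boxmean e f x - boxmean e Fr x) l = 0"
        using fourier_coeff_S1_ap(2)[OF f ap e, of l] fourier_coeff_S1_ap(2)[OF FB S1F e, of l] cF[of l] coef_diff[OF a, of l]
        by (simp add: coef_eq_fourier_coeff)
    qed
    thus "boxmean e f x = boxmean e Fr x" by simp
  qed
  with L.tpoly_limit_axioms sp cF show ?thesis unfolding Fr_def by blast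
qed

theorem theorem5:
  fixes f :: "real^'m \<Rightarrow> complex" and p C :: real
  assumes "p \<ge> 1"
    and "stepanoff_ap p f"
    and "\<forall>l\<in>spectrum_ap f. norm l \<le> C"
  shows "\<exists>F :: complex^'m \<Rightarrow> complex.
           entire_fn F \<and> exponential_type F \<and>
           (AE x in lborel. F (cvec x) = f x) \<and>
           (\<forall>K. bounded K \<longrightarrow> bohr_ap_tube K F) \<and>
           (\<forall>y l. (dirichlet_avg F y l \<longlongrightarrow> fourier_coeff f l) at_top) \<and>
           (\<forall>y. P_indicator F y = support_fn (spectrum_ap f) (- y))"
proof -
  have S1: "S1_ap f" by (rule stepanoff_imp_S1_ap[OF assms(1,2)])
  hence "f \<in> borel_measurable lebesgue" by (intro li_measurable) (simp add: S1_ap_def)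
  \<comment> \<open>A change on a null set alters none of the integrals, so the coefficients and the
    spectrum remain those of \<open>f\<close>.\<close>
  then obtain f' where f': "f' \<in> borel_measurable borel" "negligible {x. f x \<noteq> f' x}"
    by (rule borel_representative)
  have S1': "S1_ap f'" by (rule S1_ap_spike[OF S1 f'(2)])
  have "fourier_avg f l N = fourier_avg f' l N" for l N
  proof -
    have "integral (cbox (- (N *\<^sub>R One)) (N *\<^sub>R One)) (\<lambda>x. f x * exp (- \<i> * complex_of_real (x \<bullet> l))) =
      integral (cbox (- (N *\<^sub>R One)) (N *\<^sub>R One)) (\<lambda>x. f' x * exp (- \<i> * complex_of_real (x \<bullet> l)))"
      by (rule integral_spike[OF f'(2)]) auto
    thus ?thesis by (simp add: fourier_avg_def)
  qed
  hence coeff: "fourier_coeff f l = fourier_coeff f' l" for l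
    unfolding fourier_coeff_def by (intro arg_cong[of _ _ "Lim at_top"] ext)
  hence sp: "spectrum_ap f = spectrum_ap f'" by (simp add: spectrum_ap_def)
  \<comment> \<open>\<open>C\<close> may be negative when the spectrum is empty, whereas the tube
    bounds work with a nonnegative radius.\<close>
  have C: "\<forall>l\<in>spectrum_ap f'. norm l \<le> max C 0" using assms(3) sp by force
  obtain \<Lambda> q where L: "tpoly_limit \<Lambda> q (max C 0)" "\<And>n. \<Lambda> n \<subseteq> spectrum_ap f'"
    "\<And>l. coef (\<lambda>x. tpoly_limit.F \<Lambda> q (cvec x)) l = fourier_coeff f' l"
    "negligible {x. f' x \<noteq> tpoly_limit.F \<Lambda> q (cvec x)}"
    using bandlimited_extension[OF f'(1) S1' C] by auto
  interpret tpoly_limit \<Lambda> q "max C 0" by (rule L(1))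
  show ?thesis
  proof (intro exI[of _ F] conjI allI impI)
    show "entire_fn F" by (rule entire_F)
    show "exponential_type F" by (rule exponential_type_F)
    have "AE x in lborel. f x = f' x" "AE x in lborel. f' x = F (cvec x)"
      using f'(2) L(4) negligible_iff_AE_lborel[of "\<lambda>x. f x = f' x"] negligible_iff_AE_lborel[of "\<lambda>x. f' x = F (cvec x)"] by auto
    thus "AE x in lborel. F (cvec x) = f x" by eventually_elim simp
    show "bohr_ap_tube K F" if "bounded K" for K by (rule bohr_F[OF that])
    show "(dirichlet_avg F y l \<longlongrightarrow> fourier_coeff f l) at_top" for y l
      using dirichlet_F[of y l] L(3)[of l] coeff[of l] by simp
    have "spectrum_ap f' = {l. coef (\<lambda>x. F (cvec x)) l \<noteq> 0}" by (simp add: spectrum_ap_def L(3))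
    from P_indicator_F[OF L(2) this] show "P_indicator F y = support_fn (spectrum_ap f) (- y)" for y
      by (simp add: sp)
  qed
qed

end
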